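(* Let $p>2$. There is a constant $c>1$ such that, for real matrices $A\in\mathbb{R}^{n\times d}$ of rank $r$, there is an $(O(n^{1-2/p}r^2\log n),c)$-sketching family for the $2\to p$ norm.
   Context: For $A\in\mathbb{R}^{n\times d}$, $\|A\|_{2\to p}=\sup_{x\ne0}\frac{\|Ax\|_p}{\|x\|_2}$. A $(k,\alpha)$-sketching family for the $q\to p$ norm (on a class of matrices) is a pair $(\mathcal{S},f)$ where $\mathcal{S}$ is a distribution over linear maps $L:\mathbb{R}^{n\times d}\to\mathbb{R}^k$ and $f:\mathbb{R}^k\to\mathbb{R}$, such that for every $A$ in the class, $\Pr_{L\sim\mathcal{S}}\big[f(L(A))\in(\tfrac1\alpha\|A\|_{q\to p},\,\alpha\|A\|_{q\to p})\big]\ge \frac56$. *)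

theory Defs
  imports "HOL-Probability.Probability" "Jordan_Normal_Form.DL_Rank"
begin

definition lp_norm :: "real \<Rightarrow> real Matrix.vec \<Rightarrow> real" where
  "lp_norm p v = (\<Sum>i<dim_vec v. \<bar>vec_index v i\<bar> powr p) powr (1 / p)"

text \<open>The supremum is taken in the reals: it is the intended one when the matrix has at
  least one column, since the set of quotients is then nonempty and bounded.\<close>

definition op_norm :: "real \<Rightarrow> real \<Rightarrow> real Matrix.mat \<Rightarrow> real" where
  "op_norm q p A =
     (SUP x \<in> carrier_vec (dim_col A) - {0\<^sub>v (dim_col A)}. lp_norm p (A *\<^sub>v x) / lp_norm q x)"

text \<open>Functions are restricted to the carrier by \<^const>\<open>extensional\<close>, so that
  every linear map occurs exactly once.\<close>

definition linear_maps :: "nat \<Rightarrow> nat \<Rightarrow> nat \<Rightarrow> (real Matrix.mat \<Rightarrow> real Matrix.vec) set" where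
  "linear_maps n d k =
     {L \<in> extensional (carrier_mat n d).
        linear_map class_ring (module_mat TYPE(real) n d) (module_vec TYPE(real) k) L}"

text \<open>The sigma-algebra generated by the coordinates of the evaluations at all matrices; it is
  the Borel sigma-algebra of this finite-dimensional space of linear maps.\<close>

definition linear_maps_algebra ::
    "nat \<Rightarrow> nat \<Rightarrow> nat \<Rightarrow> (real Matrix.mat \<Rightarrow> real Matrix.vec) measure" where
  "linear_maps_algebra n d k =
     sigma (linear_maps n d k)
       {{L \<in> linear_maps n d k. vec_index (L A) i \<in> B} | A i B.
          A \<in> carrier_mat n d \<and> i < k \<and> B \<in> sets borel}"

text \<open>\<open>f\<close> is an arbitrary function, of which only the values on vectors of dimension \<open>k\<close>
  matter. The success event is nevertheless measurable whenever the inequality holds, because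
  \<^const>\<open>measure\<close> is 0 on non-measurable sets.\<close>

definition sketching_family ::
    "nat \<Rightarrow> nat \<Rightarrow> nat \<Rightarrow> real \<Rightarrow> real \<Rightarrow> real \<Rightarrow> real Matrix.mat set
     \<Rightarrow> (real Matrix.mat \<Rightarrow> real Matrix.vec) measure \<Rightarrow> (real Matrix.vec \<Rightarrow> real) \<Rightarrow> bool" where
  "sketching_family n d k \<alpha> q p \<A> S f \<longleftrightarrow>
     prob_space S \<and>
     space S = linear_maps n d k \<and> sets S = sets (linear_maps_algebra n d k) \<and>
     (\<forall>A \<in> \<A>. measure S {L \<in> space S.
         f (L A) \<in> {1 / \<alpha> * op_norm q p A <..< \<alpha> * op_norm q p A}} \<ge> 5 / 6)"

end

theory Submission
  imports Defs
begin

text \<open>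
  A random sign matrix \<open>G\<close> with \<open>m = O(r)\<close> columns compresses \<open>A\<close> to \<open>AG\<close>, and the
  maximum of \<open>\<parallel>AGx\<parallel>\<^sub>p\<close> over sign vectors \<open>x\<close> is \<open>\<Theta>(m)\<close> times the operator norm. The lower bound needs
  only one direction: if \<open>\<phi>\<close> norms \<open>Au\<close> for a near-maximiser \<open>u\<close> and \<open>v = A\<^sup>T\<phi>\<close>, then the sign pattern
  of \<open>G\<^sup>Tv\<close> gives \<open>\<parallel>AGx\<parallel>\<^sub>p \<ge> \<parallel>G\<^sup>Tv\<parallel>\<^sub>1\<close>. The upper bound is a union bound over the \<open>2\<^sup>m\<close> sign vectors,
  each controlled by the exponential moment of the squared length of the projection of \<open>Gx\<close> to the row space.

  A single vector \<open>y\<close> is sketched by \<open>O(n\<^bsup>1-2/p\<^esup> log n)\<close> rows of independent sparse symmetric entries \<open>\<xi>\<close>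
  with \<open>P(\<bar>\<xi>\<bar> \<ge> \<tau>) \<approx> \<tau>\<^bsup>-p\<^esup>/s\<close>. With constant probability the largest modulus of the resulting coordinates
  is comparable to \<open>\<parallel>y\<parallel>\<^sub>p\<close>: from below because some summand is large and the entries are symmetric, from
  above by truncation and a Chernoff bound. Taking medians over \<open>m\<close> independent blocks makes
  the failure probability of the upper bound small enough for a union bound over the sign vectors.
  No net of the unit sphere is needed since only the \<open>2\<^sup>m\<close> sign vectors are evaluated.
\<close>

section \<open>Events in products of probability mass functions\<close>

text \<open>The two sides of the estimate are not symmetric, and this fixes the sizes. From below,
  one good sign vector seen by a majority of blocks is enough, so a constant failure probability and
  Markov's inequality suffice. From above, all \<open>2^m\<close> sign vectors must be controlled at
  once, so the failure for each has to be exponentially small in \<open>m\<close>; this is bought by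
  using as many blocks as \<open>G\<close> has columns. The sketch consists of the entries of
  \<open>H_t A G\<close> for \<open>m\<close> blocks \<open>H_t\<close> of \<open>32 * s\<close>
  rows each, with \<open>m = 40 * r\<close>: both factors \<open>r\<close> in the size come from
  here, one from the columns and one from the blocks. The obstacle inside a block is that
  heavy-tailed sums must stay below a constant multiple of the \<open>p\<close>-norm in all
  \<open>32 * s\<close> rows simultaneously. After truncation at a constant level the Chernoff bound
  needs a slope of order \<open>ln n\<close>. Its variance term is then of order
  \<open>(ln n)^2 * n powr (1 - 2 / p) / s\<close>, and keeping it of order \<open>ln n\<close> is
  what forces the logarithm into \<open>s\<close>.\<close>

text \<open>Fubini in the first coordinate, with the inner probability estimated by 1 on
  \<open>B\<close>. It separates the two sources of randomness: the heavy rows are analysed for a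
  fixed sign matrix outside a bad set.\<close>

lemma measure_pair_pmf_le:
  assumes "\<And>g. g \<in> set_pmf P \<Longrightarrow> g \<notin> B \<Longrightarrow> measure_pmf.prob Q {h. E g h} \<le> \<epsilon>" "\<epsilon> \<ge> 0"
  shows "measure_pmf.prob (pair_pmf P Q) {(g, h). E g h} \<le> measure_pmf.prob P B + \<epsilon>"
proof -
  have "emeasure (pair_pmf P Q) {(g, h). E g h} =
      (\<integral>\<^sup>+ g. emeasure Q {h. E g h} \<partial>measure_pmf P)"
    by (simp add: pair_pmf_def indicator_def of_bool_def if_distrib cong: if_cong)
       (simp add: nn_integral_indicator[symmetric] indicator_def of_bool_def del: nn_integral_indicator)
  also have "\<dots> \<le> (\<integral>\<^sup>+ g. indicator B g + ennreal \<epsilon> \<partial>measure_pmf P)"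
  proof (rule nn_integral_mono_AE, rule AE_pmfI)
    fix g assume g: "g \<in> set_pmf P"
    show "emeasure Q {h. E g h} \<le> indicator B g + ennreal \<epsilon>"
    proof (cases "g \<in> B")
      case True
      have "emeasure Q {h. E g h} \<le> 1" by (rule measure_pmf.emeasure_le_1)
      with True show ?thesis by (simp add: add_increasing2)
    next
      case False
      with assms(1)[OF g] show ?thesis
        by (simp add: measure_pmf.emeasure_eq_measure ennreal_leI)
    qed
  qed
  also have "\<dots> = emeasure P B + ennreal \<epsilon>"
    by (subst nn_integral_add) auto
  also have "\<dots> = ennreal (measure_pmf.prob P B + \<epsilon>)"
    using assms(2) by (simp add: measure_pmf.emeasure_eq_measure)
  finally show ?thesis
    using assms(2) by (simp add: measure_pmf.emeasure_eq_measure flip: ennreal_plus)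
qed

text \<open>Markov's inequality for the number of bad indices, whose mean is at most
  \<open>T * \<delta>\<close>; no independence is involved.\<close>

lemma measure_half_le:
  fixes P :: "'a pmf"
  assumes "\<And>t. t < T \<Longrightarrow> measure_pmf.prob P {h. B t h} \<le> \<delta>" "T > 0"
  shows "measure_pmf.prob P {h. T \<le> 2 * card {t. t < T \<and> B t h}} \<le> 2 * \<delta>"
proof -
  let ?X = "\<lambda>h. real (card {t. t < T \<and> B t h})"
  have X: "?X h = (\<Sum>t<T. indicator {h. B t h} h)" for h
    by (subst card_eq_sum) (auto simp: indicator_def sum.If_cases Int_def)
  have int: "integrable (measure_pmf P) ?X"
    unfolding X
    by (intro Bochner_Integration.integrable_sum measure_pmf.integrable_const_bound[where B=1]) auto
  have "measure_pmf.prob P {h. T \<le> 2 * card {t. t < T \<and> B t h}} \<le> measure_pmf.prob P {h \<in> space P. ?X h \<ge> real T / 2}"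
    by (intro measure_pmf.finite_measure_mono) auto
  also have "\<dots> \<le> measure_pmf.expectation P ?X / (real T / 2)"
    by (rule integral_Markov_inequality_measure[where A="{}"]) (use int assms in auto)
  also have "measure_pmf.expectation P ?X = (\<Sum>t<T. measure_pmf.prob P {h. B t h})"
    unfolding X
    by (subst Bochner_Integration.integral_sum) (auto intro!: measure_pmf.integrable_const_bound[where B=1])
  also have "\<dots> \<le> (\<Sum>t<T. \<delta>)" by (intro sum_mono assms) auto
  finally show ?thesis using assms(2) by (simp add: field_simps)
qed

lemma measure_Pi_pmf_ball:
  assumes "finite A" "J \<subseteq> A"
  shows "measure_pmf.prob (Pi_pmf A d (\<lambda>_. p)) {h. \<forall>t\<in>J. B (h t)} = measure_pmf.prob p {x. B x} ^ card J"
proof -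
  have "{h. \<forall>t\<in>J. B (h t)} = Pi A (\<lambda>t. if t \<in> J then {x. B x} else UNIV)"
    using assms(2) by (auto simp: Pi_def subset_iff split: if_splits)
  then have "measure_pmf.prob (Pi_pmf A d (\<lambda>_. p)) {h. \<forall>t\<in>J. B (h t)} =
     (\<Prod>t\<in>A. measure_pmf.prob p (if t \<in> J then {x. B x} else UNIV))"
    by (simp only: measure_Pi_pmf_Pi[OF assms(1)])
  also have "\<dots> = (\<Prod>t\<in>A. if t \<in> J then measure_pmf.prob p {x. B x} else 1)"
    by (intro prod.cong) auto
  also have "\<dots> = measure_pmf.prob p {x. B x} ^ card J"
    using assms by (simp add: prod.If_cases Int_absorb1)
  finally show ?thesis .
qed

lemma Pi_pmf_component_prob:
  assumes "finite A" "t \<in> A"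
  shows "measure_pmf.prob (Pi_pmf A d (\<lambda>_. p)) {h. B (h t)} = measure_pmf.prob p {x. B x}"
  using measure_Pi_pmf_ball[OF assms(1), of "{t}" d p B] assms by simp

text \<open>Union bound over the at most \<open>2 ^ T\<close> sets \<open>J\<close> with
  \<open>T \<le> 2 * card J\<close>. The hypothesis is stated as a square so that
  \<open>T / 2\<close> or more independent factors give \<open>\<delta> ^ T\<close> without
  roots.\<close>

lemma measure_half_bad_le:
  assumes "measure_pmf.prob p {x. B x} \<le> \<delta>\<^sup>2" "\<delta> \<ge> 0" "\<delta> \<le> 1"
  shows "measure_pmf.prob (Pi_pmf {..<T} d (\<lambda>_. p)) {h. T \<le> 2 * card {t. t < T \<and> B (h t)}} \<le> (2 * \<delta>) ^ T"
proof -
  let ?J = "{J. J \<subseteq> {..<T} \<and> T \<le> 2 * card J}"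
  have fin: "finite ?J" by auto
  have "measure_pmf.prob (Pi_pmf {..<T} d (\<lambda>_. p)) {h. T \<le> 2 * card {t. t < T \<and> B (h t)}}
     \<le> measure_pmf.prob (Pi_pmf {..<T} d (\<lambda>_. p)) (\<Union>J\<in>?J. {h. \<forall>t\<in>J. B (h t)})"
  proof (intro measure_pmf.finite_measure_mono subsetI)
    fix h assume h: "h \<in> {h. T \<le> 2 * card {t. t < T \<and> B (h t)}}"
    show "h \<in> (\<Union>J\<in>?J. {h. \<forall>t\<in>J. B (h t)})"
      by (rule UN_I[of "{t. t < T \<and> B (h t)}"]) (use h in auto)
  qed auto
  also have "\<dots> \<le> (\<Sum>J\<in>?J. measure_pmf.prob (Pi_pmf {..<T} d (\<lambda>_. p)) {h. \<forall>t\<in>J. B (h t)})"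
    using fin by (intro measure_pmf.finite_measure_subadditive_finite) auto
  also have "\<dots> \<le> (\<Sum>J\<in>?J. \<delta> ^ T)"
  proof (rule sum_mono)
    fix J assume J: "J \<in> ?J"
    then have "measure_pmf.prob (Pi_pmf {..<T} d (\<lambda>_. p)) {h. \<forall>t\<in>J. B (h t)} = measure_pmf.prob p {x. B x} ^ card J"
      by (intro measure_Pi_pmf_ball) auto
    also have "\<dots> \<le> (\<delta>\<^sup>2) ^ card J" by (intro power_mono assms) auto
    also have "\<dots> = \<delta> ^ (2 * card J)" by (simp add: power_mult)
    also have "\<dots> \<le> \<delta> ^ T" using J assms by (intro power_decreasing) auto
    finally show "measure_pmf.prob (Pi_pmf {..<T} d (\<lambda>_. p)) {h. \<forall>t\<in>J. B (h t)} \<le> \<delta> ^ T" .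
  qed
  also have "\<dots> = real (card ?J) * \<delta> ^ T" by simp
  also have "\<dots> \<le> 2 ^ T * \<delta> ^ T"
  proof -
    have "card ?J \<le> card (Pow {..<T})" by (intro card_mono) auto
    then have "real (card ?J) \<le> 2 ^ T" by (simp add: card_Pow)
    then show ?thesis using assms by (intro mult_right_mono) auto
  qed
  finally show ?thesis by (simp add: power_mult_distrib)
qed

section \<open>Sparse heavy-tailed entries\<close>

text \<open>With \<open>j\<close> uniform on \<open>{1..sN}\<close>, the ratio \<open>j/N\<close> plays the role of a uniform variable conditioned
  on an event of probability \<open>1/s\<close>, and \<open>(N/j)\<^bsup>1/p\<^esup>\<close> that of a Pareto variable; \<open>N = 2n\<close> grid points
  suffice for vectors of length \<open>n\<close>.\<close>

definition heavy_value :: "real \<Rightarrow> nat \<Rightarrow> nat \<Rightarrow> real" where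
  "heavy_value p N j = (if j \<le> N then (real N / real j) powr (1 / p) else 0)"

definition heavy_pmf :: "real \<Rightarrow> nat \<Rightarrow> nat \<Rightarrow> real pmf" where
  "heavy_pmf p N s =
     map_pmf (\<lambda>(j, \<sigma>). \<sigma> * heavy_value p N j) (pair_pmf (pmf_of_set {1..s * N}) (pmf_of_set {- 1, 1}))"

lemma finite_set_heavy_pmf:
  assumes "s * N > 0" shows "finite (set_pmf (heavy_pmf p N s))"
  using assms by (auto simp: heavy_pmf_def set_pmf_of_set)

text \<open>Pairing the two signs of one modulus makes the symmetry visible and later turns
  exponentials into \<open>cosh\<close>.\<close>

lemma heavy_expectation:
  assumes "s * N > 0"
  shows "measure_pmf.expectation (heavy_pmf p N s) f =
    (\<Sum>j=1..s*N. (f (heavy_value p N j) + f (- heavy_value p N j)) / 2) / (real s * real N)"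
proof -
  have eq: "pair_pmf (pmf_of_set {1..s * N}) (pmf_of_set {- 1, 1::real}) = pmf_of_set ({1..s * N} \<times> {- 1, 1})"
    using assms by (intro pmf_eqI) (auto simp: pmf_pair pmf_of_set card_cartesian_product indicator_def)
  have "measure_pmf.expectation (heavy_pmf p N s) f =
     (\<Sum>(j,\<sigma>)\<in>{1..s * N} \<times> {- 1, 1}. f (\<sigma> * heavy_value p N j)) / (2 * (real s * real N))"
    unfolding heavy_pmf_def eq using assms
    by (simp add: integral_pmf_of_set card_cartesian_product case_prod_unfold mult_ac)
  also have "(\<Sum>(j,\<sigma>)\<in>{1..s * N} \<times> {- 1, 1}. f (\<sigma> * heavy_value p N j)) =
     (\<Sum>j=1..s*N. \<Sum>\<sigma>\<in>{- 1, 1}. f (\<sigma> * heavy_value p N j))"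
    by (subst sum.cartesian_product) simp
  also have "\<dots> = 2 * (\<Sum>j=1..s*N. (f (heavy_value p N j) + f (- heavy_value p N j)) / 2)"
    unfolding sum_distrib_left by (intro sum.cong) auto
  finally show ?thesis by simp
qed

lemma heavy_prob_abs:
  assumes "s * N > 0" "0 \<notin> B"
  shows "measure_pmf.prob (heavy_pmf p N s) {x. \<bar>x\<bar> \<in> B} =
    real (card {j\<in>{1..N}. heavy_value p N j \<in> B}) / (real s * real N)"
proof -
  have v: "heavy_value p N j \<ge> 0" for j by (auto simp: heavy_value_def)
  have s: "{1..N} \<subseteq> {1..s * N}" using assms by (auto intro: order_trans)
  have "measure_pmf.prob (heavy_pmf p N s) {x. \<bar>x\<bar> \<in> B} = measure_pmf.expectation (heavy_pmf p N s) (indicator {x. \<bar>x\<bar> \<in> B})"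
    by simp
  also have "\<dots> = (\<Sum>j=1..s*N. indicator B (heavy_value p N j)) / (real s * real N)"
    unfolding heavy_expectation[OF assms(1)] using v
    by (simp add: indicator_def of_bool_def abs_of_nonneg)
  also have "(\<Sum>j=1..s*N. indicator B (heavy_value p N j)) = (\<Sum>j=1..N. indicator B (heavy_value p N j) :: real)"
    using assms(2) s by (intro sum.mono_neutral_right) (auto simp: heavy_value_def indicator_def)
  also have "\<dots> = real (card {j\<in>{1..N}. heavy_value p N j \<in> B})"
    by (subst card_eq_sum) (auto simp: indicator_def sum.If_cases Int_def)
  finally show ?thesis .
qed

lemma heavy_symmetric:
  assumes "s * N > 0"
  shows "pmf (heavy_pmf p N s) (- x) = pmf (heavy_pmf p N s) x"
proof -
  have "pmf (heavy_pmf p N s) x = measure_pmf.expectation (heavy_pmf p N s) (indicator {x})" for x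
    by (simp add: measure_pmf_single)
  then show ?thesis
    unfolding heavy_expectation[OF assms]
    by (auto intro!: sum.cong arg_cong2[where f="(/)"] simp: indicator_def of_bool_def)
qed

lemma heavy_value_eq:
  assumes "1 \<le> j" "j \<le> N" "p > 0"
  shows "heavy_value p N j powr p = real N / real j"
  using assms by (simp add: heavy_value_def powr_powr)

text \<open>All \<open>j \<le> N * |y| powr p\<close> qualify, and they lie below \<open>N\<close>
  because \<open>|y| \<le> 1\<close>. Rounding their number down costs less than one, whence the
  \<open>- 1\<close>.\<close>

lemma heavy_prob_ge:
  assumes "s > 0" "N > 0" "p > 0" "\<bar>y\<bar> \<le> 1"
  shows "measure_pmf.prob (heavy_pmf p N s) {x. \<bar>x * y\<bar> \<ge> 1} \<ge> (real N * \<bar>y\<bar> powr p - 1) / (real s * real N)"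
proof -
  let ?B = "{b. b * \<bar>y\<bar> \<ge> 1}"
  let ?k = "nat \<lfloor>real N * \<bar>y\<bar> powr p\<rfloor>"
  have y1: "\<bar>y\<bar> powr p \<le> 1" using assms by (simp add: powr_le1)
  have "{1..?k} \<subseteq> {j\<in>{1..N}. heavy_value p N j \<in> ?B}"
  proof
    fix j assume "j \<in> {1..?k}"
    then have j: "1 \<le> j" "real j \<le> real N * \<bar>y\<bar> powr p" by (auto simp: le_nat_iff le_floor_iff)
    then have "real j \<le> real N" using y1 mult_left_mono[of "\<bar>y\<bar> powr p" 1 "real N"] by simp
    then have jN: "j \<le> N" by simp
    have "1 \<le> real N / real j * \<bar>y\<bar> powr p" using j by (simp add: field_simps)
    also have "\<dots> = (heavy_value p N j * \<bar>y\<bar>) powr p"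
      using heavy_value_eq[of j N p] j jN assms by (subst powr_mult) (auto simp: heavy_value_def)
    finally have ge: "1 \<le> (heavy_value p N j * \<bar>y\<bar>) powr p" .
    have "heavy_value p N j * \<bar>y\<bar> \<ge> 1"
    proof (rule ccontr)
      assume "\<not> heavy_value p N j * \<bar>y\<bar> \<ge> 1"
      then have "(heavy_value p N j * \<bar>y\<bar>) powr p < 1 powr p"
        using assms(3) by (intro powr_less_mono2) (auto simp: heavy_value_def)
      with ge show False by simp
    qed
    then show "j \<in> {j\<in>{1..N}. heavy_value p N j \<in> ?B}" using j jN by simp
  qed
  then have "card {1..?k} \<le> card {j\<in>{1..N}. heavy_value p N j \<in> ?B}" by (intro card_mono) auto
  then have "real ?k \<le> real (card {j\<in>{1..N}. heavy_value p N j \<in> ?B})" by simp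
  then have c: "real N * \<bar>y\<bar> powr p - 1 \<le> real (card {j\<in>{1..N}. heavy_value p N j \<in> ?B})" by linarith
  have "{x. \<bar>x * y\<bar> \<ge> 1} = {x. \<bar>x\<bar> \<in> ?B}" by (auto simp: abs_mult)
  moreover have "measure_pmf.prob (heavy_pmf p N s) {x. \<bar>x\<bar> \<in> ?B} =
      real (card {j\<in>{1..N}. heavy_value p N j \<in> ?B}) / (real s * real N)"
    using assms by (intro heavy_prob_abs) auto
  ultimately show ?thesis by (simp only: divide_right_mono[OF c] mult_nonneg_nonneg of_nat_0_le_iff)
qed

text \<open>The same count from above: rounding down now goes in the right direction, so no
  correction term appears.\<close>

lemma heavy_prob_gt:
  assumes "s > 0" "N > 0" "p > 0" "c > 0"
  shows "measure_pmf.prob (heavy_pmf p N s) {x. \<bar>x * y\<bar> > c} \<le> \<bar>y\<bar> powr p / (real s * c powr p)"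
proof -
  let ?B = "{b. b * \<bar>y\<bar> > c}"
  let ?k = "nat \<lfloor>real N * \<bar>y\<bar> powr p / c powr p\<rfloor>"
  have "{j\<in>{1..N}. heavy_value p N j \<in> ?B} \<subseteq> {1..?k}"
  proof
    fix j assume "j \<in> {j\<in>{1..N}. heavy_value p N j \<in> ?B}"
    then have j: "1 \<le> j" "j \<le> N" "heavy_value p N j * \<bar>y\<bar> > c" by auto
    then have "c powr p < (heavy_value p N j * \<bar>y\<bar>) powr p" using assms by (intro powr_less_mono2) auto
    also have "\<dots> = real N / real j * \<bar>y\<bar> powr p"
      using heavy_value_eq[of j N p] j assms by (subst powr_mult) (auto simp: heavy_value_def)
    finally have "real j \<le> real N * \<bar>y\<bar> powr p / c powr p" using j assms by (simp add: field_simps)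
    then show "j \<in> {1..?k}" using j by (auto simp: le_nat_iff le_floor_iff)
  qed
  then have "card {j\<in>{1..N}. heavy_value p N j \<in> ?B} \<le> card {1..?k}" by (intro card_mono) auto
  then have "real (card {j\<in>{1..N}. heavy_value p N j \<in> ?B}) \<le> real ?k" by (simp only: card_atLeastAtMost of_nat_le_iff diff_Suc_1 One_nat_def)
  also have "\<dots> \<le> real N * \<bar>y\<bar> powr p / c powr p" by (simp add: field_simps)
  finally have c: "real (card {j\<in>{1..N}. heavy_value p N j \<in> ?B}) \<le> real N * \<bar>y\<bar> powr p / c powr p" .
  have "{x. \<bar>x * y\<bar> > c} = {x. \<bar>x\<bar> \<in> ?B}" by (auto simp: abs_mult)
  moreover have "measure_pmf.prob (heavy_pmf p N s) {x. \<bar>x\<bar> \<in> ?B} =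
      real (card {j\<in>{1..N}. heavy_value p N j \<in> ?B}) / (real s * real N)"
    using assms by (intro heavy_prob_abs) auto
  ultimately have "measure_pmf.prob (heavy_pmf p N s) {x. \<bar>x * y\<bar> > c} \<le> real N * \<bar>y\<bar> powr p / c powr p / (real s * real N)"
    by (simp only: divide_right_mono[OF c] mult_nonneg_nonneg of_nat_0_le_iff)
  also have "\<dots> = \<bar>y\<bar> powr p / (real s * c powr p)" using assms by (simp add: field_simps)
  finally show ?thesis .
qed

section \<open>Lower tail of the sketch of a vector\<close>

definition heavy_row :: "real \<Rightarrow> nat \<Rightarrow> nat \<Rightarrow> nat \<Rightarrow> (nat \<Rightarrow> real) pmf" where
  "heavy_row p N s n = Pi_pmf {..<n} 0 (\<lambda>_. heavy_pmf p N s)"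

lemma heavy_row_some_large:
  assumes "s > 0" "n > 0" "p > 0" "(\<Sum>i<n. \<bar>y i\<bar> powr p) = 1"
  shows "measure_pmf.prob (heavy_row p (2 * n) s n) {x. \<exists>i<n. \<bar>x i * y i\<bar> \<ge> 1} \<ge> 1 / (4 * real s)"
proof -
  let ?P = "heavy_row p (2 * n) s n" and ?x = "heavy_pmf p (2 * n) s"
  define q where "q i = measure_pmf.prob ?x {z. \<bar>z * y i\<bar> \<ge> 1}" for i
  have y1: "\<bar>y i\<bar> \<le> 1" if "i < n" for i
  proof (rule ccontr)
    assume "\<not> \<bar>y i\<bar> \<le> 1"
    then have "1 powr p < \<bar>y i\<bar> powr p" using assms(3) by (intro powr_less_mono2) auto
    also have "\<bar>y i\<bar> powr p \<le> (\<Sum>i<n. \<bar>y i\<bar> powr p)" using that by (intro member_le_sum) auto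
    finally show False using assms(4) by simp
  qed
  have "{x. \<not> (\<exists>i<n. \<bar>x i * y i\<bar> \<ge> 1)} = Pi {..<n} (\<lambda>i. - {z. \<bar>z * y i\<bar> \<ge> 1})"
    by (auto simp: Pi_def)
  then have "measure_pmf.prob ?P {x. \<not> (\<exists>i<n. \<bar>x i * y i\<bar> \<ge> 1)} =
     (\<Prod>i<n. measure_pmf.prob ?x (- {z. \<bar>z * y i\<bar> \<ge> 1}))"
    by (simp only: heavy_row_def measure_Pi_pmf_Pi finite_lessThan)
  also have "\<dots> = (\<Prod>i<n. 1 - q i)"
    unfolding q_def by (intro prod.cong refl measure_pmf.prob_compl[simplified, unfolded Compl_eq_Diff_UNIV[symmetric]])
  also have "\<dots> \<le> (\<Prod>i<n. exp (- q i))"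
    using exp_ge_add_one_self[of "- q _"] by (intro prod_mono) (auto simp: q_def)
  also have "\<dots> = exp (- (\<Sum>i<n. q i))" by (simp add: exp_sum sum_negf[symmetric])
  also have "\<dots> \<le> exp (- (1 / (2 * real s)))"
  proof -
    have "(\<Sum>i<n. (real (2 * n) * \<bar>y i\<bar> powr p - 1) / (real s * real (2 * n))) \<le> (\<Sum>i<n. q i)"
      unfolding q_def using assms y1 by (intro sum_mono heavy_prob_ge) auto
    also have "(\<Sum>i<n. (real (2 * n) * \<bar>y i\<bar> powr p - 1) / (real s * real (2 * n))) =
       (real (2 * n) * (\<Sum>i<n. \<bar>y i\<bar> powr p) - real n) / (real s * real (2 * n))"
      by (simp only: sum_divide_distrib[symmetric] sum_subtractf sum_distrib_left[symmetric] sum_constant card_lessThan mult_1_right)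
    \<comment> \<open>The \<open>n\<close> rounding losses take \<open>n\<close> away from a total
      of \<open>2 * n\<close>; this is where a grid of \<open>N = 2 * n\<close> points is
      used.\<close>
    also have "\<dots> = 1 / (2 * real s)" using assms by (simp add: field_simps)
    finally show ?thesis by simp
  qed
  also have "\<dots> \<le> 1 - 1 / (4 * real s)"
  proof -
    define u where "u = 1 / (2 * real s)"
    have u: "0 < u" "u \<le> 1" using assms by (auto simp: u_def field_simps)
    have "exp (- u) \<le> 1 / (1 + u)" using exp_ge_add_one_self[of u] u by (simp add: exp_minus field_simps)
    also have "\<dots> \<le> 1 - u / 2" using u mult_mono[of u 1 u u] by (simp add: field_simps power2_eq_square)
    finally show ?thesis by (simp add: u_def)
  qed
  finally have "measure_pmf.prob ?P {x. \<not> (\<exists>i<n. \<bar>x i * y i\<bar> \<ge> 1)} \<le> 1 - 1 / (4 * real s)" .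
  moreover have "measure_pmf.prob ?P {x. \<not> (\<exists>i<n. \<bar>x i * y i\<bar> \<ge> 1)} = 1 - measure_pmf.prob ?P {x. \<exists>i<n. \<bar>x i * y i\<bar> \<ge> 1}"
    using measure_pmf.prob_compl[of "{x. \<exists>i<n. \<bar>x i * y i\<bar> \<ge> 1}" ?P]
    by (simp add: Collect_neg_eq Compl_eq_Diff_UNIV del: not_ex)
  ultimately show ?thesis by linarith
qed

lemma map_pmf_involution:
  assumes "\<And>x. f (f x) = x" "\<And>x. pmf P (f x) = pmf P x"
  shows "map_pmf f P = P"
proof (rule pmf_eqI)
  fix x
  have "inj f" by (metis assms(1) injI)
  then have "pmf (map_pmf f P) (f (f x)) = pmf P (f x)" by (rule pmf_map_inj')
  then show "pmf (map_pmf f P) x = pmf P x" using assms by simp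
qed

text \<open>Symmetrisation: changing the sign of the first summand of modulus at least 1 preserves
  the distribution, and of the two sums so obtained at least one has modulus at least 1.\<close>

lemma heavy_row_ge:
  assumes "s > 0" "n > 0" "p > 0" "(\<Sum>i<n. \<bar>y i\<bar> powr p) = 1"
  shows "measure_pmf.prob (heavy_row p (2 * n) s n) {x. \<bar>\<Sum>i<n. x i * y i\<bar> \<ge> 1} \<ge> 1 / (8 * real s)"
proof -
  let ?P = "heavy_row p (2 * n) s n"
  let ?L = "{x. \<exists>i<n. \<bar>x i * y i\<bar> \<ge> 1}" and ?G = "{x. \<bar>\<Sum>i<n. x i * y i\<bar> \<ge> 1}"
  \<comment> \<open>The index is chosen from the moduli alone, which the flip preserves; so a second
    application of \<open>F\<close> flips the same index back.\<close>
  define i0 where "i0 x = (LEAST i. i < n \<and> \<bar>x i * y i\<bar> \<ge> 1)" for x :: "nat \<Rightarrow> real"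
  define F where "F x = (if x \<in> ?L then x(i0 x := - x (i0 x)) else x)" for x :: "nat \<Rightarrow> real"
  have Fabs: "\<bar>F x i * y i\<bar> = \<bar>x i * y i\<bar>" for x i by (auto simp: F_def abs_mult)
  have i0F: "i0 (F x) = i0 x" for x by (simp add: i0_def Fabs)
  have LF: "F x \<in> ?L \<longleftrightarrow> x \<in> ?L" for x by (simp add: Fabs)
  have FF: "F (F x) = x" for x
  proof (cases "x \<in> ?L")
    case True
    then have "F (F x) = (F x)(i0 x := - F x (i0 x))"
      using LF[of x] i0F[of x] by (subst F_def) simp
    with True show ?thesis by (auto simp: F_def)
  next
    case False
    then have "F x = x" by (auto simp: F_def)
    then show ?thesis by simp
  qed
  have i0: "i0 x < n \<and> \<bar>x (i0 x) * y (i0 x)\<bar> \<ge> 1" if "x \<in> ?L" for x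
    using that unfolding i0_def by (intro LeastI_ex[of "\<lambda>i. i < n \<and> \<bar>x i * y i\<bar> \<ge> 1"]) auto
  have sN: "s * (2 * n) > 0" using assms by simp
  have "pmf ?P (F x) = pmf ?P x" for x
  proof (cases "x \<in> ?L")
    case True
    have "(\<forall>z. z \<notin> {..<n} \<longrightarrow> F x z = 0) = (\<forall>z. z \<notin> {..<n} \<longrightarrow> x z = 0)"
      using i0[OF True] by (auto simp: F_def)
    moreover have "(\<Prod>i<n. pmf (heavy_pmf p (2 * n) s) (F x i)) = (\<Prod>i<n. pmf (heavy_pmf p (2 * n) s) (x i))"
      by (intro prod.cong refl) (simp add: F_def heavy_symmetric[OF sN])
    ultimately show ?thesis unfolding heavy_row_def pmf_Pi[OF finite_lessThan] by (simp only:)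
  next
    case False
    then have "F x = x" by (auto simp: F_def)
    then show ?thesis by simp
  qed
  then have mF: "map_pmf F ?P = ?P" using FF by (rule map_pmf_involution[rotated])
  have eq: "measure_pmf.prob ?P (F -` ?G) = measure_pmf.prob ?P ?G"
    using measure_map_pmf[of F ?P ?G] unfolding mF by (rule sym)
  have "?L \<subseteq> ?G \<union> F -` ?G"
  proof
    fix x assume x: "x \<in> ?L"
    let ?k = "i0 x"
    have "(\<Sum>i<n. F x i * y i) = (\<Sum>i<n. x i * y i - (if i = ?k then 2 * (x i * y i) else 0))"
      using x by (intro sum.cong) (auto simp: F_def)
    also have "\<dots> = (\<Sum>i<n. x i * y i) - 2 * (x ?k * y ?k)"
      using i0[OF x] by (simp add: sum_subtractf sum.delta)
    finally show "x \<in> ?G \<union> F -` ?G" using i0[OF x] by auto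
  qed
  then have "measure_pmf.prob ?P ?L \<le> measure_pmf.prob ?P (?G \<union> F -` ?G)"
    by (intro measure_pmf.finite_measure_mono) auto
  also have "\<dots> \<le> measure_pmf.prob ?P ?G + measure_pmf.prob ?P (F -` ?G)"
    by (rule measure_Un_le) auto
  finally have "measure_pmf.prob ?P ?L \<le> 2 * measure_pmf.prob ?P ?G" using eq by simp
  with heavy_row_some_large[OF assms] show ?thesis by simp
qed

text \<open>A row succeeds with probability at least \<open>1 / (8 * s)\<close>, so
  \<open>32 * s\<close> rows have at least 4 expected successes, and all fail with probability at
  most \<open>exp (- 4) \<le> 1 / 50\<close>.\<close>

definition heavy_block :: "real \<Rightarrow> nat \<Rightarrow> nat \<Rightarrow> (nat \<Rightarrow> nat \<Rightarrow> real) pmf" where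
  "heavy_block p s n = Pi_pmf {..<32 * s} (\<lambda>_. 0) (\<lambda>_. heavy_row p (2 * n) s n)"

lemma heavy_block_lower:
  assumes "s > 0" "n > 0" "p > 0" "(\<Sum>i<n. \<bar>y i\<bar> powr p) = 1"
  shows "measure_pmf.prob (heavy_block p s n) {h. \<not> (\<exists>j<32 * s. \<bar>\<Sum>i<n. h j i * y i\<bar> \<ge> 1)} \<le> 1 / 50"
proof -
  let ?R = "heavy_row p (2 * n) s n"
  let ?q = "measure_pmf.prob ?R {x. \<bar>\<Sum>i<n. x i * y i\<bar> \<ge> 1}"
  have "measure_pmf.prob (heavy_block p s n) {h. \<not> (\<exists>j<32 * s. \<bar>\<Sum>i<n. h j i * y i\<bar> \<ge> 1)} =
     measure_pmf.prob (heavy_block p s n) {h. \<forall>j\<in>{..<32 * s}. \<not> \<bar>\<Sum>i<n. h j i * y i\<bar> \<ge> 1}"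
    by (intro arg_cong2[where f=measure]) auto
  also have "\<dots> = measure_pmf.prob ?R {x. \<not> \<bar>\<Sum>i<n. x i * y i\<bar> \<ge> 1} ^ card {..<32 * s}"
    unfolding heavy_block_def by (rule measure_Pi_pmf_ball) auto
  also have "measure_pmf.prob ?R {x. \<not> \<bar>\<Sum>i<n. x i * y i\<bar> \<ge> 1} = 1 - ?q"
    using measure_pmf.prob_compl[of "{x. \<bar>\<Sum>i<n. x i * y i\<bar> \<ge> 1}" ?R]
    by (simp add: Collect_neg_eq Compl_eq_Diff_UNIV del: not_le)
  also have "(1 - ?q) ^ card {..<32 * s} \<le> exp (- ?q) ^ card {..<32 * s}"
    using exp_ge_add_one_self[of "- ?q"] by (intro power_mono) auto
  also have "\<dots> = exp (- (real (32 * s) * ?q))" by (simp add: exp_of_nat_mult[symmetric])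
  also have "\<dots> \<le> exp (- 4)"
    using heavy_row_ge[OF assms] assms(1) by (simp add: field_simps)
  also have "exp (- 4 :: real) \<le> 1 / 50"
  proof -
    have "(2.7::real) ^ 4 \<le> exp 1 ^ 4" using e_approx_32 by (intro power_mono) (auto simp: abs_if split: if_splits)
    also have "\<dots> = exp (4::real)" by (simp add: exp_of_nat_mult[symmetric])
    finally have "50 \<le> exp (4::real)" by (simp add: power4_eq_xxxx)
    then show ?thesis by (simp add: exp_minus field_simps)
  qed
  finally show ?thesis .
qed

section \<open>Upper tail of the sketch of a vector\<close>

text \<open>Beyond 1 the bound \<open>a^2 * exp b\<close> would multiply the whole second moment by
  \<open>exp b\<close>, which is too much once \<open>exp b\<close> is a power of \<open>n\<close>.
  The power \<open>2 * p\<close> puts the factor \<open>exp b\<close> only on a moment that is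
  dominated by values next to the cutoff \<open>b\<close>. It is available because
  \<open>(b / a) powr (2 * p)\<close> is at most a constant times
  \<open>exp (b - a)\<close>.\<close>

lemma cosh_le_power:
  assumes "0 \<le> a" "a \<le> b" "b > 0" "p \<ge> (1::real)"
  shows "cosh a - 1 \<le> a\<^sup>2 + exp 1 * (2 * p) powr (2 * p) * ((a / b) powr (2 * p) * exp b)"
proof (cases "a \<le> 1")
  case True
  have "exp a \<le> 1 + a + a\<^sup>2" using exp_bound[of a] assms True by simp
  moreover have "exp (- a) \<le> 1 - a + a\<^sup>2"
  proof -
    have "exp (- a) * (1 + a) \<le> 1" using exp_ge_add_one_self[of a] assms by (simp add: exp_minus field_simps)
    also have "1 \<le> (1 - a + a\<^sup>2) * (1 + a)" using assms by (simp add: field_simps power2_eq_square)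
    finally show ?thesis using assms by (simp add: mult_le_cancel_right)
  qed
  ultimately have "exp a + exp (- a) \<le> 2 * (a\<^sup>2 + 1)" by (simp add: algebra_simps)
  moreover have "(u + v) / 2 - 1 \<le> w" if "u + v \<le> 2 * (w + 1)" for u v w :: real
    using that by (simp add: field_simps)
  ultimately have "cosh a - 1 \<le> a\<^sup>2" unfolding cosh_field_def by blast
  then show ?thesis by (simp add: add_increasing2)
next
  case False
  \<comment> \<open>\<open>(a - 1) * (b - a) \<ge> 0\<close> is a rewriting of
    \<open>b / a \<le> 1 + (b - a)\<close>.\<close>
  have "(b / a) powr (2 * p) \<le> (1 + (b - a)) powr (2 * p)"
    using False assms mult_nonneg_nonneg[of "a - 1" "b - a"] by (intro powr_mono2) (auto simp: field_simps)
  also have "1 + (b - a) \<le> 2 * p * exp ((1 + (b - a)) / (2 * p))"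
    using exp_ge_add_one_self[of "(1 + (b - a)) / (2 * p)"] assms by (simp add: field_simps)
  then have "(1 + (b - a)) powr (2 * p) \<le> (2 * p * exp ((1 + (b - a)) / (2 * p))) powr (2 * p)"
    using assms by (intro powr_mono2) auto
  also have "\<dots> = (2 * p) powr (2 * p) * exp ((1 + (b - a)) / (2 * p)) powr (2 * p)"
    by (rule powr_mult)
  also have "exp ((1 + (b - a)) / (2 * p)) powr (2 * p) = exp (1 + (b - a))"
    using assms by (simp add: powr_def)
  finally have *: "(b / a) powr (2 * p) \<le> (2 * p) powr (2 * p) * exp (1 + (b - a))" .
  have "(a / b) powr (2 * p) * (b / a) powr (2 * p) = 1"
    using False assms by (simp add: powr_mult[symmetric])
  then have "exp a = (a / b) powr (2 * p) * (b / a) powr (2 * p) * exp a" by simp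
  also have "\<dots> \<le> (a / b) powr (2 * p) * ((2 * p) powr (2 * p) * exp (1 + (b - a))) * exp a"
    using * by (intro mult_right_mono mult_left_mono) auto
  also have "\<dots> = exp 1 * (2 * p) powr (2 * p) * ((a / b) powr (2 * p) * exp b)"
    by (simp add: exp_add exp_diff)
  finally have "exp a \<le> exp 1 * (2 * p) powr (2 * p) * ((a / b) powr (2 * p) * exp b)" .
  moreover have "cosh a \<le> exp a" using False by (simp add: cosh_def)
  ultimately show ?thesis by (smt (verit) zero_le_power2)
qed

text \<open>Comparison with the integral of \<open>t powr (- a)\<close>, done by induction.\<close>

lemma sum_powr_neg_le:
  fixes a :: real
  assumes "0 < a" "a < 1"
  shows "(\<Sum>j=1..N. real j powr (- a)) \<le> real N powr (1 - a) / (1 - a)"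
proof (induction N)
  case (Suc N)
  let ?b = "1 - a" and ?M = "real (Suc N)"
  have "real N powr ?b \<le> ?M powr ?b * (1 - ?b / ?M)"
  proof (cases "N = 0")
    case False
    \<comment> \<open>Weighted AM-GM stands in for the tangent inequality at 1 of the concave
      function \<open>t powr ?b\<close>.\<close>
    have "(real N / ?M) powr ?b * 1 powr a \<le> ?b * (real N / ?M) + a * 1"
      using False assms by (intro Youngs_inequality_0) auto
    also have "\<dots> = 1 - ?b / ?M" by (simp add: field_simps)
    finally have "(real N / ?M) powr ?b \<le> 1 - ?b / ?M" by simp
    then have "?M powr ?b * (real N / ?M) powr ?b \<le> ?M powr ?b * (1 - ?b / ?M)" by (intro mult_left_mono) auto
    then show ?thesis by (simp add: powr_divide)
  qed (use assms in auto)
  also have "\<dots> = ?M powr ?b - ?b * ?M powr (- a)"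
    using powr_diff[of ?M ?b 1] by (simp add: algebra_simps)
  finally have "(real N powr ?b + ?b * ?M powr (- a)) / ?b \<le> ?M powr ?b / ?b"
    using assms by (intro divide_right_mono) auto
  then have "real N powr ?b / ?b + ?M powr (- a) \<le> ?M powr ?b / ?b"
    using assms by (simp add: add_divide_distrib del: of_nat_Suc)
  with Suc show ?case by simp
qed simp

text \<open>Telescoping from the ceiling of \<open>x\<close>: the difference
  \<open>2 / j - 2 / (j + 1)\<close> dominates \<open>1 / j^2\<close> from \<open>j = 1\<close>
  on.\<close>

lemma sum_inverse_square_le:
  fixes x :: real
  assumes "x > 0"
  shows "(\<Sum>j\<in>{j\<in>{1..N}. real j \<ge> x}. 1 / (real j)\<^sup>2) \<le> 2 / x"
proof -
  define k where "k = nat \<lceil>x\<rceil>"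
  have k: "k \<ge> 1" "real k \<ge> x" using assms by (auto simp: k_def le_nat_iff)
  have tel: "(\<Sum>j=k..m. 1 / (real j)\<^sup>2) \<le> 2 / real k - 2 / (real m + 1)" if "m \<ge> k" for m
    using that
  proof (induction m rule: dec_induct)
    case base
    have "1 / (real k)\<^sup>2 = 2 / (real k * (2 * real k))" by (simp add: power2_eq_square)
    also have "\<dots> \<le> 2 / (real k * (real k + 1))"
      using k by (intro divide_left_mono mult_left_mono mult_pos_pos) auto
    also have "\<dots> = 2 / real k - 2 / (real k + 1)" using k by (simp add: field_simps)
    finally show ?case by simp
  next
    case (step m)
    let ?M = "real (Suc m)"
    have "1 / ?M\<^sup>2 = 2 / (?M * (2 * ?M))" by (simp add: power2_eq_square del: of_nat_Suc)
    also have "\<dots> \<le> 2 / (?M * (real m + 2))"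
      by (intro divide_left_mono mult_left_mono mult_pos_pos) auto
    also have "\<dots> = 2 / (real m + 1) - 2 / (real m + 2)" by (simp add: field_simps)
    finally have "1 / ?M\<^sup>2 \<le> 2 / (real m + 1) - 2 / (real m + 2)" .
    with step show ?case by (simp add: algebra_simps)
  qed
  have "{j\<in>{1..N}. real j \<ge> x} \<subseteq> {k..max N k}" by (auto simp: k_def nat_le_iff ceiling_le_iff)
  then have "(\<Sum>j\<in>{j\<in>{1..N}. real j \<ge> x}. 1 / (real j)\<^sup>2) \<le> (\<Sum>j=k..max N k. 1 / (real j)\<^sup>2)"
    by (intro sum_mono2) auto
  also have "\<dots> \<le> 2 / real k - 2 / (real (max N k) + 1)" by (intro tel) auto
  also have "\<dots> \<le> 2 / real k" by simp
  also have "\<dots> \<le> 2 / x" using k assms by (intro divide_left_mono) auto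
  finally show ?thesis .
qed

definition clip :: "real \<Rightarrow> real \<Rightarrow> real" where
  "clip C z = (if \<bar>z\<bar> \<le> C then z else 0)"

text \<open>The factor in front of the second term of \<open>cosh_le_power\<close>.\<close>

definition mgf_const :: "real \<Rightarrow> real" where
  "mgf_const p = exp 1 * (2 * p) powr (2 * p)"

text \<open>\<open>cosh_le_power\<close> is applied with \<open>a = \<mu> * v j * |y|\<close> and
  \<open>b = \<mu> * C\<close>. Its square term averages \<open>(N / j) powr (2 / p)\<close>, which
  is bounded since \<open>2 / p < 1\<close>. Its other term carries \<open>w^2 * (N / j)^2\<close>
  with \<open>w = (|y| / C) powr p\<close>; the truncation says \<open>j \<ge> N * w\<close>, and
  summing \<open>1 / j^2\<close> from there gives back one factor \<open>w\<close>. The result is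
  thus linear in \<open>|y| powr p\<close> and adds up over the coordinates. The division by
  \<open>s\<close> reflects the chance of a nonzero entry.\<close>

lemma heavy_clip_mgf:
  assumes "s > 0" "N > 0" "p > 2" "C > 0" "\<mu> > 0"
  shows "measure_pmf.expectation (heavy_pmf p N s) (\<lambda>x. exp (\<mu> * clip C (x * y)))
    \<le> exp ((\<mu>\<^sup>2 * y\<^sup>2 / (1 - 2 / p) + 2 * mgf_const p * exp (\<mu> * C) * (\<bar>y\<bar> powr p / C powr p)) / real s)"
proof -
  define v where "v = heavy_value p N"
  define K where "K = mgf_const p"
  have K: "K \<ge> 0" by (simp add: K_def mgf_const_def)
  have v0: "v j \<ge> 0" for j by (simp add: v_def heavy_value_def)
  have clip_minus: "clip C (- z) = - clip C z" for z by (simp add: clip_def)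
  have vp: "v j powr p = real N / real j" if "j \<in> {1..N}" for j
    using that assms heavy_value_eq[of j N p] by (simp add: v_def)
  let ?I = "{j\<in>{1..N}. v j * \<bar>y\<bar> \<le> C}"
  have "measure_pmf.expectation (heavy_pmf p N s) (\<lambda>x. exp (\<mu> * clip C (x * y))) =
     (\<Sum>j=1..s*N. cosh (\<mu> * clip C (v j * y))) / (real s * real N)"
    using assms by (subst heavy_expectation) (auto simp: v_def clip_minus cosh_def intro!: sum.cong)
  \<comment> \<open>Once 1 is subtracted from each \<open>cosh\<close>, zero entries and clipped
    entries contribute nothing.\<close>
  also have "(\<Sum>j=1..s*N. cosh (\<mu> * clip C (v j * y))) = real s * real N + (\<Sum>j=1..s*N. cosh (\<mu> * clip C (v j * y)) - 1)"
    by (simp add: sum_subtractf)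
  also have "(\<Sum>j=1..s*N. cosh (\<mu> * clip C (v j * y)) - 1) = (\<Sum>j\<in>?I. cosh (\<mu> * (v j * y)) - 1)"
  proof -
    have "N \<le> s * N" using assms(1) by simp
    then have "{1..N} \<subseteq> {1..s * N}" by (simp only: atLeastatMost_subset_iff) simp
    then have sub: "?I \<subseteq> {1..s * N}" by blast
    have absv: "\<bar>v j * y\<bar> = v j * \<bar>y\<bar>" for j using v0[of j] by (simp add: abs_mult)
    have zero: "clip C (v j * y) = 0" if "j \<in> {1..s * N} - ?I" for j
    proof (cases "j \<le> N")
      case True
      then have "v j * \<bar>y\<bar> > C" using that by auto
      then show ?thesis by (simp add: clip_def absv)
    qed (simp add: clip_def v_def heavy_value_def)
    have "(\<Sum>j=1..s*N. cosh (\<mu> * clip C (v j * y)) - 1) = (\<Sum>j\<in>?I. cosh (\<mu> * clip C (v j * y)) - 1)"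
      using sub by (intro sum.mono_neutral_right) (simp_all add: zero)
    also have "\<dots> = (\<Sum>j\<in>?I. cosh (\<mu> * (v j * y)) - 1)"
      by (intro sum.cong refl) (simp add: clip_def absv)
    finally show ?thesis .
  qed
  finally have eq: "measure_pmf.expectation (heavy_pmf p N s) (\<lambda>x. exp (\<mu> * clip C (x * y))) =
     (real s * real N + (\<Sum>j\<in>?I. cosh (\<mu> * (v j * y)) - 1)) / (real s * real N)" .
  have "(\<Sum>j\<in>?I. cosh (\<mu> * (v j * y)) - 1) \<le> (\<Sum>j\<in>?I. \<mu>\<^sup>2 * y\<^sup>2 * (real N / real j) powr (2 / p) +
       K * exp (\<mu> * C) * (\<bar>y\<bar> powr p / C powr p)\<^sup>2 * (real N)\<^sup>2 * (1 / (real j)\<^sup>2))"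
  proof (rule sum_mono)
    fix j assume j: "j \<in> ?I"
    let ?a = "\<mu> * (v j * \<bar>y\<bar>)"
    have "cosh (\<mu> * (v j * y)) = cosh ?a"
      using assms v0[of j] by (subst cosh_real_abs[symmetric]) (simp add: abs_mult)
    also have "\<dots> - 1 \<le> ?a\<^sup>2 + K * ((?a / (\<mu> * C)) powr (2 * p) * exp (\<mu> * C))"
      unfolding K_def mgf_const_def using j v0[of j] assms by (intro cosh_le_power) auto
    also have "?a\<^sup>2 = \<mu>\<^sup>2 * y\<^sup>2 * (v j)\<^sup>2" by (simp add: power_mult_distrib)
    also have "(v j)\<^sup>2 = (real N / real j) powr (2 / p)"
      using j assms by (simp add: v_def heavy_value_def powr_power)
    also have "(?a / (\<mu> * C)) powr (2 * p) = (((v j * \<bar>y\<bar>) / C) powr p)\<^sup>2"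
      using assms by (simp add: power2_eq_square powr_add[symmetric] mult_ac)
    also have "((v j * \<bar>y\<bar>) / C) powr p = real N / real j * (\<bar>y\<bar> powr p / C powr p)"
      using v0[of j] assms vp[of j] j by (simp add: powr_mult powr_divide)
    finally show "cosh (\<mu> * (v j * y)) - 1 \<le> \<mu>\<^sup>2 * y\<^sup>2 * (real N / real j) powr (2 / p) +
       K * exp (\<mu> * C) * (\<bar>y\<bar> powr p / C powr p)\<^sup>2 * (real N)\<^sup>2 * (1 / (real j)\<^sup>2)"
      by (simp add: power_mult_distrib power_divide mult_ac)
  qed
  also have "\<dots> = \<mu>\<^sup>2 * y\<^sup>2 * (\<Sum>j\<in>?I. (real N / real j) powr (2 / p)) +
       K * exp (\<mu> * C) * (\<bar>y\<bar> powr p / C powr p)\<^sup>2 * (real N)\<^sup>2 * (\<Sum>j\<in>?I. 1 / (real j)\<^sup>2)"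
    unfolding sum.distrib sum_distrib_left by (rule refl)
  also have "\<dots> \<le> \<mu>\<^sup>2 * y\<^sup>2 * (real N / (1 - 2 / p)) +
       K * exp (\<mu> * C) * (2 * real N * (\<bar>y\<bar> powr p / C powr p))"
  proof (rule add_mono)
    have "(\<Sum>j\<in>?I. (real N / real j) powr (2 / p)) \<le> (\<Sum>j=1..N. (real N / real j) powr (2 / p))"
      by (intro sum_mono2) auto
    also have "\<dots> = real N powr (2 / p) * (\<Sum>j=1..N. real j powr (- (2 / p)))"
      unfolding sum_distrib_left by (intro sum.cong refl) (simp add: powr_divide powr_minus_divide)
    also have "\<dots> \<le> real N powr (2 / p) * (real N powr (1 - 2 / p) / (1 - 2 / p))"
      using assms by (intro mult_left_mono sum_powr_neg_le) auto
    also have "\<dots> = real N / (1 - 2 / p)"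
      using assms by (simp add: powr_add[symmetric])
    finally show "\<mu>\<^sup>2 * y\<^sup>2 * (\<Sum>j\<in>?I. (real N / real j) powr (2 / p)) \<le> \<mu>\<^sup>2 * y\<^sup>2 * (real N / (1 - 2 / p))"
      by (intro mult_left_mono) auto
    show "K * exp (\<mu> * C) * (\<bar>y\<bar> powr p / C powr p)\<^sup>2 * (real N)\<^sup>2 * (\<Sum>j\<in>?I. 1 / (real j)\<^sup>2)
       \<le> K * exp (\<mu> * C) * (2 * real N * (\<bar>y\<bar> powr p / C powr p))"
    proof (cases "y = 0")
      case False
      define w where "w = \<bar>y\<bar> powr p / C powr p"
      have w: "w > 0" using False assms by (simp add: w_def)
      have sub: "?I \<subseteq> {j\<in>{1..N}. real j \<ge> real N * w}"
      proof
        fix j assume j: "j \<in> ?I"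
        then have "(v j * \<bar>y\<bar>) powr p \<le> C powr p" using v0[of j] assms by (intro powr_mono2) auto
        then have "real N / real j * \<bar>y\<bar> powr p \<le> C powr p" using vp[of j] v0[of j] j by (simp add: powr_mult)
        then show "j \<in> {j\<in>{1..N}. real j \<ge> real N * w}" using j assms by (simp add: w_def field_simps)
      qed
      have "(\<Sum>j\<in>?I. 1 / (real j)\<^sup>2) \<le> (\<Sum>j\<in>{j\<in>{1..N}. real j \<ge> real N * w}. 1 / (real j)\<^sup>2)"
        using sub by (intro sum_mono2) auto
      also have "\<dots> \<le> 2 / (real N * w)" using w assms by (intro sum_inverse_square_le) auto
      finally have "w\<^sup>2 * (real N)\<^sup>2 * (\<Sum>j\<in>?I. 1 / (real j)\<^sup>2) \<le> w\<^sup>2 * (real N)\<^sup>2 * (2 / (real N * w))"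
        by (intro mult_left_mono) auto
      also have "\<dots> = 2 * real N * w" using w assms by (simp add: power2_eq_square)
      finally have "K * exp (\<mu> * C) * (w\<^sup>2 * (real N)\<^sup>2 * (\<Sum>j\<in>?I. 1 / (real j)\<^sup>2)) \<le> K * exp (\<mu> * C) * (2 * real N * w)"
        using K by (intro mult_left_mono) auto
      then show ?thesis by (simp add: w_def mult_ac)
    qed simp
  qed
  finally have "measure_pmf.expectation (heavy_pmf p N s) (\<lambda>x. exp (\<mu> * clip C (x * y))) \<le>
     (real s * real N + (\<mu>\<^sup>2 * y\<^sup>2 * (real N / (1 - 2 / p)) +
       K * exp (\<mu> * C) * (2 * real N * (\<bar>y\<bar> powr p / C powr p)))) / (real s * real N)"
    unfolding eq by (intro divide_right_mono add_left_mono) auto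
  also have "\<dots> = 1 + (\<mu>\<^sup>2 * y\<^sup>2 / (1 - 2 / p) + 2 * K * exp (\<mu> * C) * (\<bar>y\<bar> powr p / C powr p)) / real s"
    using assms by (simp add: add_divide_distrib mult_ac)
  also have "\<dots> \<le> exp ((\<mu>\<^sup>2 * y\<^sup>2 / (1 - 2 / p) + 2 * K * exp (\<mu> * C) * (\<bar>y\<bar> powr p / C powr p)) / real s)"
    by (rule exp_ge_add_one_self)
  finally show ?thesis by (simp only: K_def)
qed

lemma heavy_row_clip_tail:
  assumes "s > 0" "n > 0" "p > 2" "C > 0" "\<mu> > 0" "(\<Sum>i<n. \<bar>y i\<bar> powr p) \<le> 1"
  shows "measure_pmf.prob (heavy_row p (2 * n) s n) {x. \<bar>\<Sum>i<n. clip C (x i * y i)\<bar> > D}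
    \<le> 2 * exp (- \<mu> * D + (\<mu>\<^sup>2 * (2 * real n powr (1 - 2 / p)) / (1 - 2 / p)
         + 2 * mgf_const p * exp (\<mu> * C) / C powr p) / real s)"
proof -
  let ?R = "heavy_row p (2 * n) s n" and ?x = "heavy_pmf p (2 * n) s"
  let ?M = "(\<mu>\<^sup>2 * (2 * real n powr (1 - 2 / p)) / (1 - 2 / p)
         + 2 * mgf_const p * exp (\<mu> * C) / C powr p) / real s"
  have K: "mgf_const p \<ge> 0" by (simp add: mgf_const_def)
  have sN: "s * (2 * n) > 0" using assms by simp
  have fin: "finite (set_pmf ?x)" using sN by (rule finite_set_heavy_pmf)
  have finR: "finite (set_pmf ?R)" unfolding heavy_row_def
    using fin by (subst set_Pi_pmf) (auto intro!: finite_PiE_dflt)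
  have p0: "1 - 2 / p > 0" using assms by simp
  \<comment> \<open>Hoelder's inequality up to the factor 2, obtained termwise from
    \<open>u^2 \<le> 1 + u powr p\<close> for the rescaled
    \<open>u = n powr (1 / p) * |y i|\<close>.\<close>
  have l2: "(\<Sum>i<n. (y i)\<^sup>2) \<le> 2 * real n powr (1 - 2 / p)"
  proof -
    have "(y i)\<^sup>2 \<le> real n powr (- (2 / p)) * (1 + real n * \<bar>y i\<bar> powr p)" for i
    proof -
      define u where "u = real n powr (1 / p) * \<bar>y i\<bar>"
      have u: "u \<ge> 0" by (simp add: u_def)
      have "u\<^sup>2 \<le> 1 + u powr p"
      proof (cases "u \<le> 1")
        case True then show ?thesis using u by (simp add: power_le_one add_increasing2)
      next
        case False
        then have "u powr 2 \<le> u powr p" using assms by (intro powr_mono) auto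
        then show ?thesis using False by simp
      qed
      moreover have "u powr p = real n * \<bar>y i\<bar> powr p" using assms by (simp add: u_def powr_mult powr_powr)
      moreover have "(y i)\<^sup>2 = real n powr (- (2 / p)) * u\<^sup>2"
      proof -
        have "(real n powr (1 / p))\<^sup>2 = real n powr (2 / p)"
          by (simp add: power2_eq_square powr_add[symmetric])
        then show ?thesis using assms by (simp add: u_def power_mult_distrib powr_minus field_simps)
      qed
      ultimately show ?thesis by (simp add: mult_left_mono)
    qed
    then have "(\<Sum>i<n. (y i)\<^sup>2) \<le> (\<Sum>i<n. real n powr (- (2 / p)) * (1 + real n * \<bar>y i\<bar> powr p))"
      by (intro sum_mono)
    also have "\<dots> = real n powr (- (2 / p)) * (real n + real n * (\<Sum>i<n. \<bar>y i\<bar> powr p))"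
      by (simp add: sum_distrib_left[symmetric] sum.distrib)
    also have "\<dots> \<le> real n powr (- (2 / p)) * (real n + real n * 1)"
      using assms by (intro mult_left_mono add_left_mono) auto
    also have "\<dots> = 2 * (real n powr (- (2 / p)) * real n powr 1)" using assms by simp
    also have "real n powr (- (2 / p)) * real n powr 1 = real n powr (1 - 2 / p)"
      by (simp only: powr_add[symmetric]) simp
    finally show ?thesis .
  qed
  \<comment> \<open>The vector \<open>z\<close> will be \<open>y\<close> and its negative, one for
    each tail.\<close>
  have mgf: "measure_pmf.expectation ?R (\<lambda>x. exp (\<mu> * (\<Sum>i<n. clip C (x i * z i)))) \<le> exp ?M"
    if z: "\<And>i. \<bar>z i\<bar> = \<bar>y i\<bar>" for z
  proof -
    have "measure_pmf.expectation ?R (\<lambda>x. exp (\<mu> * (\<Sum>i<n. clip C (x i * z i)))) =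
       measure_pmf.expectation ?R (\<lambda>x. \<Prod>i<n. exp (\<mu> * clip C (x i * z i)))"
      by (simp add: sum_distrib_left exp_sum)
    also have "\<dots> = (\<Prod>i<n. measure_pmf.expectation ?x (\<lambda>x. exp (\<mu> * clip C (x * z i))))"
      unfolding heavy_row_def
      by (rule expectation_prod_Pi_pmf) (auto intro: integrable_measure_pmf_finite[OF fin])
    also have "\<dots> \<le> (\<Prod>i<n. exp ((\<mu>\<^sup>2 * (z i)\<^sup>2 / (1 - 2 / p) +
         2 * mgf_const p * exp (\<mu> * C) * (\<bar>z i\<bar> powr p / C powr p)) / real s))"
      using assms by (intro prod_mono conjI heavy_clip_mgf Bochner_Integration.integral_nonneg) auto
    also have "\<dots> = exp (\<Sum>i<n. (\<mu>\<^sup>2 * (z i)\<^sup>2 / (1 - 2 / p) +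
         2 * mgf_const p * exp (\<mu> * C) * (\<bar>z i\<bar> powr p / C powr p)) / real s)"
      by (simp add: exp_sum)
    also have "(\<Sum>i<n. (\<mu>\<^sup>2 * (z i)\<^sup>2 / (1 - 2 / p) +
         2 * mgf_const p * exp (\<mu> * C) * (\<bar>z i\<bar> powr p / C powr p)) / real s) =
       (\<mu>\<^sup>2 * (\<Sum>i<n. (y i)\<^sup>2) / (1 - 2 / p) +
         2 * mgf_const p * exp (\<mu> * C) * (\<Sum>i<n. \<bar>y i\<bar> powr p) / C powr p) / real s"
    proof -
      have "(z i)\<^sup>2 = (y i)\<^sup>2" for i using z[of i] by (metis power2_abs)
      then show ?thesis
        unfolding sum_divide_distrib[symmetric] sum.distrib z
        by (simp add: sum_distrib_left[symmetric] sum_divide_distrib[symmetric])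
    qed
    also have "\<dots> \<le> (\<mu>\<^sup>2 * (2 * real n powr (1 - 2 / p)) / (1 - 2 / p) +
         2 * mgf_const p * exp (\<mu> * C) * 1 / C powr p) / real s"
      using l2 p0 assms K
      by (intro divide_right_mono add_mono mult_left_mono mult_nonneg_nonneg) auto
    finally show ?thesis by simp
  qed
  have tail: "measure_pmf.prob ?R {x. (\<Sum>i<n. clip C (x i * z i)) > D} \<le> exp (- \<mu> * D + ?M)"
    if z: "\<And>i. \<bar>z i\<bar> = \<bar>y i\<bar>" for z
  proof -
    let ?X = "\<lambda>x. exp (\<mu> * (\<Sum>i<n. clip C (x i * z i)))"
    have "measure_pmf.prob ?R {x. (\<Sum>i<n. clip C (x i * z i)) > D} \<le>
       measure_pmf.prob ?R {x \<in> space ?R. ?X x \<ge> exp (\<mu> * D)}"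
      using assms by (intro measure_pmf.finite_measure_mono) auto
    also have "\<dots> \<le> measure_pmf.expectation ?R ?X / exp (\<mu> * D)"
      by (rule integral_Markov_inequality_measure[where A="{}"])
         (auto intro: integrable_measure_pmf_finite[OF finR])
    also have "\<dots> \<le> exp ?M / exp (\<mu> * D)" by (intro divide_right_mono mgf z) auto
    also have "\<dots> = exp (- \<mu> * D + ?M)" by (simp add: exp_diff[symmetric] add.commute)
    finally show ?thesis .
  qed
  have "clip C (- z) = - clip C z" for z by (simp add: clip_def)
  then have neg: "(\<Sum>i<n. clip C (x i * - y i)) = - (\<Sum>i<n. clip C (x i * y i))" for x
    by (simp add: sum_negf)
  have "{x. \<bar>\<Sum>i<n. clip C (x i * y i)\<bar> > D} \<subseteq> {x. (\<Sum>i<n. clip C (x i * y i)) > D} \<union>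
     {x. (\<Sum>i<n. clip C (x i * - y i)) > D}" unfolding neg by auto
  then have "measure_pmf.prob ?R {x. \<bar>\<Sum>i<n. clip C (x i * y i)\<bar> > D} \<le>
     measure_pmf.prob ?R ({x. (\<Sum>i<n. clip C (x i * y i)) > D} \<union>
     {x. (\<Sum>i<n. clip C (x i * - y i)) > D})" by (intro measure_pmf.finite_measure_mono) auto
  also have "\<dots> \<le> measure_pmf.prob ?R {x. (\<Sum>i<n. clip C (x i * y i)) > D} +
     measure_pmf.prob ?R {x. (\<Sum>i<n. clip C (x i * - y i)) > D}" by (rule measure_Un_le) auto
  also have "\<dots> \<le> exp (- \<mu> * D + ?M) + exp (- \<mu> * D + ?M)"
    by (intro add_mono tail) auto
  finally show ?thesis by simp
qed

text \<open>If no single entry exceeds \<open>C\<close>, clipping changes nothing. The exceptional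
  event costs \<open>1 / (s * C powr p)\<close>, whose factor \<open>1 / s\<close> lets it survive a
  union bound over order \<open>s\<close> rows.\<close>

lemma heavy_row_tail:
  assumes "s > 0" "n > 0" "p > 2" "C > 0" "\<mu> > 0" "(\<Sum>i<n. \<bar>y i\<bar> powr p) \<le> 1"
  shows "measure_pmf.prob (heavy_row p (2 * n) s n) {x. \<bar>\<Sum>i<n. x i * y i\<bar> > D}
    \<le> 1 / (real s * C powr p) + 2 * exp (- \<mu> * D + (\<mu>\<^sup>2 * (2 * real n powr (1 - 2 / p)) / (1 - 2 / p)
         + 2 * mgf_const p * exp (\<mu> * C) / C powr p) / real s)"
proof -
  let ?R = "heavy_row p (2 * n) s n"
  have "{x. \<bar>\<Sum>i<n. x i * y i\<bar> > D} \<subseteq>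
      (\<Union>i<n. {x. \<bar>x i * y i\<bar> > C}) \<union> {x. \<bar>\<Sum>i<n. clip C (x i * y i)\<bar> > D}"
  proof
    fix x assume x: "x \<in> {x. \<bar>\<Sum>i<n. x i * y i\<bar> > D}"
    show "x \<in> (\<Union>i<n. {x. \<bar>x i * y i\<bar> > C}) \<union> {x. \<bar>\<Sum>i<n. clip C (x i * y i)\<bar> > D}"
    proof (cases "\<exists>i<n. \<bar>x i * y i\<bar> > C")
      case False
      then have "\<bar>x i * y i\<bar> \<le> C" if "i < n" for i using that by (meson not_less)
      then have "(\<Sum>i<n. clip C (x i * y i)) = (\<Sum>i<n. x i * y i)"
        by (intro sum.cong) (auto simp: clip_def)
      with x show ?thesis by simp
    qed auto
  qed
  then have "measure_pmf.prob ?R {x. \<bar>\<Sum>i<n. x i * y i\<bar> > D} \<le>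
     measure_pmf.prob ?R ((\<Union>i<n. {x. \<bar>x i * y i\<bar> > C}) \<union> {x. \<bar>\<Sum>i<n. clip C (x i * y i)\<bar> > D})"
    by (intro measure_pmf.finite_measure_mono) auto
  also have "\<dots> \<le> measure_pmf.prob ?R (\<Union>i<n. {x. \<bar>x i * y i\<bar> > C}) +
     measure_pmf.prob ?R {x. \<bar>\<Sum>i<n. clip C (x i * y i)\<bar> > D}"
    by (rule measure_Un_le) auto
  also have "measure_pmf.prob ?R (\<Union>i<n. {x. \<bar>x i * y i\<bar> > C}) \<le> (\<Sum>i<n. measure_pmf.prob ?R {x. \<bar>x i * y i\<bar> > C})"
    by (intro measure_pmf.finite_measure_subadditive_finite) auto
  also have "\<dots> = (\<Sum>i<n. measure_pmf.prob (heavy_pmf p (2 * n) s) {z. \<bar>z * y i\<bar> > C})"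
    unfolding heavy_row_def by (intro sum.cong refl Pi_pmf_component_prob) auto
  also have "\<dots> \<le> (\<Sum>i<n. \<bar>y i\<bar> powr p / (real s * C powr p))"
    using assms by (intro sum_mono heavy_prob_gt) auto
  also have "\<dots> = (\<Sum>i<n. \<bar>y i\<bar> powr p) / (real s * C powr p)" by (simp add: sum_divide_distrib)
  also have "\<dots> \<le> 1 / (real s * C powr p)" using assms by (intro divide_right_mono) auto
  finally show ?thesis using heavy_row_clip_tail[OF assms, of D] by linarith
qed

section \<open>Choice of sparsity, truncation level and threshold\<close>

text \<open>With a constant threshold, the slope \<open>\<mu>\<close> of the Chernoff bound has to
  be of order \<open>ln n\<close> to beat a number of rows that grows like a power of
  \<open>n\<close>. The factor \<open>ln n\<close> keeps the variance term, of order
  \<open>\<mu>^2 * n powr (1 - 2 / p) / s\<close>, down to order \<open>ln n\<close>.\<close>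

definition sparsity :: "real \<Rightarrow> nat \<Rightarrow> nat" where
  "sparsity p n = nat \<lceil>real n powr (1 - 2 / p) * ln (real n)\<rceil>"

text \<open>\<open>n \<ge> 2\<close> keeps the unrounded value at least 1/2, so rounding up at most
  triples it.\<close>

lemma sparsity_bounds:
  assumes "n \<ge> 2" "p > 2"
  shows "sparsity p n > 0" "real n powr (1 - 2 / p) * ln (real n) \<le> real (sparsity p n)"
    "real (sparsity p n) \<le> 3 * (real n powr (1 - 2 / p) * ln (real n))"
    "ln (real n) \<ge> 1 / 2" "real n powr (1 - 2 / p) \<ge> 1"
proof -
  have "exp (1 / 2 :: real) \<le> 2"
  proof -
    have "exp (1 / 2 :: real) ^ 2 = exp 1" by (simp add: exp_of_nat_mult[symmetric])
    also have "\<dots> \<le> 2 ^ 2" using e_less_272 by simp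
    finally show ?thesis by (rule power2_le_imp_le) simp
  qed
  then have "1 / 2 \<le> ln (2 :: real)" by (subst ln_ge_iff) auto
  also have "\<dots> \<le> ln (real n)" using assms by simp
  finally show l: "ln (real n) \<ge> 1 / 2" .
  show one: "real n powr (1 - 2 / p) \<ge> 1" using assms by (intro ge_one_powr_ge_zero) auto
  have "1 * (1 / 2) \<le> real n powr (1 - 2 / p) * ln (real n)" using one l by (intro mult_mono) auto
  then have *: "1 / 2 \<le> real n powr (1 - 2 / p) * ln (real n)" by simp
  show "sparsity p n > 0" "real n powr (1 - 2 / p) * ln (real n) \<le> real (sparsity p n)"
    "real (sparsity p n) \<le> 3 * (real n powr (1 - 2 / p) * ln (real n))"
    using * unfolding sparsity_def by linarith+
qed

text \<open>The balance is \<open>\<mu> * C = \<theta> * ln n\<close>: then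
  \<open>exp (\<mu> * C) = n powr \<theta> \<le> 2 * s\<close> makes the heavy part of the exponent
  at most \<open>4 * K\<close>, while the variance part is at most \<open>2 * ln n\<close>.
  \<open>D\<close> depends on \<open>p\<close> and \<open>\<delta>\<close> only.\<close>

lemma heavy_block_upper:
  fixes p \<delta> :: real
  assumes "p > 2" "\<delta> > 0"
  obtains D where "D > 0" "\<And>n y. n \<ge> 2 \<Longrightarrow> (\<Sum>i<n. \<bar>y i\<bar> powr p) \<le> 1 \<Longrightarrow>
    measure_pmf.prob (heavy_block p (sparsity p n) n)
      {h. \<exists>j<32 * sparsity p n. \<bar>\<Sum>i<n. h j i * y i\<bar> > D} \<le> \<delta>"
proof -
  define \<theta> where "\<theta> = 1 - 2 / p"
  have \<theta>: "0 < \<theta>" "\<theta> < 1" using assms by (auto simp: \<theta>_def)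
  define K where "K = mgf_const p"
  have K: "K > 0" using assms by (simp add: K_def mgf_const_def)
  \<comment> \<open>Entries above \<open>C\<close> in \<open>32 * s\<close> rows cost at most
    \<open>32 / C powr p \<le> \<delta> / 2\<close>.\<close>
  define C where "C = max 1 ((64 / \<delta>) powr (1 / p))"
  have C: "C \<ge> 1" "C powr p \<ge> 64 / \<delta>" "C powr p \<ge> 1"
  proof -
    show "C \<ge> 1" by (simp add: C_def)
    then show "C powr p \<ge> 1" using assms by (intro ge_one_powr_ge_zero) auto
    have "64 / \<delta> = ((64 / \<delta>) powr (1 / p)) powr p" using assms by (simp add: powr_powr)
    also have "\<dots> \<le> C powr p" using assms by (intro powr_mono2) (auto simp: C_def)
    finally show "C powr p \<ge> 64 / \<delta>" .
  qed
  \<comment> \<open>\<open>192 = 32 * 2 * 3\<close>: the rows, the two tails, and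
    \<open>s \<le> 3 * n^2\<close>. The exponent is \<open>E / 2\<close> because
    \<open>ln n \<ge> 1 / 2\<close>.\<close>
  define E where "E = max 1 (2 * ln (384 * exp (4 * K) / \<delta>))"
  have E: "E \<ge> 1" "192 * exp (4 * K) * exp (- (E / 2)) \<le> \<delta> / 2"
  proof -
    show "E \<ge> 1" by (simp add: E_def)
    have "384 * exp (4 * K) / \<delta> = exp (ln (384 * exp (4 * K) / \<delta>))" using assms by simp
    also have "\<dots> \<le> exp (E / 2)" by (simp only: exp_le_cancel_iff) (simp add: E_def)
    finally show "192 * exp (4 * K) * exp (- (E / 2)) \<le> \<delta> / 2"
      using assms by (simp add: exp_minus field_simps)
  qed
  \<comment> \<open>This gives \<open>\<mu> * D = (4 + E) * ln n\<close>: two units pay for the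
    variance, two for the number of rows, and \<open>E\<close> for the constants.\<close>
  define D where "D = C / \<theta> * (4 + E)"
  show ?thesis
  proof (rule that[of D])
    show "D > 0" using C E \<theta> by (simp add: D_def)
    fix n :: nat and y :: "nat \<Rightarrow> real"
    assume n: "n \<ge> 2" and y: "(\<Sum>i<n. \<bar>y i\<bar> powr p) \<le> 1"
    define s where "s = sparsity p n"
    define L where "L = ln (real n)"
    note sb = sparsity_bounds[OF n assms(1), folded s_def \<theta>_def L_def]
    define \<mu> where "\<mu> = \<theta> * L / C"
    have \<mu>: "\<mu> > 0" using \<theta> sb C by (simp add: \<mu>_def)
    have N: "real n powr \<theta> = exp (\<theta> * L)" using n by (simp add: powr_def L_def)
    have eC: "exp (\<mu> * C) = real n powr \<theta>" using C by (simp add: \<mu>_def N)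
    have half: "real n powr \<theta> \<le> 2 * real s"
    proof -
      have "real n powr \<theta> * 1 \<le> real n powr \<theta> * (2 * L)" using sb by (intro mult_left_mono) auto
      then show ?thesis using sb by simp
    qed
    let ?R = "heavy_row p (2 * n) s n"
    have tail: "measure_pmf.prob ?R {x. \<bar>\<Sum>i<n. x i * y i\<bar> > D}
      \<le> 1 / (real s * C powr p) + 2 * exp (- \<mu> * D + (\<mu>\<^sup>2 * (2 * real n powr \<theta>) / \<theta>
         + 2 * K * exp (\<mu> * C) / C powr p) / real s)" (is "_ \<le> _ + 2 * exp (_ + ?M / _)")
      using heavy_row_tail[OF sb(1) _ assms(1) _ \<mu> y, of C D] n C by (simp add: \<theta>_def K_def)
    have M: "?M / real s \<le> 2 * L + 4 * K"
    proof -
      have "\<mu>\<^sup>2 * (2 * real n powr \<theta>) / \<theta> = 2 * \<theta> / C\<^sup>2 * L * (real n powr \<theta> * L)"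
        using \<theta> C by (simp add: \<mu>_def power2_eq_square field_simps)
      also have "\<dots> \<le> 2 * L * real s"
      proof (intro mult_mono)
        have "2 * \<theta> / C\<^sup>2 \<le> 2 * 1 / 1" using \<theta> C by (intro frac_le) (auto simp: one_le_power)
        then show "2 * \<theta> / C\<^sup>2 \<le> 2" by simp
      qed (use sb \<theta> in auto)
      finally have 1: "\<mu>\<^sup>2 * (2 * real n powr \<theta>) / \<theta> \<le> 2 * L * real s" .
      have "2 * K * exp (\<mu> * C) / C powr p \<le> 2 * K * (2 * real s) / 1"
        unfolding eC using half K C by (intro frac_le mult_left_mono) auto
      with 1 have "?M \<le> (2 * L + 4 * K) * real s" by (simp add: algebra_simps)
      then show ?thesis using sb(1) by (simp add: field_simps)
    qed
    have "\<mu> * D = L * (4 + E)" using C \<theta> by (simp add: \<mu>_def D_def)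
    with M have expo: "- \<mu> * D + ?M / real s \<le> 4 * K - 2 * L - E * L" by (simp add: algebra_simps)
    have "L \<le> real n" using n by (simp add: L_def ln_bound)
    have eL: "exp L = real n" using n by (simp add: L_def)
    have "real n powr \<theta> \<le> real n powr 1" using n \<theta> by (intro powr_mono) auto
    then have sn: "real s \<le> 3 * exp (2 * L)"
    proof -
      have "real s \<le> 3 * (real n powr \<theta> * L)" by (rule sb)
      also have "\<dots> \<le> 3 * (real n * real n)"
        using \<open>L \<le> real n\<close> \<open>real n powr \<theta> \<le> real n powr 1\<close> sb by (intro mult_left_mono mult_mono) auto
      also have "real n * real n = exp (2 * L)" by (simp add: eL[symmetric] exp_add[symmetric])
      finally show ?thesis .
    qed
    have "measure_pmf.prob (heavy_block p s n) {h. \<exists>j<32 * s. \<bar>\<Sum>i<n. h j i * y i\<bar> > D}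
       \<le> measure_pmf.prob (heavy_block p s n) (\<Union>j<32 * s. {h. \<bar>\<Sum>i<n. h j i * y i\<bar> > D})"
      by (intro measure_pmf.finite_measure_mono) auto
    also have "\<dots> \<le> (\<Sum>j<32 * s. measure_pmf.prob (heavy_block p s n) {h. \<bar>\<Sum>i<n. h j i * y i\<bar> > D})"
      by (intro measure_pmf.finite_measure_subadditive_finite) auto
    also have "\<dots> = (\<Sum>j<32 * s. measure_pmf.prob ?R {x. \<bar>\<Sum>i<n. x i * y i\<bar> > D})"
      unfolding heavy_block_def by (intro sum.cong refl Pi_pmf_component_prob) auto
    also have "\<dots> = 32 * real s * measure_pmf.prob ?R {x. \<bar>\<Sum>i<n. x i * y i\<bar> > D}" by simp
    also have "\<dots> \<le> 32 * real s * (1 / (real s * C powr p) + 2 * exp (4 * K - 2 * L - E * L))"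
    proof -
      have "exp (- \<mu> * D + ?M / real s) \<le> exp (4 * K - 2 * L - E * L)" using expo by simp
      with tail have "measure_pmf.prob ?R {x. \<bar>\<Sum>i<n. x i * y i\<bar> > D}
         \<le> 1 / (real s * C powr p) + 2 * exp (4 * K - 2 * L - E * L)" by linarith
      then show ?thesis by (intro mult_left_mono) auto
    qed
    also have "\<dots> = 32 / C powr p + 64 * real s * exp (4 * K - 2 * L - E * L)"
      using sb(1) by (simp add: field_simps)
    also have "\<dots> \<le> \<delta> / 2 + \<delta> / 2"
    proof (rule add_mono)
      have "32 / C powr p \<le> 32 / (64 / \<delta>)" using C assms by (intro divide_left_mono) auto
      then show "32 / C powr p \<le> \<delta> / 2" by simp
      have "64 * real s * exp (4 * K - 2 * L - E * L) \<le> 64 * (3 * exp (2 * L)) * exp (4 * K - 2 * L - E * L)"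
        using sn by (intro mult_right_mono mult_left_mono) auto
      also have "\<dots> = 192 * exp (4 * K) * exp (- (E * L))" by (simp add: exp_diff exp_minus exp_add field_simps)
      also have "\<dots> \<le> 192 * exp (4 * K) * exp (- (E / 2))"
        using E mult_left_mono[OF sb(4), of E] by (intro mult_left_mono) auto
      also have "\<dots> \<le> \<delta> / 2" by (rule E)
      finally show "64 * real s * exp (4 * K - 2 * L - E * L) \<le> \<delta> / 2" .
    qed
    finally show "measure_pmf.prob (heavy_block p (sparsity p n) n)
      {h. \<exists>j<32 * sparsity p n. \<bar>\<Sum>i<n. h j i * y i\<bar> > D} \<le> \<delta>" by (simp add: s_def)
  qed
qed

section \<open>Random sign matrices\<close>

text \<open>The logarithmic estimate behind Hoeffding's lemma, for a fair coin and range
  \<open>2 * |a|\<close>.\<close>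

lemma cosh_le_exp_square: "cosh (a::real) \<le> exp (a\<^sup>2 / 2)"
proof -
  let ?b = "\<bar>a\<bar>"
  have "- (2 * ?b) * (1 / 2) + ln (1 + 1 / 2 * (exp (2 * ?b) - 1)) \<le> (2 * ?b)\<^sup>2 / 8"
    by (rule Hoeffdings_lemma_aux) auto
  then have "ln ((1 + exp (2 * ?b)) / 2) \<le> ?b + a\<^sup>2 / 2"
    by (simp add: power_mult_distrib field_simps)
  moreover have "(1 + exp (2 * ?b)) / 2 > 0" by (simp add: add_pos_pos)
  ultimately have "(1 + exp (2 * ?b)) / 2 \<le> exp (?b + a\<^sup>2 / 2)"
    by (metis exp_le_cancel_iff exp_ln)
  then have "(1 + exp (2 * ?b)) / 2 * exp (- ?b) \<le> exp (?b + a\<^sup>2 / 2) * exp (- ?b)"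
    by (intro mult_right_mono) auto
  moreover have "(1 + exp (2 * ?b)) / 2 * exp (- ?b) = cosh ?b"
    by (simp add: cosh_field_def algebra_simps exp_add[symmetric])
  moreover have "exp (?b + a\<^sup>2 / 2) * exp (- ?b) = exp (a\<^sup>2 / 2)" by (simp add: exp_add[symmetric])
  ultimately show ?thesis by simp
qed

definition sign_pmf :: "real pmf" where
  "sign_pmf = pmf_of_set {- 1, 1}"

definition sign_vector :: "nat \<Rightarrow> (nat \<Rightarrow> real) pmf" where
  "sign_vector d = Pi_pmf {..<d} 0 (\<lambda>_. sign_pmf)"

text \<open>The first index is the column of \<open>G\<close>: \<open>g l i\<close> is the entry of
  \<open>G\<close> in row \<open>i\<close> and column \<open>l\<close>.\<close>

definition sign_matrix :: "nat \<Rightarrow> nat \<Rightarrow> (nat \<Rightarrow> nat \<Rightarrow> real) pmf" where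
  "sign_matrix m d = Pi_pmf {..<m} (\<lambda>_. 0) (\<lambda>_. sign_vector d)"

lemma set_sign_pmf: "set_pmf sign_pmf = {- 1, 1}"
  by (simp add: sign_pmf_def)

lemma finite_sign_Pi: "finite A \<Longrightarrow> finite (set_pmf (Pi_pmf A 0 (\<lambda>_. sign_pmf)))"
  by (simp add: set_Pi_pmf finite_PiE_dflt set_sign_pmf)

lemma finite_sign_vector: "finite (set_pmf (sign_vector d))"
  by (simp add: sign_vector_def finite_sign_Pi)

lemma finite_sign_matrix: "finite (set_pmf (sign_matrix m d))"
  by (simp add: sign_matrix_def set_Pi_pmf finite_PiE_dflt finite_sign_vector)

lemma sign_matrix_range:
  assumes "g \<in> set_pmf (sign_matrix m d)" shows "\<bar>g l i\<bar> \<le> 1"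
proof -
  have g: "g \<in> PiE_dflt {..<m} (\<lambda>_. 0) (\<lambda>_. set_pmf (sign_vector d))"
    using assms by (simp add: sign_matrix_def set_Pi_pmf)
  show ?thesis
  proof (cases "l < m")
    case True
    then have "g l \<in> PiE_dflt {..<d} 0 (\<lambda>_. {-1, 1})"
      using g by (auto simp: PiE_dflt_def sign_vector_def set_Pi_pmf set_sign_pmf)
    then show ?thesis by (cases "i < d") (auto simp: PiE_dflt_def)
  next
    case False
    then show ?thesis using g by (auto simp: PiE_dflt_def)
  qed
qed

section \<open>Anti-concentration of sign sums\<close>

lemma sign_expectation: "measure_pmf.expectation sign_pmf f = (f (- 1) + f 1) / (2::real)"
  by (simp add: sign_pmf_def integral_pmf_of_set)

text \<open>Characteristic function of a weighted sum of signs. It is real by symmetry, so cosines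
  suffice and the induction step is the formula for
  \<open>cos (a + b) + cos (a - b)\<close>.\<close>

lemma expectation_cos_signs:
  assumes "finite A"
  shows "measure_pmf.expectation (Pi_pmf A 0 (\<lambda>_. sign_pmf)) (\<lambda>x. cos (\<Sum>i\<in>A. x i * v i)) = (\<Prod>i\<in>A. cos (v i :: real))"
  using assms
proof (induction A rule: finite_induct)
  case (insert a A)
  let ?Q = "Pi_pmf A 0 (\<lambda>_. sign_pmf)"
  let ?S = "\<lambda>x. \<Sum>i\<in>A. x i * v i"
  have fin: "finite (set_pmf ?Q)" using insert by (simp add: finite_sign_Pi)
  have int: "integrable (measure_pmf ?Q) f" for f :: "_ \<Rightarrow> real"
    using fin by (rule integrable_measure_pmf_finite)
  have upd: "(\<Sum>i\<in>insert a A. (x(a := y)) i * v i) = y * v a + ?S x" for x y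
    using insert by (auto intro!: sum.cong)
  have "measure_pmf.expectation (Pi_pmf (insert a A) 0 (\<lambda>_. sign_pmf)) (\<lambda>x. cos (\<Sum>i\<in>insert a A. x i * v i)) =
     measure_pmf.expectation (sign_pmf \<bind> (\<lambda>y. map_pmf (\<lambda>x. x(a := y)) ?Q)) (\<lambda>x. cos (\<Sum>i\<in>insert a A. x i * v i))"
    using insert by (simp add: Pi_pmf_insert' map_pmf_def)
  also have "\<dots> = (\<Sum>y\<in>{- 1, 1}. measure_pmf.expectation (map_pmf (\<lambda>x. x(a := y)) ?Q) (\<lambda>x. cos (\<Sum>i\<in>insert a A. x i * v i)) /\<^sub>R real (card {- 1, 1 :: real}))"
    unfolding sign_pmf_def by (rule pmf_expectation_bind_pmf_of_set) (use fin in \<open>auto simp: sign_pmf_def\<close>)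
  also have "\<dots> = (measure_pmf.expectation ?Q (\<lambda>x. cos (?S x - v a)) + measure_pmf.expectation ?Q (\<lambda>x. cos (v a + ?S x))) / 2"
  proof -
    have "measure_pmf.expectation (map_pmf (\<lambda>x. x(a := y)) ?Q) (\<lambda>x. cos (\<Sum>i\<in>insert a A. x i * v i)) =
       measure_pmf.expectation ?Q (\<lambda>x. cos (y * v a + ?S x))" for y
      by (simp only: integral_map_pmf upd)
    then show ?thesis by (simp add: add_divide_distrib)
  qed
  also have "\<dots> = measure_pmf.expectation ?Q (\<lambda>x. cos (?S x - v a) + cos (v a + ?S x)) / 2"
    by (simp add: int)
  also have "\<dots> = measure_pmf.expectation ?Q (\<lambda>x. 2 * cos (v a) * cos (?S x)) / 2"
    by (intro arg_cong2[where f="(/)"] refl Bochner_Integration.integral_cong) (simp add: cos_add cos_diff)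
  also have "\<dots> = cos (v a) * (\<Prod>i\<in>A. cos (v i))" using insert.IH by simp
  finally show ?case using insert by simp
qed simp

text \<open>For \<open>|v| \<le> 1\<close> the fourth-order Taylor remainder is at most
  \<open>v^2 / 24\<close>, and \<open>11 / 24 = 1 / 2 - 1 / 24\<close>.\<close>

lemma cos_le_exp_neg: "cos v \<le> exp (- (11 / 24 * v\<^sup>2))" if "\<bar>v\<bar> \<le> (1::real)"
proof -
  obtain t where t: "cos v = (\<Sum>m<4. cos_coeff m * v ^ m) + cos (t + 1 / 2 * real 4 * pi) / fact 4 * v ^ 4"
    using Maclaurin_cos_expansion[of v 4] by blast
  have "cos (t + 1 / 2 * real 4 * pi) / fact 4 * v ^ 4 \<le> 1 / 24 * v ^ 4"
    by (intro mult_right_mono) (auto simp: fact_numeral)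
  moreover have "(\<Sum>m<4. cos_coeff m * v ^ m) = 1 - v\<^sup>2 / 2"
  proof -
    have "{..<4::nat} = {0, 1, 2, 3}" by auto
    then show ?thesis by (simp add: cos_coeff_def)
  qed
  moreover have "v\<^sup>2 * v\<^sup>2 \<le> v\<^sup>2 * 1" using that by (intro mult_left_mono) (auto simp: abs_square_le_1)
  then have "v ^ 4 \<le> v\<^sup>2" by (simp add: power4_eq_xxxx power2_eq_square)
  ultimately have "cos v \<le> 1 - 11 / 24 * v\<^sup>2" using t by linarith
  also have "\<dots> \<le> exp (- (11 / 24 * v\<^sup>2))" using exp_ge_add_one_self[of "- (11 / 24 * v\<^sup>2)"] by simp
  finally show ?thesis .
qed

text \<open>A majorant affine in \<open>cos t\<close>, so that its mean over sign sums can be read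
  off the characteristic function. For \<open>|t| > 2\<close> the least value 1/5 of the right side
  already exceeds \<open>exp (- 2)\<close>; otherwise both sides are compared with
  \<open>1 - 2 / 5 * |t|\<close>.\<close>

lemma exp_neg_abs_le: "exp (- \<bar>t\<bar>) \<le> 3 / 5 + 2 / 5 * cos (t::real)"
proof (cases "\<bar>t\<bar> \<le> 2")
  case True
  let ?u = "\<bar>t\<bar>"
  have "1 + ?u + ?u\<^sup>2 / 2 \<le> exp ?u" using exp_lower_Taylor_quadratic[of ?u] by simp
  moreover have "1 \<le> (1 - 2 / 5 * ?u) * (1 + ?u + ?u\<^sup>2 / 2)"
  proof -
    \<comment> \<open>The factor \<open>2 - u\<close> is the reason for splitting the cases at
      2.\<close>
    have ring: "u * ((2 - u) * (3 / 10 + u / 5)) = (1 - 2 / 5 * u) * (1 + u + u\<^sup>2 / 2) - 1" for u :: real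
      by (simp add: power2_eq_square field_simps)
    have "0 \<le> ?u * ((2 - ?u) * (3 / 10 + ?u / 5))" using True by (intro mult_nonneg_nonneg) auto
    also have "\<dots> = (1 - 2 / 5 * ?u) * (1 + ?u + ?u\<^sup>2 / 2) - 1"
      by (rule ring)
    finally show ?thesis by simp
  qed
  moreover have "1 - 2 / 5 * ?u \<ge> 0" using True by simp
  ultimately have "1 \<le> (1 - 2 / 5 * ?u) * exp ?u" by (meson mult_left_mono order_trans)
  then have "exp (- ?u) \<le> 1 - 2 / 5 * ?u" by (simp add: exp_minus field_simps)
  moreover have "1 - cos t \<le> ?u"
  proof -
    obtain z where z: "cos t = (\<Sum>m<2. cos_coeff m * t ^ m) + cos (z + 1 / 2 * real 2 * pi) / fact 2 * t ^ 2"
      using Maclaurin_cos_expansion[of t 2] by blast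
    have "- 1 / 2 * t ^ 2 \<le> cos (z + 1 / 2 * real 2 * pi) / fact 2 * t ^ 2"
      by (intro mult_right_mono) auto
    moreover have "(\<Sum>m<2. cos_coeff m * t ^ m) = 1"
      by (simp add: cos_coeff_def numeral_2_eq_2)
    ultimately have "1 - cos t \<le> ?u * ?u / 2" using z by (simp add: power2_eq_square)
    also have "\<dots> \<le> 2 * ?u / 2" using True by (intro divide_right_mono mult_right_mono) auto
    finally show ?thesis by simp
  qed
  ultimately show ?thesis by linarith
next
  case False
  have "exp (- \<bar>t\<bar>) \<le> exp (- 2)" using False by simp
  also have "exp (- 2 :: real) \<le> 1 / 5"
    using exp_lower_Taylor_quadratic[of "2::real"] by (simp add: exp_minus field_simps)
  also have "1 / 5 \<le> 3 / 5 + 2 / 5 * cos t" using cos_ge_minus_one[of t] by linarith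
  finally show ?thesis .
qed

text \<open>A constant below 1 that is uniform over unit vectors, whether spread out or concentrated
  on few coordinates. \<open>43 / 50 = 3 / 5 + 2 / 5 * 13 / 20\<close>, with
  \<open>exp (- 11 / 24) \<le> 13 / 20\<close>.\<close>

lemma sign_vector_exp_neg_abs:
  assumes "(\<Sum>i<d. (v i)\<^sup>2) = 1"
  shows "measure_pmf.expectation (sign_vector d) (\<lambda>x. exp (- \<bar>\<Sum>i<d. x i * v i\<bar>)) \<le> 43 / 50"
proof -
  have int: "integrable (measure_pmf (sign_vector d)) f" for f :: "_ \<Rightarrow> real"
    by (rule integrable_measure_pmf_finite[OF finite_sign_vector])
  have v1: "\<bar>v i\<bar> \<le> 1" if "i < d" for i
  proof -
    have "(v i)\<^sup>2 \<le> (\<Sum>i<d. (v i)\<^sup>2)" using that by (intro member_le_sum) auto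
    then show ?thesis using assms by (simp add: abs_square_le_1)
  qed
  have "measure_pmf.expectation (sign_vector d) (\<lambda>x. exp (- \<bar>\<Sum>i<d. x i * v i\<bar>)) \<le>
     measure_pmf.expectation (sign_vector d) (\<lambda>x. 3 / 5 + 2 / 5 * cos (\<Sum>i<d. x i * v i))"
    by (intro integral_mono int exp_neg_abs_le)
  also have "\<dots> = 3 / 5 + 2 / 5 * (\<Prod>i<d. cos (v i))"
    using expectation_cos_signs[of "{..<d}" v] by (simp add: int sign_vector_def[symmetric])
  also have "(\<Prod>i<d. cos (v i)) \<le> (\<Prod>i<d. exp (- (11 / 24 * (v i)\<^sup>2)))"
  proof (intro prod_mono conjI cos_le_exp_neg v1)
    fix i assume "i \<in> {..<d}"
    then have "\<bar>v i\<bar> < pi / 2" using v1[of i] pi_gt3 by simp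
    then show "0 \<le> cos (v i)" by (intro cos_ge_zero) auto
  qed auto
  also have "(\<Prod>i<d. exp (- (11 / 24 * (v i)\<^sup>2))) = exp (- (11 / 24 * (\<Sum>i<d. (v i)\<^sup>2)))"
    by (simp add: exp_sum[symmetric] sum_negf sum_distrib_left)
  also have "\<dots> \<le> 13 / 20"
    using exp_lower_Taylor_quadratic[of "11 / 24 :: real"] assms by (simp add: exp_minus field_simps power2_eq_square)
  finally show ?thesis by simp
qed

text \<open>Exponential Markov inequality: each column contributes a factor
  \<open>43 / 50 * exp (1 / 20) \<le> 91 / 100\<close>, and 40 columns bring the product below
  1/40.\<close>

lemma sign_matrix_lower:
  assumes "(\<Sum>i<d. (v i)\<^sup>2) = 1" "m \<ge> 40"
  shows "measure_pmf.prob (sign_matrix m d) {g. (\<Sum>l<m. \<bar>\<Sum>i<d. g l i * v i\<bar>) < real m / 20} \<le> 1 / 40"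
proof -
  let ?X = "\<lambda>g. (\<Sum>l<m. \<bar>\<Sum>i<d. g l i * v i\<bar>)"
  have "measure_pmf.prob (sign_matrix m d) {g. ?X g < real m / 20} \<le>
     measure_pmf.prob (sign_matrix m d) {g \<in> space (sign_matrix m d). exp (- ?X g) \<ge> exp (- (real m / 20))}"
    by (intro measure_pmf.finite_measure_mono) auto
  also have "\<dots> \<le> measure_pmf.expectation (sign_matrix m d) (\<lambda>g. exp (- ?X g)) / exp (- (real m / 20))"
    by (rule integral_Markov_inequality_measure[where A="{}"])
       (auto intro: integrable_measure_pmf_finite[OF finite_sign_matrix])
  also have "measure_pmf.expectation (sign_matrix m d) (\<lambda>g. exp (- ?X g)) =
     measure_pmf.expectation (sign_matrix m d) (\<lambda>g. \<Prod>l<m. exp (- \<bar>\<Sum>i<d. g l i * v i\<bar>))"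
    by (simp add: exp_sum[symmetric] sum_negf)
  also have "\<dots> = (\<Prod>l<m. measure_pmf.expectation (sign_vector d) (\<lambda>x. exp (- \<bar>\<Sum>i<d. x i * v i\<bar>)))"
    unfolding sign_matrix_def
    by (rule expectation_prod_Pi_pmf) (auto intro: integrable_measure_pmf_finite[OF finite_sign_vector])
  also have "\<dots> / exp (- (real m / 20)) \<le> (43 / 50) ^ m / exp (- (real m / 20))"
    using sign_vector_exp_neg_abs[OF assms(1)]
    by (intro divide_right_mono) (auto intro!: power_mono Bochner_Integration.integral_nonneg)
  also have "\<dots> = (43 / 50 * exp (1 / 20)) ^ m"
    by (simp add: exp_minus power_mult_distrib exp_of_nat_mult[symmetric] field_simps)
  also have "\<dots> \<le> (91 / 100) ^ m"
  proof (intro power_mono)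
    have "1 - 1 / 20 \<le> exp (- (1 / 20) :: real)" using exp_ge_add_one_self[of "- (1 / 20) :: real"] by simp
    then show "43 / 50 * exp (1 / 20) \<le> (91 / 100 :: real)" by (simp add: exp_minus field_simps)
  qed auto
  also have "\<dots> \<le> (91 / 100) ^ 40" using assms by (intro power_decreasing) auto
  also have "\<dots> \<le> (1 / 40 :: real)" by (simp add: power_divide)
  finally show ?thesis .
qed

section \<open>Exponential moment of the squared length of a projection\<close>

text \<open>The bound must not depend on \<open>J\<close>. The induction proves
  \<open>5 - 4 * (2 / 3) ^ J\<close>, whose increments are exactly
  \<open>2 * (2 / 3) ^ (J + 1)\<close>, a bound for the two new terms.\<close>

lemma sum_gaussian_le: "(\<Sum>j\<in>{- int J..int J}. exp (- (real_of_int j)\<^sup>2 / 2)) \<le> 5"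
proof -
  have half: "exp (- 1 / 2 :: real) \<le> 2 / 3"
    using exp_ge_add_one_self[of "1 / 2 :: real"] by (simp add: exp_minus field_simps)
  have "(\<Sum>j\<in>{- int J..int J}. exp (- (real_of_int j)\<^sup>2 / 2)) \<le> 5 - 4 * (2 / 3) ^ J"
  proof (induction J)
    case (Suc J)
    have "{- int (Suc J)..int (Suc J)} = insert (- int (Suc J)) (insert (int (Suc J)) {- int J..int J})" by auto
    then have "(\<Sum>j\<in>{- int (Suc J)..int (Suc J)}. exp (- (real_of_int j)\<^sup>2 / 2)) =
       2 * exp (- (real (Suc J))\<^sup>2 / 2) + (\<Sum>j\<in>{- int J..int J}. exp (- (real_of_int j)\<^sup>2 / 2))"
      by (simp add: power2_eq_square algebra_simps)
    also have "exp (- (real (Suc J))\<^sup>2 / 2) \<le> exp (real (Suc J) * (- 1 / 2))"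
    proof -
      have "- z\<^sup>2 / 2 \<le> z * (- 1 / 2)" if "z \<ge> 1" for z :: real using that by (simp add: power2_eq_square)
      from this[of "real (Suc J)"] have "- (real (Suc J))\<^sup>2 / 2 \<le> real (Suc J) * (- 1 / 2)" by simp
      then show ?thesis by (simp only: exp_le_cancel_iff)
    qed
    also have "\<dots> = exp (- 1 / 2) ^ Suc J" by (rule exp_of_nat_mult)
    also have "\<dots> \<le> (2 / 3) ^ Suc J" using half by (intro power_mono) auto
    finally show ?case using Suc by simp
  qed simp
  also have "\<dots> \<le> 5" by simp
  finally show ?thesis .
qed

text \<open>A discrete substitute for linearising a square with an independent Gaussian variable:
  the lattice sum is dominated by the integer nearest to \<open>b / 2\<close>.\<close>

lemma exp_square_le_lattice_sum:
  assumes "\<bar>b\<bar> \<le> 2 * real J"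
  shows "exp (b\<^sup>2 / 4) \<le> exp (1 / 4) * (\<Sum>j\<in>{- int J..int J}. exp (- (real_of_int j)\<^sup>2 + real_of_int j * b))"
proof -
  define k where "k = round (b / 2)"
  have k: "k \<in> {- int J..int J}" using assms unfolding k_def round_def by (auto; linarith)
  have near: "\<bar>b / 2 - real_of_int k\<bar> \<le> 1 / 2" unfolding k_def using of_int_round_abs_le[of "b / 2"] by (simp add: abs_minus_commute)
  \<comment> \<open>Completing the square: \<open>b^2 / 4 = (b / 2 - k)^2 + (- k^2 + k * b)\<close>,
    so rounding costs the factor \<open>exp (1 / 4)\<close>.\<close>
  have "(b / 2 - real_of_int k)\<^sup>2 \<le> (1 / 2)\<^sup>2" using near by (metis abs_ge_zero power2_abs power_mono)
  then have "b\<^sup>2 / 4 \<le> 1 / 4 + (- (real_of_int k)\<^sup>2 + real_of_int k * b)"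
    by (simp add: power2_eq_square algebra_simps)
  then have "exp (b\<^sup>2 / 4) \<le> exp (1 / 4) * exp (- (real_of_int k)\<^sup>2 + real_of_int k * b)"
    by (simp only: exp_add[symmetric] exp_le_cancel_iff)
  also have "exp (- (real_of_int k)\<^sup>2 + real_of_int k * b) \<le> (\<Sum>j\<in>{- int J..int J}. exp (- (real_of_int j)\<^sup>2 + real_of_int j * b))"
    by (rule member_le_sum[OF k]) auto
  finally show ?thesis by simp
qed

lemma sign_matrix_mgf:
  assumes "\<And>l. l < m \<Longrightarrow> \<bar>x l\<bar> = 1"
  shows "measure_pmf.expectation (sign_matrix m d) (\<lambda>g. exp (\<Sum>l<m. \<Sum>i<d. g l i * (x l * w i))) \<le> exp (real m * (\<Sum>i<d. (w i)\<^sup>2) / 2)"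
proof -
  have "measure_pmf.expectation (sign_matrix m d) (\<lambda>g. exp (\<Sum>l<m. \<Sum>i<d. g l i * (x l * w i))) =
     measure_pmf.expectation (sign_matrix m d) (\<lambda>g. \<Prod>l<m. exp (\<Sum>i<d. g l i * (x l * w i)))"
    by (simp add: exp_sum)
  also have "\<dots> = (\<Prod>l<m. measure_pmf.expectation (sign_vector d) (\<lambda>z. exp (\<Sum>i<d. z i * (x l * w i))))"
    unfolding sign_matrix_def
    by (rule expectation_prod_Pi_pmf) (auto intro: integrable_measure_pmf_finite[OF finite_sign_vector])
  also have "\<dots> \<le> (\<Prod>l<m. exp ((\<Sum>i<d. (w i)\<^sup>2) / 2))"
  proof (intro prod_mono conjI Bochner_Integration.integral_nonneg)
    fix l assume l: "l \<in> {..<m}"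
    have "measure_pmf.expectation (sign_vector d) (\<lambda>z. exp (\<Sum>i<d. z i * (x l * w i))) =
       measure_pmf.expectation (sign_vector d) (\<lambda>z. \<Prod>i<d. exp (z i * (x l * w i)))"
      by (simp add: exp_sum)
    also have "\<dots> = (\<Prod>i<d. measure_pmf.expectation sign_pmf (\<lambda>z. exp (z * (x l * w i))))"
      unfolding sign_vector_def
      by (rule expectation_prod_Pi_pmf) (auto intro!: integrable_measure_pmf_finite simp: set_sign_pmf)
    also have "\<dots> = (\<Prod>i<d. cosh (x l * w i))"
      by (intro prod.cong refl) (simp add: sign_expectation cosh_field_def add.commute)
    also have "\<dots> \<le> (\<Prod>i<d. exp ((x l * w i)\<^sup>2 / 2))"
      by (intro prod_mono conjI cosh_le_exp_square) auto
    also have "\<dots> = (\<Prod>i<d. exp ((w i)\<^sup>2 / 2))"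
    proof -
      have "(x l)\<^sup>2 = 1" using assms[of l] l by (simp add: power2_eq_1_iff abs_eq_iff')
      then show ?thesis by (simp add: power_mult_distrib)
    qed
    also have "\<dots> = exp ((\<Sum>i<d. (w i)\<^sup>2) / 2)" by (simp add: exp_sum sum_divide_distrib)
    finally show "measure_pmf.expectation (sign_vector d) (\<lambda>z. exp (\<Sum>i<d. z i * (x l * w i))) \<le> exp ((\<Sum>i<d. (w i)\<^sup>2) / 2)" .
  qed auto
  also have "\<dots> = exp (real m * (\<Sum>i<d. (w i)\<^sup>2) / 2)" by (simp add: exp_of_nat_mult[symmetric])
  finally show ?thesis .
qed

text \<open>Pythagoras without normalisation, since some of the vectors \<open>q k\<close> may be
  zero.\<close>

lemma sum_square_orthogonal:
  fixes q :: "nat \<Rightarrow> nat \<Rightarrow> real"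
  assumes "\<And>a b. a < r \<Longrightarrow> b < r \<Longrightarrow> a \<noteq> b \<Longrightarrow> (\<Sum>i<d. q a i * q b i) = 0"
  shows "(\<Sum>i<d. (\<Sum>k<r. z k * q k i)\<^sup>2) = (\<Sum>k<r. (z k)\<^sup>2 * (\<Sum>i<d. (q k i)\<^sup>2))"
proof -
  have "(\<Sum>i<d. (\<Sum>k<r. z k * q k i)\<^sup>2) = (\<Sum>i<d. \<Sum>k<r. \<Sum>k'<r. z k * z k' * (q k i * q k' i))"
    by (simp add: power2_eq_square sum_product mult_ac)
  also have "\<dots> = (\<Sum>k<r. \<Sum>k'<r. z k * z k' * (\<Sum>i<d. q k i * q k' i))"
  proof -
    have "(\<Sum>i<d. \<Sum>k<r. \<Sum>k'<r. z k * z k' * (q k i * q k' i)) =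
       (\<Sum>k<r. \<Sum>i<d. \<Sum>k'<r. z k * z k' * (q k i * q k' i))" by (rule sum.swap)
    also have "\<dots> = (\<Sum>k<r. \<Sum>k'<r. \<Sum>i<d. z k * z k' * (q k i * q k' i))"
      by (intro sum.cong refl sum.swap)
    finally show ?thesis by (simp only: sum_distrib_left)
  qed
  also have "\<dots> = (\<Sum>k<r. \<Sum>k'<r. if k' = k then (z k)\<^sup>2 * (\<Sum>i<d. (q k i)\<^sup>2) else 0)"
    using assms by (intro sum.cong refl) (auto simp: power2_eq_square)
  also have "\<dots> = (\<Sum>k<r. (z k)\<^sup>2 * (\<Sum>i<d. (q k i)\<^sup>2))"
    by (intro sum.cong refl) (simp add: sum.delta)
  finally show ?thesis .
qed

text \<open>With \<open>b g k\<close> the \<open>k\<close>-th coordinate of \<open>G x\<close>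
  divided by \<open>sqrt m\<close>, the lattice sum reduces the exponential moment of the quadratic
  form to moments of linear forms in the signs. For a lattice point \<open>z\<close> such a moment
  is at most \<open>exp (|z|^2 / 2)\<close>, which leaves \<open>exp (- |z|^2 / 2)\<close> and sums
  to at most 5 per coordinate. Each coordinate thus costs \<open>5 * exp (1 / 4) \<le> 7\<close>,
  while the threshold gains \<open>exp (- 9)\<close> for each column.\<close>

lemma sign_matrix_upper:
  fixes q :: "nat \<Rightarrow> nat \<Rightarrow> real"
  assumes x: "\<And>l. l < m \<Longrightarrow> \<bar>x l\<bar> = 1"
    and orth: "\<And>a b. a < r \<Longrightarrow> b < r \<Longrightarrow> a \<noteq> b \<Longrightarrow> (\<Sum>i<d. q a i * q b i) = 0"
    and unit: "\<And>a. a < r \<Longrightarrow> (\<Sum>i<d. (q a i)\<^sup>2) \<le> 1"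
    and m: "r \<le> m" "m > 0"
  shows "measure_pmf.prob (sign_matrix m d)
     {g. (\<Sum>k<r. (\<Sum>i<d. q k i * (\<Sum>l<m. g l i * x l))\<^sup>2) > 36 * (real m)\<^sup>2} \<le> (1 / 80) ^ m"
proof -
  let ?P = "sign_matrix m d"
  have int: "integrable (measure_pmf ?P) f" for f :: "_ \<Rightarrow> real"
    by (rule integrable_measure_pmf_finite[OF finite_sign_matrix])
  define b where "b g k = (\<Sum>i<d. q k i * (\<Sum>l<m. g l i * x l)) / sqrt (real m)" for g :: "nat \<Rightarrow> nat \<Rightarrow> real" and k
  \<comment> \<open>A crude bound for \<open>|b g k|\<close>: it only makes the lattice finite, and
    the size of the box does not enter the estimate.\<close>
  define J where "J = m * d"
  let ?Z = "PiE {..<r} (\<lambda>_. {- int J..int J})"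
  let ?e = "\<lambda>z g. exp (\<Sum>k<r. - (real_of_int (z k))\<^sup>2 + real_of_int (z k) * b g k)"
  have b: "\<bar>b g k\<bar> \<le> 2 * real J" if "g \<in> set_pmf ?P" "k < r" for g k
  proof -
    have "\<bar>q k i\<bar> \<le> 1" if "i < d" for i
    proof -
      have "(q k i)\<^sup>2 \<le> (\<Sum>i<d. (q k i)\<^sup>2)" using that by (intro member_le_sum) auto
      also have "\<dots> \<le> 1" using \<open>k < r\<close> by (rule unit)
      finally show ?thesis by (simp add: abs_square_le_1)
    qed
    moreover have "\<bar>\<Sum>l<m. g l i * x l\<bar> \<le> real m" for i
    proof -
      have "\<bar>\<Sum>l<m. g l i * x l\<bar> \<le> (\<Sum>l<m. \<bar>g l i * x l\<bar>)" by (rule sum_abs)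
      also have "\<dots> \<le> (\<Sum>l<m. 1)"
        using sign_matrix_range[OF \<open>g \<in> set_pmf ?P\<close>] x by (intro sum_mono) (simp add: abs_mult)
      finally show ?thesis by simp
    qed
    ultimately have "(\<Sum>i<d. \<bar>q k i * (\<Sum>l<m. g l i * x l)\<bar>) \<le> (\<Sum>i<d. 1 * real m)"
      unfolding abs_mult by (intro sum_mono mult_mono) auto
    then have *: "\<bar>\<Sum>i<d. q k i * (\<Sum>l<m. g l i * x l)\<bar> \<le> real J"
      by (intro order_trans[OF sum_abs]) (simp add: J_def mult.commute)
    have "\<bar>b g k\<bar> = \<bar>\<Sum>i<d. q k i * (\<Sum>l<m. g l i * x l)\<bar> / sqrt (real m)" by (simp add: b_def)
    also have "\<dots> \<le> real J / 1" using * m by (intro frac_le) auto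
    finally show ?thesis by simp
  qed
  have point: "exp ((\<Sum>k<r. (b g k)\<^sup>2) / 4) \<le> exp (1 / 4) ^ r * (\<Sum>z\<in>?Z. ?e z g)" if "g \<in> set_pmf ?P" for g
  proof -
    have "exp ((\<Sum>k<r. (b g k)\<^sup>2) / 4) = (\<Prod>k<r. exp ((b g k)\<^sup>2 / 4))" by (simp add: exp_sum sum_divide_distrib)
    also have "\<dots> \<le> (\<Prod>k<r. exp (1 / 4) * (\<Sum>j\<in>{- int J..int J}. exp (- (real_of_int j)\<^sup>2 + real_of_int j * b g k)))"
      using b[OF that] by (intro prod_mono conjI exp_square_le_lattice_sum) auto
    also have "\<dots> = exp (1 / 4) ^ r * (\<Prod>k<r. \<Sum>j\<in>{- int J..int J}. exp (- (real_of_int j)\<^sup>2 + real_of_int j * b g k))"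
      by (simp add: prod.distrib)
    also have "(\<Prod>k<r. \<Sum>j\<in>{- int J..int J}. exp (- (real_of_int j)\<^sup>2 + real_of_int j * b g k)) =
       (\<Sum>z\<in>?Z. \<Prod>k<r. exp (- (real_of_int (z k))\<^sup>2 + real_of_int (z k) * b g k))"
      by (rule prod_sum_PiE) auto
    also have "\<dots> = (\<Sum>z\<in>?Z. ?e z g)" by (simp add: exp_sum)
    finally show ?thesis .
  qed
  have single: "measure_pmf.expectation ?P (?e z) \<le> (\<Prod>k<r. exp (- (real_of_int (z k))\<^sup>2 / 2))" for z
  proof -
    let ?n = "\<Sum>k<r. (real_of_int (z k))\<^sup>2"
    \<comment> \<open>The linear form has the same coefficient vector \<open>w\<close> in each
      column, up to sign. Its squared length is at most \<open>|z|^2 / m\<close>, and the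
      \<open>m\<close> columns restore the factor \<open>m\<close>.\<close>
    define w where "w i = (\<Sum>k<r. real_of_int (z k) / sqrt (real m) * q k i)" for i
    have "(\<Sum>k<r. real_of_int (z k) * b g k) = (\<Sum>l<m. \<Sum>i<d. g l i * (x l * w i))" for g
    proof -
      have "(\<Sum>k<r. real_of_int (z k) * b g k) = (\<Sum>k<r. \<Sum>i<d. \<Sum>l<m. real_of_int (z k) / sqrt (real m) * q k i * (g l i * x l))"
        by (simp add: b_def sum_distrib_left sum_divide_distrib mult_ac)
      also have "\<dots> = (\<Sum>i<d. \<Sum>k<r. \<Sum>l<m. real_of_int (z k) / sqrt (real m) * q k i * (g l i * x l))"
        by (rule sum.swap)
      also have "\<dots> = (\<Sum>i<d. \<Sum>l<m. \<Sum>k<r. real_of_int (z k) / sqrt (real m) * q k i * (g l i * x l))"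
        by (intro sum.cong refl sum.swap)
      also have "\<dots> = (\<Sum>i<d. \<Sum>l<m. g l i * (x l * w i))"
        by (simp only: w_def sum_distrib_left sum_distrib_right mult_ac)
      also have "\<dots> = (\<Sum>l<m. \<Sum>i<d. g l i * (x l * w i))" by (rule sum.swap)
      finally show ?thesis .
    qed
    then have e: "?e z g = exp (- ?n) * exp (\<Sum>l<m. \<Sum>i<d. g l i * (x l * w i))" for g
      by (simp only: sum.distrib sum_negf exp_add)
    have "measure_pmf.expectation ?P (?e z) = exp (- ?n) * measure_pmf.expectation ?P (\<lambda>g. exp (\<Sum>l<m. \<Sum>i<d. g l i * (x l * w i)))"
      unfolding e by simp
    also have "\<dots> \<le> exp (- ?n) * exp (real m * (\<Sum>i<d. (w i)\<^sup>2) / 2)"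
      using x by (intro mult_left_mono sign_matrix_mgf) auto
    also have "(\<Sum>i<d. (w i)\<^sup>2) = (\<Sum>k<r. (real_of_int (z k) / sqrt (real m))\<^sup>2 * (\<Sum>i<d. (q k i)\<^sup>2))"
      unfolding w_def by (intro sum_square_orthogonal orth)
    also have "exp (real m * \<dots> / 2) \<le> exp (?n / 2)"
    proof -
      have "real m * (\<Sum>k<r. (real_of_int (z k) / sqrt (real m))\<^sup>2 * (\<Sum>i<d. (q k i)\<^sup>2)) =
         (\<Sum>k<r. (real_of_int (z k))\<^sup>2 * (\<Sum>i<d. (q k i)\<^sup>2))"
        using m by (simp add: sum_distrib_left power_divide)
      also have "\<dots> \<le> (\<Sum>k<r. (real_of_int (z k))\<^sup>2 * 1)" using unit by (intro sum_mono mult_left_mono) auto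
      finally show ?thesis by simp
    qed
    also have "exp (- ?n) * exp (?n / 2) = exp (- (?n / 2))" by (simp add: exp_add[symmetric])
    also have "\<dots> = (\<Prod>k<r. exp (- (real_of_int (z k))\<^sup>2 / 2))"
      by (simp add: exp_sum[symmetric] sum_negf sum_divide_distrib)
    finally show ?thesis by simp
  qed
  have "measure_pmf.expectation ?P (\<lambda>g. exp ((\<Sum>k<r. (b g k)\<^sup>2) / 4)) \<le>
     measure_pmf.expectation ?P (\<lambda>g. exp (1 / 4) ^ r * (\<Sum>z\<in>?Z. ?e z g))"
    by (intro integral_mono_AE int AE_pmfI point)
  also have "\<dots> = exp (1 / 4) ^ r * (\<Sum>z\<in>?Z. measure_pmf.expectation ?P (?e z))"
    by (simp add: int)
  also have "\<dots> \<le> exp (1 / 4) ^ r * (\<Sum>z\<in>?Z. \<Prod>k<r. exp (- (real_of_int (z k))\<^sup>2 / 2))"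
    by (intro mult_left_mono sum_mono single) auto
  also have "(\<Sum>z\<in>?Z. \<Prod>k<r. exp (- (real_of_int (z k))\<^sup>2 / 2)) = (\<Prod>k<r. \<Sum>j\<in>{- int J..int J}. exp (- (real_of_int j)\<^sup>2 / 2))"
    by (rule prod_sum_PiE[symmetric]) auto
  also have "\<dots> \<le> (\<Prod>k<r. 5)" by (intro prod_mono conjI sum_gaussian_le sum_nonneg) auto
  also have "exp (1 / 4) ^ r * (\<Prod>k<r. 5) = (exp (1 / 4) * 5 :: real) ^ r" by (simp add: power_mult_distrib)
  also have "\<dots> \<le> 7 ^ r"
    using exp_ge_add_one_self[of "- (1 / 4) :: real"] by (intro power_mono) (auto simp: exp_minus field_simps)
  also have "\<dots> \<le> 7 ^ m" using m by (intro power_increasing) auto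
  finally have E: "measure_pmf.expectation ?P (\<lambda>g. exp ((\<Sum>k<r. (b g k)\<^sup>2) / 4)) \<le> 7 ^ m"
    by (simp add: mult_left_mono)
  have sq: "(\<Sum>k<r. (\<Sum>i<d. q k i * (\<Sum>l<m. g l i * x l))\<^sup>2) = real m * (\<Sum>k<r. (b g k)\<^sup>2)" for g
    using m by (simp add: b_def power_divide sum_distrib_left)
  \<comment> \<open>In terms of \<open>b\<close> the event says that the sum of squares exceeds
    \<open>36 * m\<close>, hence a quarter of it exceeds \<open>9 * m\<close>.\<close>
  have "measure_pmf.prob ?P {g. (\<Sum>k<r. (\<Sum>i<d. q k i * (\<Sum>l<m. g l i * x l))\<^sup>2) > 36 * (real m)\<^sup>2} \<le>
     measure_pmf.prob ?P {g \<in> space ?P. exp ((\<Sum>k<r. (b g k)\<^sup>2) / 4) \<ge> exp (9 * real m)}"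
    unfolding sq using m by (intro measure_pmf.finite_measure_mono) (auto simp: power2_eq_square)
  also have "\<dots> \<le> measure_pmf.expectation ?P (\<lambda>g. exp ((\<Sum>k<r. (b g k)\<^sup>2) / 4)) / exp (9 * real m)"
    by (rule integral_Markov_inequality_measure[where A="{}"]) (auto intro: int)
  also have "\<dots> \<le> 7 ^ m / exp (9 * real m)" using E by (intro divide_right_mono) auto
  also have "\<dots> = (7 / exp 9) ^ m"
    by (simp add: power_divide exp_of_nat_mult[symmetric] mult.commute)
  also have "\<dots> \<le> (1 / 80) ^ m"
  proof (intro power_mono)
    have "(5 / 2 :: real) \<le> exp 1" using exp_lower_Taylor_quadratic[of "1::real"] by simp
    then have "(5 / 2 :: real) ^ 9 \<le> exp 1 ^ 9" by (intro power_mono) auto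
    also have "exp 1 ^ 9 = exp (9 :: real)" by (simp add: exp_of_nat_mult[symmetric])
    finally have "560 \<le> exp (9 :: real)" by (simp add: power_divide)
    then show "7 / exp 9 \<le> (1 / 80 :: real)" by (simp add: field_simps)
  qed auto
  finally show ?thesis .
qed

definition sign_patterns :: "nat \<Rightarrow> (nat \<Rightarrow> real) set" where
  "sign_patterns m = PiE {..<m} (\<lambda>_. {- 1, 1})"

lemma finite_sign_patterns: "finite (sign_patterns m)"
  and card_sign_patterns: "card (sign_patterns m) = 2 ^ m"
  by (simp_all add: sign_patterns_def card_PiE finite_PiE numeral_2_eq_2)

lemma sign_matrix_upper_all:
  fixes q :: "nat \<Rightarrow> nat \<Rightarrow> real"
  assumes orth: "\<And>a b. a < r \<Longrightarrow> b < r \<Longrightarrow> a \<noteq> b \<Longrightarrow> (\<Sum>i<d. q a i * q b i) = 0"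
    and unit: "\<And>a. a < r \<Longrightarrow> (\<Sum>i<d. (q a i)\<^sup>2) \<le> 1"
    and m: "r \<le> m" "m > 0"
  shows "measure_pmf.prob (sign_matrix m d)
     {g. \<exists>x\<in>sign_patterns m. (\<Sum>k<r. (\<Sum>i<d. q k i * (\<Sum>l<m. g l i * x l))\<^sup>2) > 36 * (real m)\<^sup>2} \<le> 1 / 40"
proof -
  let ?P = "sign_matrix m d"
  let ?B = "\<lambda>x. {g. (\<Sum>k<r. (\<Sum>i<d. q k i * (\<Sum>l<m. g l i * x l))\<^sup>2) > 36 * (real m)\<^sup>2}"
  have "measure_pmf.prob ?P {g. \<exists>x\<in>sign_patterns m. (\<Sum>k<r. (\<Sum>i<d. q k i * (\<Sum>l<m. g l i * x l))\<^sup>2) > 36 * (real m)\<^sup>2}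
     = measure_pmf.prob ?P (\<Union>x\<in>sign_patterns m. ?B x)" by (intro arg_cong2[where f=measure]) auto
  also have "\<dots> \<le> (\<Sum>x\<in>sign_patterns m. measure_pmf.prob ?P (?B x))"
    by (intro measure_pmf.finite_measure_subadditive_finite finite_sign_patterns) auto
  also have "\<dots> \<le> (\<Sum>x\<in>sign_patterns m. (1 / 80) ^ m)"
  proof (intro sum_mono sign_matrix_upper orth unit m)
    fix x l assume "x \<in> sign_patterns m" "l < m"
    then have "x l \<in> {- 1, 1}" by (auto simp: sign_patterns_def PiE_def Pi_def)
    then show "\<bar>x l\<bar> = 1" by auto
  qed
  also have "\<dots> = (2 * (1 / 80)) ^ m" by (simp add: card_sign_patterns power_mult_distrib[symmetric])
  also have "\<dots> \<le> (1 / 40) ^ 1"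
    using m by (simp only: mult_2) (simp add: power_decreasing[of 1 m "1 / 40 :: real", simplified])
  finally show ?thesis by simp
qed

section \<open>The operator norm and rank factorizations\<close>

definition pnorm :: "real \<Rightarrow> nat \<Rightarrow> (nat \<Rightarrow> real) \<Rightarrow> real" where
  "pnorm p n z = (\<Sum>i<n. \<bar>z i\<bar> powr p) powr (1 / p)"

lemma pnorm_nonneg: "pnorm p n z \<ge> 0"
  by (simp add: pnorm_def)

lemma pnorm_powr: "p > 0 \<Longrightarrow> pnorm p n z powr p = (\<Sum>i<n. \<bar>z i\<bar> powr p)"
  by (simp add: pnorm_def powr_powr sum_nonneg)

lemma pnorm_eq_0:
  assumes "p > 0" "pnorm p n z = 0" "i < n" shows "z i = 0"
proof -
  have "(\<Sum>i<n. \<bar>z i\<bar> powr p) = 0" using pnorm_powr[OF assms(1), of n z] assms by simp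
  then have "\<bar>z i\<bar> powr p = 0" using assms(3) by (subst (asm) sum_nonneg_eq_0_iff) auto
  then show ?thesis by simp
qed

lemma pnorm_scale:
  assumes "p > 0" "c > 0"
  shows "(\<Sum>i<n. \<bar>z i / c\<bar> powr p) = (pnorm p n z / c) powr p"
  using assms by (simp add: powr_divide pnorm_nonneg pnorm_powr sum_divide_distrib)

lemma pnorm_vec: "lp_norm p (Matrix.vec n z) = pnorm p n z"
  by (simp add: lp_norm_def pnorm_def)

lemma pnorm_2: "pnorm 2 n z = sqrt (\<Sum>i<n. (z i)\<^sup>2)"
  by (simp add: pnorm_def powr_half_sqrt sum_nonneg)

text \<open>Equality case of Hoelder's inequality: \<open>\<phi>\<close> is the gradient of the norm
  at \<open>w\<close>. The bound for other vectors is Young's inequality, termwise after normalising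
  both sides.\<close>

lemma pnorm_norming_functional:
  assumes "p > 1" "pnorm p n w > 0"
  obtains \<phi> where "(\<Sum>i<n. \<phi> i * w i) = pnorm p n w" "\<And>z. (\<Sum>i<n. \<phi> i * z i) \<le> pnorm p n z"
proof -
  define W where "W = pnorm p n w"
  have W: "W > 0" using assms by (simp add: W_def)
  define \<phi> where "\<phi> i = sgn (w i) * (\<bar>w i\<bar> / W) powr (p - 1)" for i
  have eq: "\<phi> i * w i = W * (\<bar>w i\<bar> / W) powr p" for i
  proof -
    have "\<phi> i * w i = W * ((\<bar>w i\<bar> / W) powr (p - 1) * (\<bar>w i\<bar> / W))"
      using W by (simp add: \<phi>_def abs_sgn mult_ac)
    also have "(\<bar>w i\<bar> / W) powr (p - 1) * (\<bar>w i\<bar> / W) = (\<bar>w i\<bar> / W) powr p"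
      using W by (cases "w i = 0") (simp_all add: powr_diff)
    finally show ?thesis .
  qed
  have one: "(\<Sum>i<n. (\<bar>w i\<bar> / W) powr p) = 1"
    using pnorm_scale[where c=W and z=w and p=p and n=n] W assms by (simp add: W_def)
  show ?thesis
  proof (rule that[of \<phi>])
    show "(\<Sum>i<n. \<phi> i * w i) = pnorm p n w"
      unfolding eq sum_distrib_left[symmetric] one by (simp add: W_def)
    fix z
    define Z where "Z = pnorm p n z"
    show "(\<Sum>i<n. \<phi> i * z i) \<le> pnorm p n z"
    proof (cases "Z = 0")
      case True
      then have "(\<Sum>i<n. \<phi> i * z i) = (\<Sum>i<n. 0)"
        using assms pnorm_eq_0[of p n z] by (intro sum.cong) (auto simp: Z_def)
      then show ?thesis by (simp add: pnorm_nonneg)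
    next
      case False
      then have Z: "Z > 0" using pnorm_nonneg[of p n z] by (simp add: Z_def)
      define q where "q = p / (p - 1)"
      have q: "q > 1" "1 / p + 1 / q = 1" "(p - 1) * q = p" using assms by (auto simp: q_def field_simps)
      have "\<phi> i * z i \<le> Z * (\<bar>z i / Z\<bar> powr p / p + (\<bar>w i\<bar> / W) powr p / q)" for i
      proof -
        have "\<phi> i * z i \<le> \<bar>\<phi> i * z i\<bar>" by (rule abs_ge_self)
        also have "\<dots> = \<bar>\<phi> i\<bar> * \<bar>z i\<bar>" by (rule abs_mult)
        also have "\<dots> \<le> (\<bar>w i\<bar> / W) powr (p - 1) * \<bar>z i\<bar>"
          by (intro mult_right_mono) (auto simp: \<phi>_def abs_mult abs_sgn_eq)
        also have "\<dots> = Z * (\<bar>z i / Z\<bar> * (\<bar>w i\<bar> / W) powr (p - 1))" using Z by (simp add: mult_ac)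
        also have "\<dots> \<le> Z * (\<bar>z i / Z\<bar> powr p / p + ((\<bar>w i\<bar> / W) powr (p - 1)) powr q / q)"
          using Z assms q by (intro mult_left_mono Youngs_inequality) auto
        finally show ?thesis by (simp add: powr_powr q)
      qed
      then have "(\<Sum>i<n. \<phi> i * z i) \<le> (\<Sum>i<n. Z * (\<bar>z i / Z\<bar> powr p / p + (\<bar>w i\<bar> / W) powr p / q))"
        by (intro sum_mono)
      also have "\<dots> = Z * ((\<Sum>i<n. \<bar>z i / Z\<bar> powr p) / p + (\<Sum>i<n. (\<bar>w i\<bar> / W) powr p) / q)"
        by (simp only: sum_distrib_left[symmetric] sum.distrib sum_divide_distrib)
      also have "(\<Sum>i<n. \<bar>z i / Z\<bar> powr p) = 1"
        using pnorm_scale[where c=Z and z=z and p=p and n=n] Z assms by (simp add: Z_def)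
      finally show ?thesis using one q by (simp add: Z_def)
    qed
  qed
qed

context
  fixes A :: "real Matrix.mat" and n d :: nat and p :: real
  assumes A: "A \<in> carrier_mat n d" and p: "p > 1"
begin

lemma mult_mat_vec_pnorm:
  "lp_norm p (A *\<^sub>v Matrix.vec d u) = pnorm p n (\<lambda>i. \<Sum>j<d. A $$ (i, j) * u j)"
proof -
  have "A *\<^sub>v Matrix.vec d u = Matrix.vec n (\<lambda>i. \<Sum>j<d. A $$ (i, j) * u j)"
    using A by (intro eq_vecI) (auto simp: scalar_prod_def atLeast0LessThan)
  then show ?thesis by (simp add: pnorm_vec)
qed

text \<open>Without boundedness the real \<open>SUP\<close> would carry no information. Each
  coordinate of a vector is at most its 2-norm, so the \<open>p\<close>-norm of the vector of
  absolute row sums is an upper bound.\<close>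

lemma op_norm_bdd:
  "bdd_above ((\<lambda>x. lp_norm p (A *\<^sub>v x) / lp_norm 2 x) ` (carrier_vec (dim_col A) - {0\<^sub>v (dim_col A)}))"
proof (rule bdd_aboveI2)
  let ?R = "pnorm p n (\<lambda>i. \<Sum>j<d. \<bar>A $$ (i, j)\<bar>)"
  fix x :: "real Matrix.vec" assume x: "x \<in> carrier_vec (dim_col A) - {0\<^sub>v (dim_col A)}"
  define u where "u j = vec_index x j" for j
  have xu: "x = Matrix.vec d u" using x A by (auto simp: u_def)
  let ?N = "pnorm 2 d u"
  have le: "\<bar>u j\<bar> \<le> ?N" if "j < d" for j
    unfolding pnorm_2 using that by (intro real_le_rsqrt) (auto intro!: member_le_sum)
  have "pnorm p n (\<lambda>i. \<Sum>j<d. A $$ (i, j) * u j) \<le> (\<Sum>i<n. (?N * \<bar>\<Sum>j<d. \<bar>A $$ (i, j)\<bar>\<bar>) powr p) powr (1 / p)"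
    unfolding pnorm_def[of p]
  proof (intro powr_mono2 sum_mono sum_nonneg)
    fix i
    have "\<bar>\<Sum>j<d. A $$ (i, j) * u j\<bar> \<le> (\<Sum>j<d. \<bar>A $$ (i, j) * u j\<bar>)" by (rule sum_abs)
    also have "\<dots> \<le> (\<Sum>j<d. ?N * \<bar>A $$ (i, j)\<bar>)"
    proof (rule sum_mono)
      fix j assume "j \<in> {..<d}"
      then have "\<bar>u j\<bar> * \<bar>A $$ (i, j)\<bar> \<le> ?N * \<bar>A $$ (i, j)\<bar>" by (intro mult_right_mono le) auto
      then show "\<bar>A $$ (i, j) * u j\<bar> \<le> ?N * \<bar>A $$ (i, j)\<bar>" by (simp only: abs_mult mult.commute)
    qed
    also have "\<dots> = ?N * (\<Sum>j<d. \<bar>A $$ (i, j)\<bar>)" by (simp add: sum_distrib_left)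
    finally show "\<bar>\<Sum>j<d. A $$ (i, j) * u j\<bar> \<le> ?N * \<bar>\<Sum>j<d. \<bar>A $$ (i, j)\<bar>\<bar>" by (simp add: sum_nonneg)
  qed (use p in auto)
  also have "\<dots> = ?N * ?R"
    using p by (simp add: powr_mult pnorm_nonneg sum_distrib_left[symmetric] pnorm_def[of p] powr_powr)
  finally show "lp_norm p (A *\<^sub>v x) / lp_norm 2 x \<le> ?R"
    unfolding xu mult_mat_vec_pnorm pnorm_vec
    using pnorm_nonneg[of 2 d u] pnorm_nonneg[of p n "\<lambda>i. \<Sum>j<d. \<bar>A $$ (i, j)\<bar>"]
    by (cases "?N = 0") (auto simp: field_simps)
qed

lemma pnorm_mult_le_op_norm:
  "pnorm p n (\<lambda>i. \<Sum>j<d. A $$ (i, j) * u j) \<le> op_norm 2 p A * sqrt (\<Sum>j<d. (u j)\<^sup>2)"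
proof (cases "\<forall>j<d. u j = 0")
  case True
  then have "pnorm p n (\<lambda>i. \<Sum>j<d. A $$ (i, j) * u j) = 0" by (simp add: pnorm_def)
  with True show ?thesis by simp
next
  case False
  then obtain k where k: "k < d" "u k \<noteq> 0" by auto
  have "0 < (u k)\<^sup>2" using k by simp
  also have "(u k)\<^sup>2 \<le> (\<Sum>j<d. (u j)\<^sup>2)" using k by (intro member_le_sum) auto
  finally have "(\<Sum>j<d. (u j)\<^sup>2) > 0" .
  then have pos: "sqrt (\<Sum>j<d. (u j)\<^sup>2) > 0" by simp
  have "Matrix.vec d u \<noteq> 0\<^sub>v d" using k by (metis index_vec index_zero_vec(1))
  then have "lp_norm p (A *\<^sub>v Matrix.vec d u) / lp_norm 2 (Matrix.vec d u) \<le> op_norm 2 p A"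
    unfolding op_norm_def using A by (intro cSUP_upper op_norm_bdd) auto
  then show ?thesis unfolding mult_mat_vec_pnorm pnorm_vec pnorm_2 using pos by (simp add: field_simps)
qed

lemma op_norm_pos:
  assumes "i < n" "j < d" "A $$ (i, j) \<noteq> 0"
  shows "op_norm 2 p A > 0"
proof -
  let ?u = "\<lambda>j'. if j' = j then 1 else 0 :: real"
  have "(\<Sum>j'<d. A $$ (i', j') * ?u j') = A $$ (i', j)" for i' using assms by (simp add: if_distrib sum.delta cong: if_cong)
  moreover have "(\<Sum>j'<d. (?u j')\<^sup>2) = 1"
  proof -
    have "(?u j')\<^sup>2 = ?u j'" for j' by simp
    then have "(\<Sum>j'<d. (?u j')\<^sup>2) = (\<Sum>j'<d. ?u j')" by (simp only:)
    then show ?thesis using assms by (simp add: sum.delta)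
  qed
  ultimately have le: "pnorm p n (\<lambda>i'. A $$ (i', j)) \<le> op_norm 2 p A"
    using pnorm_mult_le_op_norm[of ?u] by (simp only: real_sqrt_one mult_1_right)
  have "pnorm p n (\<lambda>i'. A $$ (i', j)) \<noteq> 0" using pnorm_eq_0[of p n "\<lambda>i'. A $$ (i', j)" i] p assms by auto
  with le show ?thesis using pnorm_nonneg[of p n "\<lambda>i'. A $$ (i', j)"] by linarith
qed

text \<open>Settling for half of the supremum avoids a compactness argument; \<open>d > 0\<close>
  makes the set of quotients nonempty.\<close>

lemma op_norm_near_maximiser:
  assumes "op_norm 2 p A > 0" "d > 0"
  obtains u where "(\<Sum>j<d. (u j)\<^sup>2) = 1" "pnorm p n (\<lambda>i. \<Sum>j<d. A $$ (i, j) * u j) \<ge> op_norm 2 p A / 2"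
proof -
  let ?X = "carrier_vec (dim_col A) - {0\<^sub>v (dim_col A)} :: real Matrix.vec set"
  have "unit_vec d 0 \<in> ?X" using assms(2) A by (auto dest: arg_cong[where f="\<lambda>v. vec_index v 0"])
  then have ne: "?X \<noteq> {}" by blast
  have "op_norm 2 p A / 2 < (SUP x\<in>?X. lp_norm p (A *\<^sub>v x) / lp_norm 2 x)"
    using assms unfolding op_norm_def by simp
  then obtain x where x: "x \<in> ?X" "op_norm 2 p A / 2 < lp_norm p (A *\<^sub>v x) / lp_norm 2 x"
    using less_cSUP_iff[OF ne op_norm_bdd] by blast
  define v where "v j = vec_index x j" for j
  have xv: "x = Matrix.vec d v" using x A by (auto simp: v_def)
  define N where "N = pnorm 2 d v"
  have N: "N > 0"
  proof -
    have "N \<noteq> 0" using x(2) assms(1) unfolding xv mult_mat_vec_pnorm pnorm_vec N_def[symmetric] by auto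
    then show ?thesis using pnorm_nonneg[of 2 d v] by (simp add: N_def)
  qed
  show ?thesis
  proof (rule that[of "\<lambda>j. v j / N"])
    have "(\<Sum>j<d. (v j)\<^sup>2) = N\<^sup>2" by (simp add: N_def pnorm_2 sum_nonneg)
    then show "(\<Sum>j<d. (v j / N)\<^sup>2) = 1" using N by (simp add: power_divide sum_divide_distrib[symmetric])
    have "(\<Sum>j<d. A $$ (i, j) * (v j / N)) = (\<Sum>j<d. A $$ (i, j) * v j) / N" for i
      by (simp add: sum_divide_distrib)
    then have "pnorm p n (\<lambda>i. \<Sum>j<d. A $$ (i, j) * (v j / N)) = ((pnorm p n (\<lambda>i. \<Sum>j<d. A $$ (i, j) * v j) / N) powr p) powr (1 / p)"
      using pnorm_scale[where c=N and p=p and n=n and z="\<lambda>i. \<Sum>j<d. A $$ (i, j) * v j"] N p by (simp add: pnorm_def)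
    also have "\<dots> = pnorm p n (\<lambda>i. \<Sum>j<d. A $$ (i, j) * v j) / N"
      using N p pnorm_nonneg[of p n] by (simp add: powr_powr)
    finally show "pnorm p n (\<lambda>i. \<Sum>j<d. A $$ (i, j) * (v j / N)) \<ge> op_norm 2 p A / 2"
      using x(2) unfolding xv mult_mat_vec_pnorm pnorm_vec N_def[symmetric] by simp
  qed
qed

end

section \<open>Orthonormal vectors spanning the row space\<close>

text \<open>The vectors \<open>c l\<close> may be dependent: one that lies in the span of its
  predecessors gets the zero vector, which is why squared lengths are 0 or 1. The number of vectors
  stays \<open>r\<close> and no basis has to be selected.\<close>

lemma gram_schmidt_functions:
  fixes c :: "nat \<Rightarrow> nat \<Rightarrow> real"
  shows "\<exists>q e. (\<forall>a<r. \<forall>b<r. a \<noteq> b \<longrightarrow> (\<Sum>i<d. q a i * q b i) = 0) \<and>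
    (\<forall>a<r. (\<Sum>i<d. q a i * q a i) \<in> {0, 1}) \<and> (\<forall>l<r. \<forall>i<d. c l i = (\<Sum>k<r. e l k * q k i))"
proof (induction r)
  case (Suc r)
  from Suc.IH obtain q e where qe: "(\<forall>a<r. \<forall>b<r. a \<noteq> b \<longrightarrow> (\<Sum>i<d. q a i * q b i) = 0) \<and>
    (\<forall>a<r. (\<Sum>i<d. q a i * q a i) \<in> {0, 1}) \<and> (\<forall>l<r. \<forall>i<d. c l i = (\<Sum>k<r. e l k * q k i))"
    by (elim exE)
  have orth: "(\<Sum>i<d. q a i * q b i) = 0" if "a < r" "b < r" "a \<noteq> b" for a b
    using qe that by simp
  have unit: "(\<Sum>i<d. q a i * q a i) \<in> {0, 1}" if "a < r" for a
    using qe that by simp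
  have ex: "c l i = (\<Sum>k<r. e l k * q k i)" if "l < r" "i < d" for l i
    using qe that by blast
  define f where "f k = (\<Sum>i<d. q k i * c r i)" for k
  define t where "t i = c r i - (\<Sum>k<r. f k * q k i)" for i
  define N where "N = (\<Sum>i<d. t i * t i)"
  have N0: "N \<ge> 0" by (simp add: N_def sum_nonneg)
  have qt: "(\<Sum>i<d. q a i * t i) = 0" if a: "a < r" for a
  proof -
    have "(\<Sum>i<d. q a i * t i) = f a - (\<Sum>i<d. \<Sum>k<r. f k * (q a i * q k i))"
      by (simp add: t_def f_def right_diff_distrib sum_subtractf sum_distrib_left mult_ac)
    also have "(\<Sum>i<d. \<Sum>k<r. f k * (q a i * q k i)) = (\<Sum>k<r. f k * (\<Sum>i<d. q a i * q k i))"
      by (subst sum.swap) (simp add: sum_distrib_left)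
    also have "\<dots> = (\<Sum>k<r. if k = a then f a * (\<Sum>i<d. q a i * q a i) else 0)"
      using orth a by (intro sum.cong refl) auto
    also have "\<dots> = f a * (\<Sum>i<d. q a i * q a i)" using a by (simp add: sum.delta)
    \<comment> \<open>A zero vector \<open>q a\<close> does no harm, since then \<open>f a\<close>
      vanishes too.\<close>
    also have "\<dots> = f a"
    proof (cases "(\<Sum>i<d. q a i * q a i) = 0")
      case True
      then have "q a i = 0" if "i < d" for i using that by (subst (asm) sum_nonneg_eq_0_iff) auto
      then show ?thesis by (simp add: f_def)
    next
      case False
      with unit[OF a] show ?thesis by simp
    qed
    finally show ?thesis by simp
  qed
  \<comment> \<open>For \<open>N = 0\<close> the new vector is zero by the convention on
    division.\<close>
  define q' where "q' = q(r := \<lambda>i. t i / sqrt N)"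
  define e' where "e' l k = (if l < r then (if k < r then e l k else 0) else if k < r then f k else sqrt N)" for l k
  have q'r: "q' r i = t i / sqrt N" and q'a: "a < r \<Longrightarrow> q' a i = q a i" for a i
    by (auto simp: q'_def)
  have new: "(\<Sum>i<d. q a i * (t i / sqrt N)) = 0" if "a < r" for a
    using qt[OF that] by (simp add: sum_divide_distrib[symmetric])
  have "(\<Sum>i<d. q' a i * q' b i) = 0" if ab: "a < Suc r" "b < Suc r" "a \<noteq> b" for a b
  proof -
    consider "a < r" "b < r" | "a = r" "b < r" | "a < r" "b = r"
      using ab by (auto simp: less_Suc_eq)
    then show ?thesis
    proof cases
      case 1 then show ?thesis using orth ab by (simp add: q'a)
    next
      case 2 then show ?thesis using new[of b] by (simp add: q'a q'r mult.commute)
    next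
      case 3 then show ?thesis using new[of a] by (simp add: q'a q'r)
    qed
  qed
  moreover have "(\<Sum>i<d. q' a i * q' a i) \<in> {0, 1}" if "a < Suc r" for a
  proof (cases "a = r")
    case True
    have "(\<Sum>i<d. q' r i * q' r i) = (\<Sum>i<d. t i * t i) / N"
      using N0 by (simp add: q'r sum_divide_distrib)
    also have "\<dots> = N / N" by (simp only: N_def)
    finally have "(\<Sum>i<d. q' r i * q' r i) = N / N" .
    with True show ?thesis by (cases "N = 0") auto
  next
    case False
    then show ?thesis using unit[of a] that by (simp add: q'a)
  qed
  moreover have "c l i = (\<Sum>k<Suc r. e' l k * q' k i)" if "l < Suc r" "i < d" for l i
  proof (cases "l = r")
    case True
    have "sqrt N * (t i / sqrt N) = t i"
    proof (cases "N = 0")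
      case True
      then have "t i * t i = 0" using \<open>i < d\<close> unfolding N_def by (subst (asm) sum_nonneg_eq_0_iff) auto
      then show ?thesis by simp
    qed simp
    then show ?thesis using True by (simp add: e'_def q'r q'a t_def)
  next
    case False
    then show ?thesis using ex[of l i] that by (simp add: e'_def q'a)
  qed
  ultimately show ?case by (intro exI[of _ q'] exI[of _ e'] conjI allI impI)
qed simp

text \<open>The columns of \<open>b\<close> form a maximal independent set of columns of
  \<open>A\<close>, and \<open>c\<close> holds the coefficients of all columns in them. Its use is
  that every row of \<open>A\<close> is a combination of the \<open>r\<close> rows of
  \<open>c\<close>.\<close>

lemma rank_factorization:
  fixes A :: "real Matrix.mat"
  assumes A: "A \<in> carrier_mat n d" and r: "vec_space.rank n A = r"
  shows "\<exists>b c. \<forall>i<n. \<forall>j<d. A $$ (i, j) = (\<Sum>k<r. b i k * (c k j :: real))"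
proof -
  interpret vec_space "TYPE(real)" n .
  let ?S = "set (cols A)"
  have S: "?S \<subseteq> carrier_vec n" using cols_dim A by blast
  obtain U where U: "maximal U (\<lambda>T. T \<subseteq> ?S \<and> lin_indpt T)" "finite U"
    using maximal_exists_superset[of ?S "\<lambda>T. T \<subseteq> ?S \<and> lin_indpt T" "{}"]
    by (auto simp: lin_dep_def)
  have US: "U \<subseteq> ?S" "lin_indpt U" using U(1) by (auto simp: maximal_def)
  have card: "card U = r" using rank_card_indpt[OF A U(1)] r by simp
  have UC: "U \<subseteq> carrier_vec n" using US S by blast
  have span: "v \<in> span U" if v: "v \<in> ?S" for v
  proof (rule ccontr)
    assume nv: "v \<notin> span U"
    have vC: "v \<in> carrier_vec n" using v S by blast
    have "lin_indpt (U \<union> {v})" using lin_dep_iff_in_span[of U v] UC US vC nv in_own_span[of U]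
      by (metis (no_types, lifting) carrier_vec_def module_vec_simps(3) subsetD)
    moreover have "U \<union> {v} \<subseteq> ?S" using US v by blast
    ultimately have "U = U \<union> {v}" using U(1) by (auto simp: maximal_def)
    then have "v \<in> U" by blast
    then show False using nv in_own_span[of U] UC by auto
  qed
  have "\<exists>a. \<forall>i<n. vec_index v i = (\<Sum>x\<in>U. a x * vec_index x i)" if vS: "v \<in> ?S" for v
  proof -
    obtain a where "v = lincomb a U" using finite_in_span[OF U(2) _ span[OF vS]] UC by blast
    then have "vec_index v i = (\<Sum>x\<in>U. a x * vec_index x i)" if "i < n" for i using lincomb_index[OF that UC] by simp
    then show ?thesis by blast
  qed
  then obtain a where a: "\<And>v i. v \<in> ?S \<Longrightarrow> i < n \<Longrightarrow> vec_index v i = (\<Sum>x\<in>U. a v x * vec_index x i)" by metis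
  obtain h where h: "bij_betw h {..<r} U" using ex_bij_betw_nat_finite[OF U(2)] card by (auto simp: atLeast0LessThan)
  have eq: "A $$ (i, j) = (\<Sum>k<r. vec_index (h k) i * a (col A j) (h k))" if "i < n" "j < d" for i j
  proof -
    have "col A j \<in> ?S" using that A by (auto simp: cols_def)
    then have "vec_index (col A j) i = (\<Sum>x\<in>U. a (col A j) x * vec_index x i)" using a that by blast
    also have "\<dots> = (\<Sum>k<r. a (col A j) (h k) * vec_index (h k) i)" by (rule sum.reindex_bij_betw[OF h, symmetric])
    finally show ?thesis using that A by (simp add: mult.commute)
  qed
  show ?thesis
    by (intro exI[of _ "\<lambda>i k. vec_index (h k) i"] exI[of _ "\<lambda>k j. a (col A j) (h k)"] allI impI eq)
qed

section \<open>Compression of a matrix of low rank\<close>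

text \<open>Coordinate \<open>i\<close> of the vector \<open>A G x\<close>.\<close>

definition compress :: "nat \<Rightarrow> nat \<Rightarrow> real Matrix.mat \<Rightarrow> (nat \<Rightarrow> nat \<Rightarrow> real) \<Rightarrow> (nat \<Rightarrow> real) \<Rightarrow> nat \<Rightarrow> real" where
  "compress d m A g x i = (\<Sum>j<d. A $$ (i, j) * (\<Sum>l<m. g l j * x l))"

text \<open>The factor 1/40 is 1/2 from the near-maximiser times 1/20 from
  \<open>sign_matrix_lower\<close>, applied to the direction of \<open>v\<close>.\<close>

lemma compress_lower:
  assumes A: "A \<in> carrier_mat n d" and p: "p > 1" and pos: "op_norm 2 p A > 0" and d: "d > 0" and m: "m \<ge> 40"
  shows "measure_pmf.prob (sign_matrix m d)
    {g. \<not> (\<exists>x\<in>sign_patterns m. pnorm p n (compress d m A g x) \<ge> real m * op_norm 2 p A / 40)} \<le> 1 / 40"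
proof -
  let ?\<nu> = "op_norm 2 p A"
  obtain u where u: "(\<Sum>j<d. (u j)\<^sup>2) = 1" "pnorm p n (\<lambda>i. \<Sum>j<d. A $$ (i, j) * u j) \<ge> ?\<nu> / 2"
    using op_norm_near_maximiser[OF A p pos d] by blast
  let ?w = "\<lambda>i. \<Sum>j<d. A $$ (i, j) * u j"
  have "pnorm p n ?w > 0" using u pos by linarith
  then obtain \<phi> where \<phi>: "(\<Sum>i<n. \<phi> i * ?w i) = pnorm p n ?w" "\<And>z. (\<Sum>i<n. \<phi> i * z i) \<le> pnorm p n z"
    using pnorm_norming_functional[OF p] by blast
  define v where "v j = (\<Sum>i<n. \<phi> i * A $$ (i, j))" for j
  have dual: "(\<Sum>i<n. \<phi> i * (\<Sum>j<d. A $$ (i, j) * z j)) = (\<Sum>j<d. v j * z j)" for z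
  proof -
    have "(\<Sum>i<n. \<phi> i * (\<Sum>j<d. A $$ (i, j) * z j)) = (\<Sum>i<n. \<Sum>j<d. \<phi> i * A $$ (i, j) * z j)"
      by (simp add: sum_distrib_left mult_ac)
    also have "\<dots> = (\<Sum>j<d. \<Sum>i<n. \<phi> i * A $$ (i, j) * z j)" by (rule sum.swap)
    finally show ?thesis by (simp add: v_def sum_distrib_right)
  qed
  define V where "V = sqrt (\<Sum>j<d. (v j)\<^sup>2)"
  \<comment> \<open>Cauchy-Schwarz against the unit vector \<open>u\<close>: the inner product of
    \<open>v\<close> and \<open>u\<close> is the value of \<open>\<phi>\<close> at
    \<open>A u\<close>.\<close>
  have V: "V \<ge> ?\<nu> / 2"
  proof -
    have "?\<nu> / 2 \<le> (\<Sum>j<d. v j * u j)" using u \<phi>(1) unfolding dual by simp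
    also have "\<dots> \<le> \<bar>\<Sum>j<d. v j * u j\<bar>" by simp
    also have "\<dots> \<le> (\<Sum>j<d. \<bar>v j\<bar> * \<bar>u j\<bar>)" using sum_abs[of "\<lambda>j. v j * u j"] by (simp add: abs_mult)
    also have "\<dots> \<le> L2_set v {..<d} * L2_set u {..<d}" by (rule L2_set_mult_ineq)
    also have "\<dots> = V" using u(1) by (simp add: L2_set_def V_def)
    finally show ?thesis .
  qed
  then have V0: "V > 0" using pos by linarith
  have "(\<Sum>j<d. (v j)\<^sup>2) = V\<^sup>2" by (simp add: V_def sum_nonneg)
  then have one: "(\<Sum>j<d. (v j / V)\<^sup>2) = 1" using V0 by (simp add: power_divide sum_divide_distrib[symmetric])
  have "{g. \<not> (\<exists>x\<in>sign_patterns m. pnorm p n (compress d m A g x) \<ge> real m * ?\<nu> / 40)}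
     \<subseteq> {g. (\<Sum>l<m. \<bar>\<Sum>j<d. g l j * (v j / V)\<bar>) < real m / 20}"
  proof (intro subsetI CollectI, rule ccontr)
    fix g assume g: "g \<in> {g. \<not> (\<exists>x\<in>sign_patterns m. pnorm p n (compress d m A g x) \<ge> real m * ?\<nu> / 40)}"
      and "\<not> (\<Sum>l<m. \<bar>\<Sum>j<d. g l j * (v j / V)\<bar>) < real m / 20"
    then have ge: "real m / 20 \<le> (\<Sum>l<m. \<bar>\<Sum>j<d. g l j * (v j / V)\<bar>)" by simp
    define x where "x = (\<lambda>l\<in>{..<m}. if (\<Sum>j<d. g l j * v j) \<ge> 0 then 1 else - 1 :: real)"
    have x: "x \<in> sign_patterns m" by (auto simp: x_def sign_patterns_def)
    have "real m * ?\<nu> / 40 \<le> real m / 20 * V" using V mult_left_mono[of "?\<nu> / 2" V "real m / 20"] by simp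
    also have "\<dots> \<le> (\<Sum>l<m. \<bar>\<Sum>j<d. g l j * (v j / V)\<bar>) * V" using ge V0 by (intro mult_right_mono) auto
    also have "\<dots> = (\<Sum>l<m. \<bar>\<Sum>j<d. g l j * v j\<bar>)"
    proof -
      have "(\<Sum>j<d. g l j * (v j / V)) = (\<Sum>j<d. g l j * v j) / V" for l by (simp add: sum_divide_distrib)
      then show ?thesis using V0 by (simp add: sum_divide_distrib[symmetric])
    qed
    also have "\<dots> = (\<Sum>l<m. \<Sum>j<d. v j * (g l j * x l))"
    proof (intro sum.cong refl)
      fix l assume "l \<in> {..<m}"
      then have "\<bar>\<Sum>j<d. g l j * v j\<bar> = (\<Sum>j<d. g l j * v j) * x l" by (simp add: x_def)
      also have "\<dots> = (\<Sum>j<d. v j * (g l j * x l))"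
        unfolding sum_distrib_right by (intro sum.cong refl) (simp only: mult_ac)
      finally show "\<bar>\<Sum>j<d. g l j * v j\<bar> = (\<Sum>j<d. v j * (g l j * x l))" .
    qed
    also have "\<dots> = (\<Sum>j<d. \<Sum>l<m. v j * (g l j * x l))" by (rule sum.swap)
    also have "\<dots> = (\<Sum>j<d. v j * (\<Sum>l<m. g l j * x l))" by (simp only: sum_distrib_left)
    also have "\<dots> = (\<Sum>i<n. \<phi> i * compress d m A g x i)" unfolding dual[symmetric] by (simp only: compress_def)
    also have "\<dots> \<le> pnorm p n (compress d m A g x)" by (rule \<phi>)
    finally show False using g x by blast
  qed
  then have "measure_pmf.prob (sign_matrix m d)
     {g. \<not> (\<exists>x\<in>sign_patterns m. pnorm p n (compress d m A g x) \<ge> real m * ?\<nu> / 40)}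
     \<le> measure_pmf.prob (sign_matrix m d) {g. (\<Sum>l<m. \<bar>\<Sum>j<d. g l j * (v j / V)\<bar>) < real m / 20}"
    by (intro measure_pmf.finite_measure_mono) auto
  also have "\<dots> \<le> 1 / 40" by (rule sign_matrix_lower[OF one m])
  finally show ?thesis .
qed

text \<open>\<open>A z\<close> depends only on the component of \<open>z\<close> in the row space,
  so the operator norm is paid for the length of that component, which involves \<open>r\<close>
  directions in place of \<open>d\<close>. The 6 is the root of the 36 in
  \<open>sign_matrix_upper_all\<close>.\<close>

lemma compress_upper:
  assumes A: "A \<in> carrier_mat n d" and p: "p > 1" and rank: "vec_space.rank n A = r"
    and m: "r \<le> m" "m > 0" and nonneg: "op_norm 2 p A \<ge> 0"
  shows "measure_pmf.prob (sign_matrix m d)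
    {g. \<exists>x\<in>sign_patterns m. pnorm p n (compress d m A g x) > 6 * real m * op_norm 2 p A} \<le> 1 / 40"
proof -
  let ?\<nu> = "op_norm 2 p A"
  obtain b c where bc: "\<And>i j. i < n \<Longrightarrow> j < d \<Longrightarrow> A $$ (i, j) = (\<Sum>k<r. b i k * c k j)"
    using rank_factorization[OF A rank] by blast
  obtain q e where qe: "(\<forall>a<r. \<forall>b<r. a \<noteq> b \<longrightarrow> (\<Sum>i<d. q a i * q b i) = 0) \<and>
    (\<forall>a<r. (\<Sum>i<d. q a i * q a i) \<in> {0, 1 :: real}) \<and> (\<forall>l<r. \<forall>i<d. c l i = (\<Sum>k<r. e l k * q k i))"
    using gram_schmidt_functions[of r d c] by (elim exE)
  have orth: "(\<Sum>i<d. q a i * q b i) = 0" if "a < r" "b < r" "a \<noteq> b" for a b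
    using qe that by simp
  have unit: "(\<Sum>i<d. q a i * q a i) = 0 \<or> (\<Sum>i<d. q a i * q a i) = 1" if "a < r" for a
    using qe that by blast
  have ex: "c l i = (\<Sum>k<r. e l k * q k i)" if "l < r" "i < d" for l i
    using qe that by blast
  have le1: "(\<Sum>i<d. (q a i)\<^sup>2) \<le> 1" if "a < r" for a
    using unit[OF that] by (auto simp: power2_eq_square)
  have bound: "pnorm p n (\<lambda>i. \<Sum>j<d. A $$ (i, j) * z j) \<le> ?\<nu> * sqrt (\<Sum>k<r. (\<Sum>i<d. q k i * z i)\<^sup>2)" for z
  proof -
    define f where "f k = (\<Sum>i<d. q k i * z i)" for k
    \<comment> \<open>The component of \<open>z\<close> in the span of the \<open>q k\<close>; it
      has the same image under \<open>A\<close> as \<open>z\<close>.\<close>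
    define y where "y j = (\<Sum>k<r. f k * q k j)" for j
    have qy: "(\<Sum>j<d. q a j * y j) = f a" if a: "a < r" for a
    proof -
      have "(\<Sum>j<d. q a j * y j) = (\<Sum>j<d. \<Sum>k<r. f k * (q a j * q k j))"
        by (simp add: y_def sum_distrib_left mult_ac)
      also have "\<dots> = (\<Sum>k<r. \<Sum>j<d. f k * (q a j * q k j))" by (rule sum.swap)
      also have "\<dots> = (\<Sum>k<r. if k = a then f a * (\<Sum>j<d. q a j * q a j) else 0)"
        using orth a by (intro sum.cong refl) (auto simp: sum_distrib_left[symmetric])
      also have "\<dots> = f a * (\<Sum>j<d. q a j * q a j)" using a by (simp add: sum.delta)
      also have "\<dots> = f a"
      proof (cases "(\<Sum>i<d. q a i * q a i) = 0")
        case True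
        then have "q a i = 0" if "i < d" for i using that by (subst (asm) sum_nonneg_eq_0_iff) auto
        then show ?thesis by (simp add: f_def)
      next
        case False
        with unit[OF a] show ?thesis by simp
      qed
      finally show ?thesis .
    qed
    have c_eq: "(\<Sum>j<d. c l j * y j) = (\<Sum>j<d. c l j * z j)" if l: "l < r" for l
    proof -
      have *: "(\<Sum>j<d. c l j * x j) = (\<Sum>k<r. e l k * (\<Sum>j<d. q k j * x j))" for x
      proof -
        have "(\<Sum>j<d. c l j * x j) = (\<Sum>j<d. \<Sum>k<r. e l k * (q k j * x j))"
          using ex[OF l] by (intro sum.cong refl) (simp add: sum_distrib_right mult.assoc)
        also have "\<dots> = (\<Sum>k<r. \<Sum>j<d. e l k * (q k j * x j))" by (rule sum.swap)
        finally show ?thesis by (simp only: sum_distrib_left)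
      qed
      show ?thesis unfolding * using qy by (intro sum.cong refl) (simp add: f_def)
    qed
    have A_eq: "(\<Sum>j<d. A $$ (i, j) * z j) = (\<Sum>j<d. A $$ (i, j) * y j)" if i: "i < n" for i
    proof -
      have *: "(\<Sum>j<d. A $$ (i, j) * x j) = (\<Sum>k<r. b i k * (\<Sum>j<d. c k j * x j))" for x
      proof -
        have "(\<Sum>j<d. A $$ (i, j) * x j) = (\<Sum>j<d. \<Sum>k<r. b i k * (c k j * x j))"
          using bc[OF i] by (intro sum.cong refl) (simp add: sum_distrib_right mult.assoc)
        also have "\<dots> = (\<Sum>k<r. \<Sum>j<d. b i k * (c k j * x j))" by (rule sum.swap)
        finally show ?thesis by (simp only: sum_distrib_left)
      qed
      show ?thesis unfolding * using c_eq by (intro sum.cong refl) simp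
    qed
    have "pnorm p n (\<lambda>i. \<Sum>j<d. A $$ (i, j) * z j) = pnorm p n (\<lambda>i. \<Sum>j<d. A $$ (i, j) * y j)"
      unfolding pnorm_def using A_eq by (intro arg_cong2[where f="(powr)"] sum.cong refl) simp
    also have "\<dots> \<le> ?\<nu> * sqrt (\<Sum>j<d. (y j)\<^sup>2)" by (rule pnorm_mult_le_op_norm[OF A p])
    also have "(\<Sum>j<d. (y j)\<^sup>2) = (\<Sum>k<r. (f k)\<^sup>2 * (\<Sum>i<d. (q k i)\<^sup>2))"
      unfolding y_def by (intro sum_square_orthogonal orth)
    also have "?\<nu> * sqrt (\<Sum>k<r. (f k)\<^sup>2 * (\<Sum>i<d. (q k i)\<^sup>2)) \<le> ?\<nu> * sqrt (\<Sum>k<r. (f k)\<^sup>2)"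
    proof (intro mult_left_mono nonneg real_sqrt_le_mono sum_mono)
      fix k assume "k \<in> {..<r}"
      then show "(f k)\<^sup>2 * (\<Sum>i<d. (q k i)\<^sup>2) \<le> (f k)\<^sup>2" using mult_left_mono[OF le1[of k], of "(f k)\<^sup>2"] by simp
    qed
    finally show ?thesis by (simp only: f_def)
  qed
  have "{g. \<exists>x\<in>sign_patterns m. pnorm p n (compress d m A g x) > 6 * real m * ?\<nu>} \<subseteq>
     {g. \<exists>x\<in>sign_patterns m. (\<Sum>k<r. (\<Sum>i<d. q k i * (\<Sum>l<m. g l i * x l))\<^sup>2) > 36 * (real m)\<^sup>2}"
  proof (intro subsetI CollectI, rule ccontr)
    fix g assume "g \<in> {g. \<exists>x\<in>sign_patterns m. pnorm p n (compress d m A g x) > 6 * real m * ?\<nu>}"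
    then obtain x where x: "x \<in> sign_patterns m" "pnorm p n (compress d m A g x) > 6 * real m * ?\<nu>" by blast
    assume "\<not> (\<exists>x\<in>sign_patterns m. (\<Sum>k<r. (\<Sum>i<d. q k i * (\<Sum>l<m. g l i * x l))\<^sup>2) > 36 * (real m)\<^sup>2)"
    then have "(\<Sum>k<r. (\<Sum>i<d. q k i * (\<Sum>l<m. g l i * x l))\<^sup>2) \<le> (6 * real m)\<^sup>2"
      using x(1) by (auto simp: not_less power_mult_distrib)
    then have "sqrt (\<Sum>k<r. (\<Sum>i<d. q k i * (\<Sum>l<m. g l i * x l))\<^sup>2) \<le> 6 * real m"
      by (intro real_le_lsqrt) (auto intro!: sum_nonneg)
    then have "?\<nu> * sqrt (\<Sum>k<r. (\<Sum>i<d. q k i * (\<Sum>l<m. g l i * x l))\<^sup>2) \<le> ?\<nu> * (6 * real m)"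
      using nonneg by (intro mult_left_mono)
    moreover have "pnorm p n (compress d m A g x) = pnorm p n (\<lambda>i. \<Sum>j<d. A $$ (i, j) * (\<Sum>l<m. g l j * x l))"
      by (simp add: compress_def[abs_def])
    ultimately show False using bound[of "\<lambda>j. \<Sum>l<m. g l j * x l"] x(2) by (simp add: mult_ac)
  qed
  then have "measure_pmf.prob (sign_matrix m d)
     {g. \<exists>x\<in>sign_patterns m. pnorm p n (compress d m A g x) > 6 * real m * ?\<nu>} \<le>
     measure_pmf.prob (sign_matrix m d) {g. \<exists>x\<in>sign_patterns m. (\<Sum>k<r. (\<Sum>i<d. q k i * (\<Sum>l<m. g l i * x l))\<^sup>2) > 36 * (real m)\<^sup>2}"
    by (intro measure_pmf.finite_measure_mono) auto
  also have "\<dots> \<le> 1 / 40" by (intro sign_matrix_upper_all orth le1 m)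
  finally show ?thesis .
qed

section \<open>Independent blocks\<close>

definition heavy_family :: "real \<Rightarrow> nat \<Rightarrow> nat \<Rightarrow> nat \<Rightarrow> (nat \<Rightarrow> nat \<Rightarrow> nat \<Rightarrow> real) pmf" where
  "heavy_family p s n T = Pi_pmf {..<T} (\<lambda>_ _. 0) (\<lambda>_. heavy_block p s n)"

text \<open>A single vector is concerned, so Markov's inequality over the blocks is enough and
  doubles the failure 1/50 of one block.\<close>

lemma heavy_family_lower:
  assumes "s > 0" "n > 0" "p > 0" "T > 0" "pnorm p n y \<ge> \<tau>" "\<tau> > 0"
  shows "measure_pmf.prob (heavy_family p s n T)
    {h. T \<le> 2 * card {t. t < T \<and> \<not> (\<exists>j<32 * s. \<bar>\<Sum>i<n. h t j i * y i\<bar> \<ge> \<tau>)}} \<le> 1 / 25"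
proof -
  let ?N = "pnorm p n y"
  have N: "?N > 0" using assms by linarith
  have y1: "(\<Sum>i<n. \<bar>y i / ?N\<bar> powr p) = 1" using pnorm_scale[where c="?N" and z=y and p=p and n=n] N assms by simp
  have *: "measure_pmf.prob (heavy_block p s n) {h. \<not> (\<exists>j<32 * s. \<bar>\<Sum>i<n. h j i * y i\<bar> \<ge> \<tau>)} \<le> 1 / 50"
  proof -
    have "measure_pmf.prob (heavy_block p s n) {h. \<not> (\<exists>j<32 * s. \<bar>\<Sum>i<n. h j i * y i\<bar> \<ge> \<tau>)} \<le>
       measure_pmf.prob (heavy_block p s n) {h. \<not> (\<exists>j<32 * s. \<bar>\<Sum>i<n. h j i * (y i / ?N)\<bar> \<ge> 1)}"
    proof (intro measure_pmf.finite_measure_mono subsetI CollectI notI)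
      fix h assume h: "h \<in> {h. \<not> (\<exists>j<32 * s. \<bar>\<Sum>i<n. h j i * y i\<bar> \<ge> \<tau>)}"
      assume "\<exists>j<32 * s. \<bar>\<Sum>i<n. h j i * (y i / ?N)\<bar> \<ge> 1"
      then obtain j where j: "j < 32 * s" "\<bar>\<Sum>i<n. h j i * (y i / ?N)\<bar> \<ge> 1" by blast
      have "(\<Sum>i<n. h j i * (y i / ?N)) = (\<Sum>i<n. h j i * y i) / ?N" by (simp add: sum_divide_distrib)
      then have "1 \<le> \<bar>\<Sum>i<n. h j i * y i\<bar> / ?N"
        using j(2) by (simp only: abs_divide abs_of_pos[OF N])
      then have "\<bar>\<Sum>i<n. h j i * y i\<bar> \<ge> ?N" by (simp only: pos_le_divide_eq[OF N] mult_1)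
      then have "\<bar>\<Sum>i<n. h j i * y i\<bar> \<ge> \<tau>" using assms(5) by linarith
      then show False using h j by blast
    qed auto
    also have "\<dots> \<le> 1 / 50" using assms y1 by (intro heavy_block_lower) auto
    finally show ?thesis .
  qed
  have "measure_pmf.prob (heavy_family p s n T)
    {h. T \<le> 2 * card {t. t < T \<and> \<not> (\<exists>j<32 * s. \<bar>\<Sum>i<n. h t j i * y i\<bar> \<ge> \<tau>)}} \<le> 2 * (1 / 50)"
  proof (rule measure_half_le[OF _ assms(4)])
    fix t assume t: "t < T"
    have "measure_pmf.prob (heavy_family p s n T) {h. \<not> (\<exists>j<32 * s. \<bar>\<Sum>i<n. h t j i * y i\<bar> \<ge> \<tau>)} =
       measure_pmf.prob (heavy_block p s n) {h. \<not> (\<exists>j<32 * s. \<bar>\<Sum>i<n. h j i * y i\<bar> \<ge> \<tau>)}"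
      unfolding heavy_family_def using t
      by (intro Pi_pmf_component_prob[where B="\<lambda>h. \<not> (\<exists>j<32 * s. \<bar>\<Sum>i<n. h j i * y i\<bar> \<ge> \<tau>)"]) auto
    with * show "measure_pmf.prob (heavy_family p s n T) {h. \<not> (\<exists>j<32 * s. \<bar>\<Sum>i<n. h t j i * y i\<bar> \<ge> \<tau>)} \<le> 1 / 50" by simp
  qed
  then show ?thesis by simp
qed

text \<open>A block may fail with probability \<open>1 / 6400 = (1 / 80)^2\<close>. Then half of the
  \<open>m\<close> blocks fail with probability at most \<open>(1 / 40) ^ m\<close>, and the union
  over \<open>2 ^ m\<close> sign vectors leaves \<open>(1 / 20) ^ m\<close>.\<close>

lemma heavy_family_upper:
  fixes p :: real
  assumes "p > 2"
  obtains D where "D > 0" "\<And>n m B Y. n \<ge> 2 \<Longrightarrow> m > 0 \<Longrightarrow> B > 0 \<Longrightarrow>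
     (\<And>x. x \<in> sign_patterns m \<Longrightarrow> pnorm p n (Y x) \<le> B) \<Longrightarrow>
     measure_pmf.prob (heavy_family p (sparsity p n) n m)
      {h. \<exists>x\<in>sign_patterns m. m \<le> 2 * card {t. t < m \<and> (\<exists>j<32 * sparsity p n. \<bar>\<Sum>i<n. h t j i * Y x i\<bar> > D * B)}} \<le> 1 / 20"
proof -
  obtain D where D: "D > 0" "\<And>n y. n \<ge> 2 \<Longrightarrow> (\<Sum>i<n. \<bar>y i\<bar> powr p) \<le> 1 \<Longrightarrow>
    measure_pmf.prob (heavy_block p (sparsity p n) n)
      {h. \<exists>j<32 * sparsity p n. \<bar>\<Sum>i<n. h j i * y i\<bar> > D} \<le> 1 / 6400"
    by (rule heavy_block_upper[OF assms, of "1 / 6400"]) (simp, rule that)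
  show ?thesis
  proof (rule that[OF D(1)])
    fix n m :: nat and B :: real and Y :: "(nat \<Rightarrow> real) \<Rightarrow> nat \<Rightarrow> real"
    assume n: "n \<ge> 2" and m: "m > 0" and B: "B > 0" and Y: "\<And>x. x \<in> sign_patterns m \<Longrightarrow> pnorm p n (Y x) \<le> B"
    let ?s = "sparsity p n"
    let ?P = "heavy_family p ?s n m"
    let ?E = "\<lambda>x. {h. m \<le> 2 * card {t. t < m \<and> (\<exists>j<32 * ?s. \<bar>\<Sum>i<n. h t j i * Y x i\<bar> > D * B)}}"
    have single: "measure_pmf.prob ?P (?E x) \<le> (2 * (1 / 80)) ^ m" if x: "x \<in> sign_patterns m" for x
    proof -
      have "(pnorm p n (Y x) / B) powr p \<le> 1"
        using Y[OF x] B assms pnorm_nonneg[of p n "Y x"] by (intro powr_le1) (auto simp: field_simps)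
      then have "(\<Sum>i<n. \<bar>Y x i / B\<bar> powr p) \<le> 1"
        using pnorm_scale[where c=B and z="Y x" and p=p and n=n] B assms by simp
      from D(2)[OF n this] have "measure_pmf.prob (heavy_block p ?s n)
         {h. \<exists>j<32 * ?s. \<bar>\<Sum>i<n. h j i * (Y x i / B)\<bar> > D} \<le> 1 / 6400" .
      moreover have "(\<bar>\<Sum>i<n. h j i * (Y x i / B)\<bar> > D) = (\<bar>\<Sum>i<n. h j i * Y x i\<bar> > D * B)" for h :: "nat \<Rightarrow> nat \<Rightarrow> real" and j
      proof -
        have "(\<Sum>i<n. h j i * (Y x i / B)) = (\<Sum>i<n. h j i * Y x i) / B" by (simp add: sum_divide_distrib)
        then show ?thesis by (simp only: abs_divide abs_of_pos[OF B] pos_less_divide_eq[OF B])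
      qed
      ultimately have "measure_pmf.prob (heavy_block p ?s n) {h. \<exists>j<32 * ?s. \<bar>\<Sum>i<n. h j i * Y x i\<bar> > D * B} \<le> (1 / 80)\<^sup>2"
        by (simp add: power_divide)
      then show ?thesis unfolding heavy_family_def
        by (intro measure_half_bad_le[where B="\<lambda>h. \<exists>j<32 * ?s. \<bar>\<Sum>i<n. h j i * Y x i\<bar> > D * B"]) auto
    qed
    have "measure_pmf.prob ?P {h. \<exists>x\<in>sign_patterns m. m \<le> 2 * card {t. t < m \<and> (\<exists>j<32 * ?s. \<bar>\<Sum>i<n. h t j i * Y x i\<bar> > D * B)}}
       = measure_pmf.prob ?P (\<Union>x\<in>sign_patterns m. ?E x)" by (intro arg_cong2[where f=measure]) auto
    also have "\<dots> \<le> (\<Sum>x\<in>sign_patterns m. measure_pmf.prob ?P (?E x))"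
      by (intro measure_pmf.finite_measure_subadditive_finite finite_sign_patterns) auto
    also have "\<dots> \<le> (\<Sum>x\<in>sign_patterns m. (2 * (1 / 80)) ^ m)" by (intro sum_mono single)
    also have "\<dots> = (1 / 20) ^ m" by (simp add: card_sign_patterns power_mult_distrib[symmetric])
    also have "\<dots> \<le> (1 / 20) ^ 1" using m by (intro power_decreasing) auto
    finally show "measure_pmf.prob ?P {h. \<exists>x\<in>sign_patterns m. m \<le> 2 * card {t. t < m \<and> (\<exists>j<32 * ?s. \<bar>\<Sum>i<n. h t j i * Y x i\<bar> > D * B)}} \<le> 1 / 20"
      by simp
  qed
qed

section \<open>The sketching family\<close>

text \<open>The two inner operations compute an upper median over the blocks: the value is at least \<open>\<tau>\<close> iff
  half of the blocks are at least \<open>\<tau>\<close> for some sign vector. This form shows measurability directly.\<close>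

definition sketch_value :: "nat \<Rightarrow> nat \<Rightarrow> (nat \<Rightarrow> nat \<Rightarrow> nat \<Rightarrow> real) \<Rightarrow> real" where
  "sketch_value m q W =
     (MAX x\<in>sign_patterns m. MAX J\<in>{J. J \<subseteq> {..<m} \<and> m \<le> 2 * card J}.
        MIN t\<in>J. MAX j\<in>{..<q}. \<bar>\<Sum>l<m. W t j l * x l\<bar>)"

lemma sketch_value_ge:
  assumes "m > 0" "x \<in> sign_patterns m"
    and "\<not> m \<le> 2 * card {t. t < m \<and> \<not> (\<exists>j<q. \<bar>\<Sum>l<m. W t j l * x l\<bar> \<ge> \<tau>)}"
  shows "sketch_value m q W \<ge> \<tau>"
proof -
  let ?v = "\<lambda>x t. MAX j\<in>{..<q}. \<bar>\<Sum>l<m. W t j l * x l\<bar>"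
  let ?JJ = "{J. J \<subseteq> {..<m} \<and> m \<le> 2 * card J}"
  let ?J = "{t. t < m \<and> (\<exists>j<q. \<bar>\<Sum>l<m. W t j l * x l\<bar> \<ge> \<tau>)}"
  let ?J' = "{t. t < m \<and> \<not> (\<exists>j<q. \<bar>\<Sum>l<m. W t j l * x l\<bar> \<ge> \<tau>)}"
  have "card (?J \<union> ?J') = card ?J + card ?J'" by (intro card_Un_disjoint) auto
  moreover have "?J \<union> ?J' = {..<m}" by auto
  ultimately have "m = card ?J + card ?J'" by simp
  with assms(3) have big: "m \<le> 2 * card ?J" by linarith
  with assms(1) have "card ?J \<noteq> 0" by linarith
  then have ne: "?J \<noteq> {}" by (metis card.empty)
  have fin: "finite ?JJ" by simp
  have "\<tau> \<le> (MIN t\<in>?J. ?v x t)"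
  proof (rule Min.boundedI)
    fix a assume "a \<in> ?v x ` ?J"
    then obtain t j where t: "a = ?v x t" "j < q" "\<bar>\<Sum>l<m. W t j l * x l\<bar> \<ge> \<tau>" by auto
    have "\<bar>\<Sum>l<m. W t j l * x l\<bar> \<le> a" unfolding t(1) using t(2) by (intro Max_ge) auto
    with t show "\<tau> \<le> a" by linarith
  qed (use ne in auto)
  also have "\<dots> \<le> (MAX J\<in>?JJ. MIN t\<in>J. ?v x t)"
    by (rule Max_ge) (use fin big in auto)
  also have "\<dots> \<le> sketch_value m q W"
    unfolding sketch_value_def using assms(2) finite_sign_patterns by (intro Max_ge) auto
  finally show ?thesis .
qed

text \<open>A set holding half of the blocks cannot consist of exceeding blocks only, so its minimum
  is at most \<open>\<tau>\<close>.\<close>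

lemma sketch_value_le:
  assumes "m > 0" "q > 0"
    and "\<not> (\<exists>x\<in>sign_patterns m. m \<le> 2 * card {t. t < m \<and> (\<exists>j<q. \<bar>\<Sum>l<m. W t j l * x l\<bar> > \<tau>)})"
  shows "sketch_value m q W \<le> \<tau>"
proof -
  let ?v = "\<lambda>x t. MAX j\<in>{..<q}. \<bar>\<Sum>l<m. W t j l * x l\<bar>"
  let ?JJ = "{J. J \<subseteq> {..<m} \<and> m \<le> 2 * card J}"
  have fin: "finite ?JJ" by simp
  have "{..<m} \<in> ?JJ" by simp
  then have ne: "?JJ \<noteq> {}" by blast
  have nes: "sign_patterns m \<noteq> {}" by (metis card_sign_patterns card.empty power_eq_0_iff zero_neq_numeral)
  have inner: "(MIN t\<in>J. ?v x t) \<le> \<tau>" if x: "x \<in> sign_patterns m" and J: "J \<in> ?JJ" for x J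
  proof -
    let ?B = "{t. t < m \<and> (\<exists>j<q. \<bar>\<Sum>l<m. W t j l * x l\<bar> > \<tau>)}"
    have "\<not> J \<subseteq> ?B"
    proof
      assume "J \<subseteq> ?B"
      then have "card J \<le> card ?B" by (intro card_mono) auto
      then show False using J x assms(3) by force
    qed
    then obtain t where t: "t \<in> J" "t \<notin> ?B" by blast
    have fJ: "finite J" using J finite_subset by blast
    have "t < m" using t J by blast
    have "(MIN t\<in>J. ?v x t) \<le> ?v x t" using t fJ by (intro Min_le) auto
    also have "\<dots> \<le> \<tau>"
    proof (rule Max.boundedI)
      fix a assume "a \<in> (\<lambda>j. \<bar>\<Sum>l<m. W t j l * x l\<bar>) ` {..<q}"
      then obtain j where j: "j < q" "a = \<bar>\<Sum>l<m. W t j l * x l\<bar>" by auto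
      show "a \<le> \<tau>"
      proof (rule ccontr)
        assume "\<not> a \<le> \<tau>"
        then have "t \<in> ?B" using j \<open>t < m\<close> by auto
        with t(2) show False by contradiction
      qed
    qed (use assms(2) in auto)
    finally show ?thesis .
  qed
  have "(MAX J\<in>?JJ. MIN t\<in>J. ?v x t) \<le> \<tau>" if "x \<in> sign_patterns m" for x
    by (rule Max.boundedI) (use fin ne inner[OF that] in blast)+
  then show ?thesis
    unfolding sketch_value_def by (intro Max.boundedI) (use finite_sign_patterns nes in auto)
qed

section \<open>The sketch as a linear map\<close>

definition sketch_index :: "nat \<Rightarrow> nat \<Rightarrow> nat \<Rightarrow> nat \<Rightarrow> nat \<Rightarrow> nat" where
  "sketch_index m q t j l = (t * q + j) * m + l"

lemma sketch_index_less:
  assumes "t < m" "j < q" "l < m"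
  shows "sketch_index m q t j l < m * q * m"
proof -
  have "(t * q + j) * m + l < (t * q + j) * m + m" using assms by simp
  also have "\<dots> = (t * q + (j + 1)) * m" by (simp add: algebra_simps)
  also have "\<dots> \<le> (t * q + q) * m" using assms by (intro mult_right_mono add_left_mono) auto
  also have "\<dots> = (t + 1) * q * m" by (simp add: algebra_simps)
  also have "\<dots> \<le> m * q * m" using assms by (intro mult_right_mono) auto
  finally show ?thesis by (simp add: sketch_index_def)
qed

lemma sketch_index_decode:
  assumes "j < q" "l < m"
  shows "sketch_index m q t j l mod m = l" "sketch_index m q t j l div m mod q = j"
    "sketch_index m q t j l div m div q = t"
  using assms by (auto simp: sketch_index_def)

text \<open>The entries of \<open>H_t A G\<close> for all blocks \<open>H_t\<close>, flattened by
  \<open>sketch_index\<close>. Restricting to the carrier gives the extensionality that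
  \<open>linear_maps\<close> asks for.\<close>

definition sketch_map :: "nat \<Rightarrow> nat \<Rightarrow> nat \<Rightarrow> nat \<Rightarrow> (nat \<Rightarrow> nat \<Rightarrow> real) \<Rightarrow> (nat \<Rightarrow> nat \<Rightarrow> nat \<Rightarrow> real)
    \<Rightarrow> real Matrix.mat \<Rightarrow> real Matrix.vec" where
  "sketch_map n d m q g h = (\<lambda>A\<in>carrier_mat n d. Matrix.vec (m * q * m)
     (\<lambda>a. \<Sum>i<n. h (a div m div q) (a div m mod q) i * (\<Sum>j<d. A $$ (i, j) * g (a mod m) j)))"

lemma sketch_map_linear: "sketch_map n d m q g h \<in> linear_maps n d (m * q * m)"
proof -
  let ?L = "sketch_map n d m q g h"
  have "?L \<in> module_hom class_ring (module_mat TYPE(real) n d) (module_vec TYPE(real) (m * q * m))"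
    unfolding module_hom_def module_vec_simps module_mat_simps
  proof (intro CollectI conjI allI impI)
    show "?L \<in> carrier_mat n d \<rightarrow> carrier_vec (m * q * m)" by (auto simp: sketch_map_def)
  next
    fix A B :: "real Matrix.mat" assume "A \<in> carrier_mat n d \<and> B \<in> carrier_mat n d"
    then have A: "A \<in> carrier_mat n d" and B: "B \<in> carrier_mat n d" by auto
    show "?L (A + B) = ?L A + ?L B"
    proof (rule eq_vecI)
      fix a assume "a < dim_vec (?L A + ?L B)"
      then have a: "a < m * q * m" using A B by (simp add: sketch_map_def)
      have "(\<Sum>i<n. h (a div m div q) (a div m mod q) i * (\<Sum>j<d. (A + B) $$ (i, j) * g (a mod m) j)) =
        (\<Sum>i<n. h (a div m div q) (a div m mod q) i * (\<Sum>j<d. A $$ (i, j) * g (a mod m) j)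
          + h (a div m div q) (a div m mod q) i * (\<Sum>j<d. B $$ (i, j) * g (a mod m) j))"
        using A B by (intro sum.cong refl) (simp add: distrib_left distrib_right sum.distrib)
      then show "vec_index (?L (A + B)) a = vec_index (?L A + ?L B) a"
        using A B a by (simp add: sketch_map_def sum.distrib)
    qed (use A B in \<open>simp add: sketch_map_def\<close>)
  next
    fix c :: real and A :: "real Matrix.mat"
    assume "c \<in> carrier class_ring \<and> A \<in> carrier_mat n d"
    then have A: "A \<in> carrier_mat n d" by simp
    show "?L (c \<cdot>\<^sub>m A) = c \<cdot>\<^sub>v ?L A"
    proof (rule eq_vecI)
      fix a assume "a < dim_vec (c \<cdot>\<^sub>v ?L A)"
      then have a: "a < m * q * m" using A by (simp add: sketch_map_def)
      have "(\<Sum>i<n. h (a div m div q) (a div m mod q) i * (\<Sum>j<d. (c \<cdot>\<^sub>m A) $$ (i, j) * g (a mod m) j)) =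
        (\<Sum>i<n. c * (h (a div m div q) (a div m mod q) i * (\<Sum>j<d. A $$ (i, j) * g (a mod m) j)))"
        using A by (intro sum.cong refl) (simp add: sum_distrib_left mult_ac)
      then show "vec_index (?L (c \<cdot>\<^sub>m A)) a = vec_index (c \<cdot>\<^sub>v ?L A) a"
        using A a by (simp add: sketch_map_def sum_distrib_left)
    qed (use A in \<open>simp add: sketch_map_def\<close>)
  qed
  then have "linear_map class_ring (module_mat TYPE(real) n d) (module_vec TYPE(real) (m * q * m)) ?L"
    using matrix_vs[where 'a=real, of n d] vec_vs[where 'a=real, of "m * q * m"]
    by (simp add: linear_map_def mod_hom_def mod_hom_axioms_def vectorspace_def)
  then show ?thesis by (auto simp: linear_maps_def sketch_map_def)
qed

text \<open>Associativity, \<open>(H A G) x = H (A G x)\<close>: all sign vectors are evaluated from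
  the same stored numbers, after the measurement.\<close>

lemma sketch_map_eval:
  assumes "A \<in> carrier_mat n d" "t < m" "j < q"
  shows "(\<Sum>l<m. vec_index (sketch_map n d m q g h A) (sketch_index m q t j l) * x l) =
    (\<Sum>i<n. h t j i * compress d m A g x i)"
proof -
  have "vec_index (sketch_map n d m q g h A) (sketch_index m q t j l) = (\<Sum>i<n. h t j i * (\<Sum>j'<d. A $$ (i, j') * g l j'))"
    if "l < m" for l
    using assms that by (simp add: sketch_map_def sketch_index_less sketch_index_decode)
  then have "(\<Sum>l<m. vec_index (sketch_map n d m q g h A) (sketch_index m q t j l) * x l) =
     (\<Sum>l<m. \<Sum>i<n. \<Sum>j'<d. h t j i * (A $$ (i, j') * (g l j' * x l)))"
    by (intro sum.cong refl) (simp add: sum_distrib_left sum_distrib_right mult.assoc)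
  also have "\<dots> = (\<Sum>i<n. \<Sum>l<m. \<Sum>j'<d. h t j i * (A $$ (i, j') * (g l j' * x l)))" by (rule sum.swap)
  also have "\<dots> = (\<Sum>i<n. \<Sum>j'<d. \<Sum>l<m. h t j i * (A $$ (i, j') * (g l j' * x l)))"
    by (intro sum.cong refl sum.swap)
  also have "\<dots> = (\<Sum>i<n. h t j i * compress d m A g x i)"
    by (simp only: compress_def sum_distrib_left)
  finally show ?thesis .
qed

section \<open>Measurability of the estimator\<close>

lemma space_linear_maps_algebra: "space (linear_maps_algebra n d k) = linear_maps n d k"
  unfolding linear_maps_algebra_def by (rule space_measure_of) auto

lemma measurable_linear_maps_coordinate:
  assumes "A \<in> carrier_mat n d" "i < k"
  shows "(\<lambda>L. vec_index (L A) i) \<in> borel_measurable (linear_maps_algebra n d k)"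
proof (rule measurableI)
  fix B :: "real set" assume B: "B \<in> sets borel"
  have "(\<lambda>L. vec_index (L A) i) -` B \<inter> space (linear_maps_algebra n d k) =
     {L \<in> linear_maps n d k. vec_index (L A) i \<in> B}"
    by (auto simp: space_linear_maps_algebra)
  also have "\<dots> \<in> sets (linear_maps_algebra n d k)"
    unfolding linear_maps_algebra_def using assms B by (intro in_measure_of) auto
  finally show "(\<lambda>L. vec_index (L A) i) -` B \<inter> space (linear_maps_algebra n d k) \<in> sets (linear_maps_algebra n d k)" .
qed simp

text \<open>The division by \<open>m\<close> undoes the growth of the maximum over sign vectors,
  which is of order \<open>m\<close> times the operator norm.\<close>

definition sketch_estimate :: "nat \<Rightarrow> nat \<Rightarrow> real Matrix.vec \<Rightarrow> real" where
  "sketch_estimate m q v = sketch_value m q (\<lambda>t j l. vec_index v (sketch_index m q t j l)) / real m"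

lemma measurable_sketch_estimate:
  assumes "A \<in> carrier_mat n d"
  shows "(\<lambda>L. sketch_estimate m q (L A)) \<in> borel_measurable (linear_maps_algebra n d (m * q * m))"
proof -
  have coord: "(\<lambda>L. vec_index (L A) (sketch_index m q t j l)) \<in> borel_measurable (linear_maps_algebra n d (m * q * m))"
    if "t < m" "j < q" "l < m" for t j l
    using assms that by (intro measurable_linear_maps_coordinate sketch_index_less)
  show ?thesis
    unfolding sketch_estimate_def sketch_value_def
  proof (intro borel_measurable_divide borel_measurable_const borel_measurable_Max borel_measurable_Min finite_sign_patterns)
    fix J assume J: "J \<in> {J. J \<subseteq> {..<m} \<and> m \<le> 2 * card J}"
    then show "finite J" using finite_subset by blast
    fix x t j assume "t \<in> J" "j \<in> {..<q}"
    then show "(\<lambda>L. \<bar>\<Sum>l<m. vec_index (L A) (sketch_index m q t j l) * x l\<bar>)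
        \<in> borel_measurable (linear_maps_algebra n d (m * q * m))"
      using J coord by (intro borel_measurable_abs borel_measurable_sum borel_measurable_times borel_measurable_const) auto
  qed auto
qed

text \<open>The open target interval is empty when the norm is 0, so the zero matrix has to be
  excluded; the entry found here also yields \<open>d > 0\<close>.\<close>

lemma rank_pos_imp_nonzero:
  fixes A :: "real Matrix.mat"
  assumes A: "A \<in> carrier_mat n d" and r: "vec_space.rank n A \<ge> 1"
  obtains i j where "i < n" "j < d" "A $$ (i, j) \<noteq> 0"
proof -
  have "\<exists>i j. i < n \<and> j < d \<and> A $$ (i, j) \<noteq> 0"
  proof (rule ccontr)
    assume "\<not> ?thesis"
    then have "A = 0\<^sub>m n d" using A by (intro eq_matI) auto
    then have "vec_space.rank n A = 0" using vec_space.rank_0I[of n d] by simp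
    with r show False by simp
  qed
  then show ?thesis using that by blast
qed

theorem theorem3p5:
  fixes p :: real
  assumes "p > 2"
  shows "\<exists>c > 1. \<exists>C > 0. \<forall>n d r :: nat. n \<ge> 2 \<longrightarrow> r \<ge> 1 \<longrightarrow>
    (\<exists>k :: nat. real k \<le> C * (real n powr (1 - 2 / p) * (real r)\<^sup>2 * ln (real n)) \<and>
      (\<exists>S f. sketching_family n d k c 2 p {A \<in> carrier_mat n d. vec_space.rank n A = r} S f))"
proof (rule heavy_family_upper[OF assms])
  fix D :: real
  assume D: "D > 0" "\<And>n m B Y. n \<ge> 2 \<Longrightarrow> m > 0 \<Longrightarrow> B > 0 \<Longrightarrow>
     (\<And>x. x \<in> sign_patterns m \<Longrightarrow> pnorm p n (Y x) \<le> B) \<Longrightarrow>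
     measure_pmf.prob (heavy_family p (sparsity p n) n m)
      {h. \<exists>x\<in>sign_patterns m. m \<le> 2 * card {t. t < m \<and> (\<exists>j<32 * sparsity p n. \<bar>\<Sum>i<n. h t j i * Y x i\<bar> > D * B)}} \<le> 1 / 20"
  \<comment> \<open>The estimate will lie between \<open>1 / 40\<close> and \<open>6 * D\<close>
    times the norm; \<open>c\<close> leaves room for strict inequalities on both sides.\<close>
  define c where "c = 41 + 6 * D"
  \<comment> \<open>\<open>153600 = 40^2 * 32 * 3\<close>, where the 3 comes from rounding in
    \<open>sparsity\<close>.\<close>
  define C :: real where "C = 153600"
  have p1: "p > 1" "p > 0" using assms by auto
  have main: "\<exists>k :: nat. real k \<le> C * (real n powr (1 - 2 / p) * (real r)\<^sup>2 * ln (real n)) \<and>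
      (\<exists>S f. sketching_family n d k c 2 p {A \<in> carrier_mat n d. vec_space.rank n A = r} S f)"
    if n: "n \<ge> 2" and r: "r \<ge> 1" for n d r :: nat
  proof -
    define s where "s = sparsity p n"
    note sb = sparsity_bounds[OF n assms, folded s_def]
    \<comment> \<open>\<open>compress_lower\<close> asks for \<open>m \<ge> 40\<close> and
      \<open>compress_upper\<close> for \<open>r \<le> m\<close>.\<close>
    define m where "m = 40 * r"
    define q where "q = 32 * s"
    have m: "m > 0" "m \<ge> 40" "r \<le> m" using r by (auto simp: m_def)
    have q: "q > 0" using sb by (simp add: q_def)
    define k where "k = m * q * m"
    define P where "P = pair_pmf (sign_matrix m d) (heavy_family p s n m)"
    define F where "F = (\<lambda>(g, h). sketch_map n d m q g h)"
    define S where "S = distr (measure_pmf P) (linear_maps_algebra n d k) F"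
    have F: "F \<in> measurable (measure_pmf P) (linear_maps_algebra n d k)"
      using sketch_map_linear by (auto simp: F_def k_def space_linear_maps_algebra)
    have "real k = 51200 * (real s * (real r)\<^sup>2)"
      by (simp add: k_def m_def q_def power2_eq_square)
    also have "\<dots> \<le> 51200 * (3 * (real n powr (1 - 2 / p) * ln (real n)) * (real r)\<^sup>2)"
      using sb by (intro mult_left_mono mult_right_mono) auto
    finally have k: "real k \<le> C * (real n powr (1 - 2 / p) * (real r)\<^sup>2 * ln (real n))"
      by (simp add: C_def mult_ac)
    have "measure S {L \<in> space S. sketch_estimate m q (L A) \<in> {1 / c * op_norm 2 p A <..< c * op_norm 2 p A}} \<ge> 5 / 6"
      if A: "A \<in> carrier_mat n d" and rank: "vec_space.rank n A = r" for A
    proof -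
      define \<nu> where "\<nu> = op_norm 2 p A"
      obtain i0 j0 where ij: "i0 < n" "j0 < d" "A $$ (i0, j0) \<noteq> 0"
        using rank_pos_imp_nonzero[OF A] rank r by metis
      have \<nu>: "\<nu> > 0" unfolding \<nu>_def using op_norm_pos[OF A p1(1) ij] .
      have d: "d > 0" using ij by simp
      let ?Y = "compress d m A"
      define B1 where "B1 = {g. \<not> (\<exists>x\<in>sign_patterns m. pnorm p n (?Y g x) \<ge> real m * \<nu> / 40)}"
      define B2 where "B2 = {g. \<exists>x\<in>sign_patterns m. pnorm p n (?Y g x) > 6 * real m * \<nu>}"
      define E where "E g h \<longleftrightarrow> \<not> (1 / c * \<nu> < sketch_estimate m q (sketch_map n d m q g h A)
          \<and> sketch_estimate m q (sketch_map n d m q g h A) < c * \<nu>)" for g h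
      have B: "measure_pmf.prob (sign_matrix m d) (B1 \<union> B2) \<le> 1 / 40 + 1 / 40"
      proof -
        have "measure_pmf.prob (sign_matrix m d) (B1 \<union> B2) \<le>
           measure_pmf.prob (sign_matrix m d) B1 + measure_pmf.prob (sign_matrix m d) B2"
          by (rule measure_Un_le) auto
        moreover have "measure_pmf.prob (sign_matrix m d) B1 \<le> 1 / 40"
          unfolding B1_def \<nu>_def using \<nu> by (intro compress_lower A p1 d m) (simp add: \<nu>_def)
        moreover have "measure_pmf.prob (sign_matrix m d) B2 \<le> 1 / 40"
          unfolding B2_def \<nu>_def using \<nu> by (intro compress_upper[OF A p1(1) rank] m) (simp add: \<nu>_def)
        ultimately show ?thesis by linarith
      qed
      have good: "measure_pmf.prob (heavy_family p s n m) {h. E g h} \<le> 1 / 25 + 1 / 20" if g: "g \<notin> B1 \<union> B2" for g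
      proof -
        obtain x0 where x0: "x0 \<in> sign_patterns m" "pnorm p n (?Y g x0) \<ge> real m * \<nu> / 40"
          using g by (auto simp: B1_def)
        have up: "pnorm p n (?Y g x) \<le> 6 * real m * \<nu>" if "x \<in> sign_patterns m" for x
          using g that by (auto simp: B2_def not_less)
        define H1 where "H1 = {h. m \<le> 2 * card {t. t < m \<and> \<not> (\<exists>j<q. \<bar>\<Sum>i<n. h t j i * ?Y g x0 i\<bar> \<ge> real m * \<nu> / 40)}}"
        define H2 where "H2 = {h. \<exists>x\<in>sign_patterns m. m \<le> 2 * card {t. t < m \<and> (\<exists>j<q. \<bar>\<Sum>i<n. h t j i * ?Y g x i\<bar> > D * (6 * real m * \<nu>))}}"
        have "measure_pmf.prob (heavy_family p s n m) H1 \<le> 1 / 25"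
          unfolding H1_def q_def using sb n p1 m x0 \<nu> by (intro heavy_family_lower) auto
        moreover have "measure_pmf.prob (heavy_family p s n m) H2 \<le> 1 / 20"
          unfolding H2_def q_def s_def using n m \<nu> up by (intro D) auto
        moreover have "measure_pmf.prob (heavy_family p s n m) (H1 \<union> H2) \<le>
           measure_pmf.prob (heavy_family p s n m) H1 + measure_pmf.prob (heavy_family p s n m) H2"
          by (rule measure_Un_le) auto
        moreover have "measure_pmf.prob (heavy_family p s n m) {h. E g h} \<le> measure_pmf.prob (heavy_family p s n m) (H1 \<union> H2)"
        proof (intro measure_pmf.finite_measure_mono subsetI)
          fix h assume h: "h \<in> {h. E g h}"
          show "h \<in> H1 \<union> H2"
          proof (rule ccontr)
            assume hn: "h \<notin> H1 \<union> H2"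
            let ?W = "\<lambda>t j l. vec_index (sketch_map n d m q g h A) (sketch_index m q t j l)"
            have eval: "(\<Sum>l<m. ?W t j l * x l) = (\<Sum>i<n. h t j i * ?Y g x i)" if "t < m" "j < q" for t j x
              using sketch_map_eval[OF A that] .
            have s1: "{t. t < m \<and> \<not> (\<exists>j<q. \<bar>\<Sum>l<m. ?W t j l * x0 l\<bar> \<ge> real m * \<nu> / 40)} =
               {t. t < m \<and> \<not> (\<exists>j<q. \<bar>\<Sum>i<n. h t j i * ?Y g x0 i\<bar> \<ge> real m * \<nu> / 40)}"
              by (intro Collect_cong conj_cong refl arg_cong[where f=Not] ex_cong1) (simp add: eval)
            have s2: "{t. t < m \<and> (\<exists>j<q. \<bar>\<Sum>l<m. ?W t j l * x l\<bar> > D * (6 * real m * \<nu>))} =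
               {t. t < m \<and> (\<exists>j<q. \<bar>\<Sum>i<n. h t j i * ?Y g x i\<bar> > D * (6 * real m * \<nu>))}" for x
              by (intro Collect_cong conj_cong refl ex_cong1) (simp add: eval)
            have "sketch_value m q ?W \<ge> real m * \<nu> / 40"
              by (rule sketch_value_ge[OF m(1) x0(1)]) (unfold s1, use hn in \<open>simp add: H1_def\<close>)
            then have ge: "sketch_estimate m q (sketch_map n d m q g h A) \<ge> \<nu> / 40"
              using m by (simp add: sketch_estimate_def field_simps)
            have "sketch_value m q ?W \<le> D * (6 * real m * \<nu>)"
              by (rule sketch_value_le[OF m(1) q]) (unfold s2, use hn in \<open>simp add: H2_def\<close>)
            then have le: "sketch_estimate m q (sketch_map n d m q g h A) \<le> 6 * D * \<nu>"
              using m by (simp add: sketch_estimate_def field_simps)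
            have "1 / c * \<nu> < 1 / 40 * \<nu>"
              using D(1) \<nu> by (intro mult_strict_right_mono divide_strict_left_mono) (auto simp: c_def)
            also have "1 / 40 * \<nu> = \<nu> / 40" by simp
            also note ge
            finally have "1 / c * \<nu> < sketch_estimate m q (sketch_map n d m q g h A)" .
            moreover have "6 * D * \<nu> < c * \<nu>" using \<nu> by (intro mult_strict_right_mono) (auto simp: c_def)
            with le have "sketch_estimate m q (sketch_map n d m q g h A) < c * \<nu>" by (rule le_less_trans)
            ultimately have "\<not> E g h" by (simp only: E_def simp_thms)
            with h show False by simp
          qed
        qed auto
        ultimately show ?thesis by linarith
      qed
      have "measure_pmf.prob P {(g, h). E g h} \<le> measure_pmf.prob (sign_matrix m d) (B1 \<union> B2) + (1 / 25 + 1 / 20)"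
        unfolding P_def using good by (intro measure_pair_pmf_le) auto
      \<comment> \<open>The failures add up to \<open>1/40 + 1/40 + 1/25 + 1/20 = 7/50\<close>,
        which is below 1/6.\<close>
      with B have bad: "measure_pmf.prob P {(g, h). E g h} \<le> 1 / 6" by simp
      have sp: "space S = linear_maps n d k" by (simp add: S_def space_linear_maps_algebra)
      let ?G = "{L \<in> space S. sketch_estimate m q (L A) \<in> {1 / c * \<nu> <..< c * \<nu>}}"
      have meas: "?G \<in> sets (linear_maps_algebra n d k)"
      proof -
        have "(\<lambda>L. sketch_estimate m q (L A)) \<in> borel_measurable (linear_maps_algebra n d k)"
          unfolding k_def by (rule measurable_sketch_estimate[OF A])
        from measurable_sets[OF this, of "{1 / c * \<nu> <..< c * \<nu>}"] show ?thesis
          by (simp add: vimage_def Int_def conj_commute sp space_linear_maps_algebra)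
      qed
      have "measure S ?G = measure_pmf.prob P (F -` ?G)"
        unfolding S_def using F meas by (simp add: measure_distr S_def)
      also have "F -` ?G = UNIV - {(g, h). E g h}"
        using sketch_map_linear by (auto simp: F_def E_def sp k_def)
      also have "measure_pmf.prob P (UNIV - {(g, h). E g h}) = 1 - measure_pmf.prob P {(g, h). E g h}"
        using measure_pmf.prob_compl[of "{(g, h). E g h}" P] by simp
      finally show ?thesis using bad by (simp add: \<nu>_def)
    qed
    moreover have "prob_space S" unfolding S_def by (rule measure_pmf.prob_space_distr[OF F])
    ultimately have "sketching_family n d k c 2 p {A \<in> carrier_mat n d. vec_space.rank n A = r} S (sketch_estimate m q)"
      unfolding sketching_family_def by (auto simp: S_def space_linear_maps_algebra)
    with k show ?thesis by blast
  qed
  have "c > 1" "C > 0" using D(1) by (auto simp: c_def C_def)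
  with main show ?thesis by blast
qed

end
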